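(* Let $k$ be an arbitrary field. The following statements are equivalent: (i) Every finite group is a Galois group over $k$. (ii) Every finite group is a pre-Galois group over $k$. (iii) Every finite group is a normal subgroup of a Galois group over $k$. (iv) Every complete finite group is a normal subgroup of a Galois group over $k$.
   Context: A finite group is a Galois group over $k$ if it is isomorphic to $\mathrm{Gal}(N/k)$ for some finite Galois field extension $N/k$. A finite field extension $E/k$ is pre-Galois with group $G$ if there is a finite Galois extension $L/k$ such that $E\otimes_k L$ is a Galois field extension of $L$ with Galois group $G$; then $G$ is called a pre-Galois group over $k$. "Is a normal subgroup of" means "is isomorphic to a normal subgroup of". A group $G$ is complete if both its center $Z(G)$ and its outer automorphism group $\mathrm{Out}(G)$ are trivial. *)

theory Defs
  imports "HOL-Algebra.Algebra"
begin

section \<open>Galois extensions and Galois groups\<close>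

text \<open>
  An extension of \<open>k\<close> is a pair of a field \<open>N\<close> and a (necessarily injective) unital ring
  homomorphism \<open>\<phi>\<close> from \<open>k\<close> to \<open>N\<close>; \<open>k\<close> is identified with its image.
\<close>

definition finite_field_extension ::
    "('a, 'm) ring_scheme \<Rightarrow> ('b, 'n) ring_scheme \<Rightarrow> ('a \<Rightarrow> 'b) \<Rightarrow> bool"
  where "finite_field_extension k N \<phi> \<longleftrightarrow>
    field k \<and> field N \<and> \<phi> \<in> ring_hom k N \<and>
    ring.finite_dimension N (\<phi> ` carrier k) (carrier N)"

definition relative_auts ::
    "('a, 'm) ring_scheme \<Rightarrow> ('b, 'n) ring_scheme \<Rightarrow> ('a \<Rightarrow> 'b) \<Rightarrow> ('b \<Rightarrow> 'b) set"
  where "relative_auts k N \<phi> =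
    {\<sigma> \<in> Bij (carrier N). \<sigma> \<in> ring_hom N N \<and> (\<forall>a \<in> carrier k. \<sigma> (\<phi> a) = \<phi> a)}"

definition Gal ::
    "('a, 'm) ring_scheme \<Rightarrow> ('b, 'n) ring_scheme \<Rightarrow> ('a \<Rightarrow> 'b) \<Rightarrow> ('b \<Rightarrow> 'b) monoid"
  where "Gal k N \<phi> = BijGroup (carrier N) \<lparr>carrier := relative_auts k N \<phi>\<rparr>"

text \<open>
  Galois is taken in Artin's sense: the base field is the whole fixed field of the group of
  relative automorphisms.
\<close>

definition finite_galois_extension ::
    "('a, 'm) ring_scheme \<Rightarrow> ('b, 'n) ring_scheme \<Rightarrow> ('a \<Rightarrow> 'b) \<Rightarrow> bool"
  where "finite_galois_extension k N \<phi> \<longleftrightarrow>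
    finite_field_extension k N \<phi> \<and>
    {x \<in> carrier N. \<forall>\<sigma> \<in> relative_auts k N \<phi>. \<sigma> x = x} = \<phi> ` carrier k"

definition finite_group :: "('g, 'm) monoid_scheme \<Rightarrow> bool"
  where "finite_group G \<longleftrightarrow> group G \<and> finite (carrier G)"

text \<open>
  Every finite group is isomorphic to one on a set of natural numbers (see
  \<open>finite_group_on_nat\<close>), and all properties of groups below are isomorphism invariant, so
  ``every finite group'' can be rendered by quantifying over \<^typ>\<open>nat monoid\<close>.

  Every finite extension of \<open>k\<close> is isomorphic to one whose elements are lists over \<open>k\<close>
  (coordinate vectors with respect to a basis); see \<open>finite_field_extension_on_lists\<close>.
  So bounding the extension fields by the type \<^typ>\<open>'a list\<close> excludes nothing.
\<close>

definition is_galois_group_over :: "('g, 'n) monoid_scheme \<Rightarrow> ('a, 'm) ring_scheme \<Rightarrow> bool"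
  where "is_galois_group_over G k \<longleftrightarrow>
    finite_group G \<and>
    (\<exists>(N :: 'a list ring) \<phi>. finite_galois_extension k N \<phi> \<and> G \<cong> Gal k N \<phi>)"

lemma finite_group_on_nat:
  fixes G :: "('g, 'm) monoid_scheme"
  assumes "finite_group G"
  shows "\<exists>H :: nat monoid. finite_group H \<and> G \<cong> H"
proof -
  interpret group G using assms by (simp add: finite_group_def)
  obtain f :: "'g \<Rightarrow> nat" where f: "inj_on f (carrier G)"
    using assms finite_imp_inj_to_nat_seg unfolding finite_group_def by blast
  have "group (image_group f G)"
    using inj_imp_image_group_is_group[OF f] .
  moreover have "f \<in> iso G (image_group f G)"
    using inj_imp_image_group_iso[OF f] .
  ultimately show ?thesis
    using assms by (auto simp: finite_group_def image_group_carrier is_iso_def intro!: exI[of _ "image_group f G"])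
qed

lemma finite_field_extension_on_lists:
  fixes k :: "('a, 'm) ring_scheme" and N :: "('b, 'n) ring_scheme"
  assumes "finite_field_extension k N \<phi>"
  shows "\<exists>(N' :: 'a list ring) \<iota>. \<iota> \<in> ring_iso N N' \<and> finite_field_extension k N' (\<iota> \<circ> \<phi>)"
proof -
  have k: "field k" and N: "field N" and \<phi>: "\<phi> \<in> ring_hom k N"
    and fd: "ring.finite_dimension N (\<phi> ` carrier k) (carrier N)"
    using assms by (auto simp: finite_field_extension_def)
  interpret k: field k by fact
  interpret N: field N by fact
  interpret \<phi>: ring_hom_ring k N \<phi>
    using ring_hom_ringI2[OF k.ring_axioms N.ring_axioms \<phi>] .
  let ?K = "\<phi> ` carrier k"
  have K: "subfield ?K N"
    using \<phi>.img_is_subfield(2)[OF k.carrier_is_subfield] N.one_not_zero by simp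
  obtain n where n: "N.dimension n ?K (carrier N)"
    using fd by (auto simp: N.finite_dimension_def)
  obtain Us where Us: "set Us \<subseteq> carrier N" "N.Span ?K Us = carrier N"
    using N.exists_base[OF K n] by blast
  have surj: "carrier N \<subseteq> (\<lambda>as. N.combine (map \<phi> as) Us) ` UNIV"
  proof
    fix x assume "x \<in> carrier N"
    then obtain Ks where "set Ks \<subseteq> ?K" "x = N.combine Ks Us"
      using N.Span_eq_combine_set[OF K Us(1)] Us(2) by blast
    moreover from this(1) have "Ks = map \<phi> (map (inv_into (carrier k) \<phi>) Ks)"
      by (auto simp: map_idI f_inv_into_f subset_iff)
    ultimately show "x \<in> (\<lambda>as. N.combine (map \<phi> as) Us) ` UNIV"
      by (metis rangeI)
  qed
  define f :: "'b \<Rightarrow> 'a list" where "f = inv_into UNIV (\<lambda>as. N.combine (map \<phi> as) Us)"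
  have f: "inj_on f (carrier N)"
    unfolding f_def using inj_on_inv_into[OF surj] .
  let ?N' = "image_ring f N"
  have iso: "f \<in> ring_iso N ?N'"
    using inj_imp_image_ring_iso[OF f] .
  have N': "field ?N'"
    using N.inj_imp_image_ring_is_field[OF f] .
  interpret N': field ?N' by fact
  have hom: "f \<in> ring_hom N ?N'"
    using iso by (simp add: ring_iso_def)
  interpret f: ring_hom_ring N ?N' f
    using ring_hom_ringI2[OF N.ring_axioms N'.ring_axioms hom] .
  have "N'.dimension n (f ` ?K) (f ` carrier N)"
    using f.inj_hom_dimension[OF K _ f n] N'.one_not_zero by simp
  then have "N'.finite_dimension ((f \<circ> \<phi>) ` carrier k) (carrier ?N')"
    unfolding N'.finite_dimension_def by (auto simp: image_comp image_ring_carrier)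
  moreover have "f \<circ> \<phi> \<in> ring_hom k ?N'"
    using ring_hom_trans[OF \<phi> hom] .
  ultimately show ?thesis
    using k N' iso by (auto simp: finite_field_extension_def intro!: exI[of _ ?N'] exI[of _ f])
qed


section \<open>Tensor products of commutative algebras\<close>

text \<open>
  The integral monoid ring of the multiplicative monoid of \<open>E \<times> L\<close>. In the quotient below
  the basis element \<^term>\<open>frag_of (x, y)\<close> becomes the pure tensor of \<open>x\<close> and \<open>y\<close>.
\<close>

definition tensor_pairs ::
    "('b, 'm) ring_scheme \<Rightarrow> ('c, 'n) ring_scheme \<Rightarrow> ('b \<times> 'c \<Rightarrow>\<^sub>0 int) ring"
  where "tensor_pairs E L =
    \<lparr>carrier = {c. Poly_Mapping.keys c \<subseteq> carrier E \<times> carrier L},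
     monoid.mult = (\<lambda>c d. frag_extend (\<lambda>(x, y). frag_extend (\<lambda>(x', y').
               frag_of (x \<otimes>\<^bsub>E\<^esub> x', y \<otimes>\<^bsub>L\<^esub> y')) d) c),
     one = frag_of (\<one>\<^bsub>E\<^esub>, \<one>\<^bsub>L\<^esub>),
     ring.zero = 0,
     ring.add = (+)\<rparr>"

lemma cring_tensor_pairs:
  assumes "cring E" and "cring L"
  shows "cring (tensor_pairs E L)"
proof -
  interpret E: cring E by fact
  interpret L: cring L by fact
  define S where "S = carrier E \<times> carrier L"
  define R where "R = tensor_pairs E L"
  define e where "e = (\<lambda>p q. (fst p \<otimes>\<^bsub>E\<^esub> fst q, snd p \<otimes>\<^bsub>L\<^esub> snd q))"
  have e_closed: "e p q \<in> S" if "p \<in> S" "q \<in> S" for p q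
    using that by (auto simp: e_def S_def)
  have e_assoc: "e (e p q) r = e p (e q r)" if "p \<in> S" "q \<in> S" "r \<in> S" for p q r
    using that by (auto simp: e_def S_def E.m_assoc L.m_assoc)
  have e_comm: "e p q = e q p" if "p \<in> S" "q \<in> S" for p q
    using that by (auto simp: e_def S_def E.m_comm L.m_comm)
  have e_one: "e (\<one>\<^bsub>E\<^esub>, \<one>\<^bsub>L\<^esub>) p = p" if "p \<in> S" for p
    using that by (auto simp: e_def S_def)
  have one: "\<one>\<^bsub>R\<^esub> = frag_of (\<one>\<^bsub>E\<^esub>, \<one>\<^bsub>L\<^esub>)" and zero: "\<zero>\<^bsub>R\<^esub> = 0"
    and add: "c \<oplus>\<^bsub>R\<^esub> d = c + d" and carr: "c \<in> carrier R \<longleftrightarrow> Poly_Mapping.keys c \<subseteq> S"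
    and mult: "c \<otimes>\<^bsub>R\<^esub> d = frag_extend (\<lambda>p. frag_extend (\<lambda>q. frag_of (e p q)) d) c" for c d
    by (simp_all add: R_def tensor_pairs_def S_def e_def case_prod_unfold)
  have zero_mult: "0 \<otimes>\<^bsub>R\<^esub> d = 0" "d \<otimes>\<^bsub>R\<^esub> 0 = 0"
    and diff_mult: "(a - b) \<otimes>\<^bsub>R\<^esub> d = a \<otimes>\<^bsub>R\<^esub> d - b \<otimes>\<^bsub>R\<^esub> d"
    and add_mult: "(a + b) \<otimes>\<^bsub>R\<^esub> d = a \<otimes>\<^bsub>R\<^esub> d + b \<otimes>\<^bsub>R\<^esub> d"
    and of_mult: "frag_of p \<otimes>\<^bsub>R\<^esub> frag_of q = frag_of (e p q)" for a b d p q
    by (simp_all add: mult frag_extend_diff frag_extend_add frag_extend_eq_0)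
  have cmul_diff: "frag_cmul n (a - b) = frag_cmul n a - frag_cmul n b"
    for n and a b :: "'a \<times> 'c \<Rightarrow>\<^sub>0 int"
    by (metis add_diff_cancel diff_add_cancel frag_cmul_distrib2)
  have mult_diff: "d \<otimes>\<^bsub>R\<^esub> (a - b) = d \<otimes>\<^bsub>R\<^esub> a - d \<otimes>\<^bsub>R\<^esub> b" for a b d
    unfolding mult frag_extend_diff
    by (simp add: frag_extend_def[of _ d] cmul_diff sum_subtractf)
  have closed: "c \<otimes>\<^bsub>R\<^esub> d \<in> carrier R" if "c \<in> carrier R" "d \<in> carrier R" for c d
    using that e_closed unfolding carr mult by (force dest!: keys_frag_extend[THEN subsetD])
  have comm: "c \<otimes>\<^bsub>R\<^esub> d = d \<otimes>\<^bsub>R\<^esub> c" if c: "c \<in> carrier R" and d: "d \<in> carrier R" for c d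
    using c[unfolded carr]
  proof (induction c rule: frag_induction)
    case (one p)
    show ?case using d[unfolded carr]
      by (induction d rule: frag_induction) (simp_all add: zero_mult of_mult mult_diff diff_mult e_comm one)
  qed (simp_all add: zero_mult mult_diff diff_mult)
  have assoc: "c \<otimes>\<^bsub>R\<^esub> d \<otimes>\<^bsub>R\<^esub> f = c \<otimes>\<^bsub>R\<^esub> (d \<otimes>\<^bsub>R\<^esub> f)"
    if c: "c \<in> carrier R" and d: "d \<in> carrier R" and f: "f \<in> carrier R" for c d f
    using c[unfolded carr]
  proof (induction c rule: frag_induction)
    case p: (one p)
    show ?case using d[unfolded carr]
    proof (induction d rule: frag_induction)
      case q: (one q)
      show ?case using f[unfolded carr]
        by (induction f rule: frag_induction)
           (simp_all add: zero_mult of_mult mult_diff diff_mult e_assoc p q)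
    qed (simp_all add: zero_mult mult_diff diff_mult)
  qed (simp_all add: zero_mult mult_diff diff_mult)
  have one_mult: "\<one>\<^bsub>R\<^esub> \<otimes>\<^bsub>R\<^esub> c = c" if c: "c \<in> carrier R" for c
    using c[unfolded carr]
    by (induction c rule: frag_induction) (simp_all add: zero_mult mult_diff of_mult one e_one)
  have "cring R"
  proof (rule cringI)
    show "abelian_group R"
    proof (rule abelian_groupI)
      fix c assume "c \<in> carrier R"
      then show "\<exists>d \<in> carrier R. d \<oplus>\<^bsub>R\<^esub> c = \<zero>\<^bsub>R\<^esub>"
        by (intro bexI[of _ "- c"]) (auto simp: carr add zero)
    qed (use Poly_Mapping.keys_add in \<open>fastforce simp: carr add zero algebra_simps\<close>)+
    show "comm_monoid R"
    proof (rule comm_monoidI)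
      show "\<one>\<^bsub>R\<^esub> \<in> carrier R"
        by (simp add: carr one S_def)
    qed (fact closed assoc one_mult comm)+
  qed (simp add: add add_mult)
  then show ?thesis by (simp add: R_def)
qed

definition tensor_relations ::
    "('a, 'l) ring_scheme \<Rightarrow> ('b, 'm) ring_scheme \<Rightarrow> ('a \<Rightarrow> 'b) \<Rightarrow>
     ('c, 'n) ring_scheme \<Rightarrow> ('a \<Rightarrow> 'c) \<Rightarrow> ('b \<times> 'c \<Rightarrow>\<^sub>0 int) set"
  where "tensor_relations k E \<phi> L \<psi> =
    {frag_of (x \<oplus>\<^bsub>E\<^esub> x', y) - frag_of (x, y) - frag_of (x', y) | x x' y.
       x \<in> carrier E \<and> x' \<in> carrier E \<and> y \<in> carrier L} \<union>
    {frag_of (x, y \<oplus>\<^bsub>L\<^esub> y') - frag_of (x, y) - frag_of (x, y') | x y y'.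
       x \<in> carrier E \<and> y \<in> carrier L \<and> y' \<in> carrier L} \<union>
    {frag_of (\<phi> a \<otimes>\<^bsub>E\<^esub> x, y) - frag_of (x, \<psi> a \<otimes>\<^bsub>L\<^esub> y) | a x y.
       a \<in> carrier k \<and> x \<in> carrier E \<and> y \<in> carrier L}"

text \<open>
  The relations are stable under multiplication by basis elements, so the ideal they generate
  is the additive subgroup they generate, and the quotient is the usual tensor product
  over \<open>k\<close> with its product \<open>(x \<otimes> y)(x' \<otimes> y') = xx' \<otimes> yy'\<close>.
\<close>

definition tensor_ideal ::
    "('a, 'l) ring_scheme \<Rightarrow> ('b, 'm) ring_scheme \<Rightarrow> ('a \<Rightarrow> 'b) \<Rightarrow>
     ('c, 'n) ring_scheme \<Rightarrow> ('a \<Rightarrow> 'c) \<Rightarrow> ('b \<times> 'c \<Rightarrow>\<^sub>0 int) set"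
  where "tensor_ideal k E \<phi> L \<psi> =
    Idl\<^bsub>tensor_pairs E L\<^esub> (tensor_relations k E \<phi> L \<psi>)"

definition tensor_product ::
    "('a, 'l) ring_scheme \<Rightarrow> ('b, 'm) ring_scheme \<Rightarrow> ('a \<Rightarrow> 'b) \<Rightarrow>
     ('c, 'n) ring_scheme \<Rightarrow> ('a \<Rightarrow> 'c) \<Rightarrow> ('b \<times> 'c \<Rightarrow>\<^sub>0 int) set ring"
  where "tensor_product k E \<phi> L \<psi> = tensor_pairs E L Quot tensor_ideal k E \<phi> L \<psi>"

definition tensor_right ::
    "('a, 'l) ring_scheme \<Rightarrow> ('b, 'm) ring_scheme \<Rightarrow> ('a \<Rightarrow> 'b) \<Rightarrow>
     ('c, 'n) ring_scheme \<Rightarrow> ('a \<Rightarrow> 'c) \<Rightarrow> 'c \<Rightarrow> ('b \<times> 'c \<Rightarrow>\<^sub>0 int) set"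
  where "tensor_right k E \<phi> L \<psi> y =
    tensor_ideal k E \<phi> L \<psi> +>\<^bsub>tensor_pairs E L\<^esub> frag_of (\<one>\<^bsub>E\<^esub>, y)"


section \<open>Pre-Galois groups\<close>

definition pre_galois_extension ::
    "('a, 'm) ring_scheme \<Rightarrow> ('b, 'n) ring_scheme \<Rightarrow> ('a \<Rightarrow> 'b) \<Rightarrow> ('g, 'l) monoid_scheme \<Rightarrow> bool"
  where "pre_galois_extension k E \<phi> G \<longleftrightarrow>
    finite_field_extension k E \<phi> \<and>
    (\<exists>(L :: 'a list ring) \<psi>. finite_galois_extension k L \<psi> \<and>
       finite_galois_extension L (tensor_product k E \<phi> L \<psi>) (tensor_right k E \<phi> L \<psi>) \<and>
       G \<cong> Gal L (tensor_product k E \<phi> L \<psi>) (tensor_right k E \<phi> L \<psi>))"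

definition is_pre_galois_group_over :: "('g, 'n) monoid_scheme \<Rightarrow> ('a, 'm) ring_scheme \<Rightarrow> bool"
  where "is_pre_galois_group_over G k \<longleftrightarrow>
    finite_group G \<and> (\<exists>(E :: 'a list ring) \<phi>. pre_galois_extension k E \<phi> G)"


section \<open>Complete groups and normal subgroups up to isomorphism\<close>

definition is_normal_subgroup_of :: "('g, 'm) monoid_scheme \<Rightarrow> ('h, 'n) monoid_scheme \<Rightarrow> bool"
  where "is_normal_subgroup_of G \<Gamma> \<longleftrightarrow> (\<exists>H. H \<lhd> \<Gamma> \<and> G \<cong> \<Gamma>\<lparr>carrier := H\<rparr>)"

definition center :: "('g, 'm) monoid_scheme \<Rightarrow> 'g set"
  where "center G = {z \<in> carrier G. \<forall>g \<in> carrier G. z \<otimes>\<^bsub>G\<^esub> g = g \<otimes>\<^bsub>G\<^esub> z}"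

definition inner_auts :: "('g, 'm) monoid_scheme \<Rightarrow> ('g \<Rightarrow> 'g) set"
  where "inner_auts G =
    (\<lambda>g. \<lambda>x \<in> carrier G. g \<otimes>\<^bsub>G\<^esub> x \<otimes>\<^bsub>G\<^esub> inv\<^bsub>G\<^esub> g) ` carrier G"

definition Out :: "('g, 'm) monoid_scheme \<Rightarrow> ('g \<Rightarrow> 'g) set monoid"
  where "Out G = AutoGroup G Mod inner_auts G"

definition complete_group :: "('g, 'm) monoid_scheme \<Rightarrow> bool"
  where "complete_group G \<longleftrightarrow>
    group G \<and> trivial_group (G\<lparr>carrier := center G\<rparr>) \<and> trivial_group (Out G)"

end

theory Submission
  imports Defs "HOL-Number_Theory.Number_Theory"
begin

text \<open>
  The step from (iv) to (i) rests on two facts. A complete normal subgroup is a retract of the whole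
  group (send an element to the inner automorphism that it induces), so it is a quotient, and quotients
  of Galois groups are Galois groups by passing to fixed fields. Hence it suffices that every finite
  group \<open>G\<close> is a quotient of a finite complete group. Take a graph on which \<open>G\<close> acts and whose
  automorphisms are determined by elements of \<open>G\<close>. Attach to it the \<open>p\<close>-group of class two generated
  by the vertices in which exactly the adjacent vertices fail to commute, and extend this \<open>p\<close>-group by
  a diagonal torus of exponent \<open>r\<close>. The resulting group \<open>B\<close> has trivial centre, its automorphisms are
  graph automorphisms up to inner ones, and for \<open>r\<close> larger than the number of permutations of the
  vertices the inner automorphisms are exactly those of order dividing \<open>p r\<close>. So the inner
  automorphisms are characteristic in the automorphism group of \<open>B\<close>, which is then complete by
  Burnside's argument, and it maps onto \<open>G\<close>.

  A Galois extension is pre-Galois with \<open>L = k\<close>. If \<open>M\<close> is the tensor product of \<open>E\<close> and \<open>L\<close>, every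
  automorphism of \<open>L\<close> over \<open>k\<close> extends to \<open>M\<close> through the second factor. So \<open>M\<close> is Galois over \<open>k\<close>,
  and the Galois group of \<open>M\<close> over \<open>L\<close> is normal in the one over \<open>k\<close>.
\<close>

section \<open>The group of a graph\<close>

text \<open>The \<open>p\<close>-group alone could not work: a nontrivial \<open>p\<close>-group has
  a nontrivial centre, and generators may be multiplied by central elements. The torus cures both. A
  diagonal element with entries 2 acts by 2 on vertex entries and by 4 on edge entries, so it fixes
  only the identity of the \<open>p\<close>-group; this removes the centre and forces every
  automorphism, up to conjugation, to preserve the torus. What is left is monomial: a vertex
  permutation together with nonzero scalars modulo \<open>p\<close>. Scalars that are not
  \<open>r\<close>-th roots of unity are outer, which is why one passes to the automorphism group of
  \<open>B\<close>. Burnside's argument needs the inner automorphisms to be recognisable there. As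
  the torus contains all \<open>r\<close>-th roots of unity, scalars of order dividing
  \<open>r\<close> are inner; by Fermat the factor \<open>p\<close> of the exponent is invisible on
  scalars; and the order of a permutation is prime to \<open>p\<close> and \<open>r\<close> once
  both exceed the number of permutations. Since 2 must be an \<open>r\<close>-th root of unity,
  \<open>p\<close> is sought among the divisors of \<open>2^r - 1\<close>.\<close>

text \<open>
  An element is a triple: a vector of \<open>r\<close>-th roots of unity modulo \<open>p\<close> indexed by the vertices, a
  vector modulo \<open>p\<close> indexed by the vertices, and an alternating matrix modulo \<open>p\<close> supported on the
  edges. Entries are represented by their residues in \<open>{0..<p}\<close>.
\<close>

type_synonym 's graph_elt = "('s \<Rightarrow> int) \<times> ('s \<Rightarrow> int) \<times> ('s \<Rightarrow> 's \<Rightarrow> int)"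

abbreviation torus :: "'s graph_elt \<Rightarrow> 's \<Rightarrow> int" where "torus x \<equiv> fst x"
abbreviation vert :: "'s graph_elt \<Rightarrow> 's \<Rightarrow> int" where "vert x \<equiv> fst (snd x)"
abbreviation edge :: "'s graph_elt \<Rightarrow> 's \<Rightarrow> 's \<Rightarrow> int" where "edge x \<equiv> snd (snd x)"

text \<open>\<open>no_isolated\<close> lets every vertex entry be detected by a commutator.
  \<open>two_pow\<close> puts the entry 2 into the torus, and \<open>p > r > 3\<close> keeps 2 and 4
  different from 1 modulo \<open>p\<close>. \<open>r_large\<close> excludes vertex permutations
  whose order is divisible by \<open>r\<close> or by \<open>p\<close>.\<close>

locale graph_group =
  fixes S :: "'s set" and E :: "'s \<Rightarrow> 's \<Rightarrow> bool" and p r :: nat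
  assumes finite_S: "finite S"
    and E_sym: "E s s' \<Longrightarrow> E s' s"
    and E_irrefl: "\<not> E s s"
    and E_in: "E s s' \<Longrightarrow> s \<in> S"
    and no_isolated: "s \<in> S \<Longrightarrow> \<exists>s'. E s s'"
    and prime_p: "Factorial_Ring.prime p" and prime_r: "Factorial_Ring.prime r"
    and p_gt: "p > r" and r_gt: "r > 3"
    and two_pow: "(2::int) ^ r mod int p = 1"
    and r_large: "card (Bij S) < r"
begin

text \<open>The law of \<open>B\<close> reduces modulo \<open>q\<close> at every operation. To
  compare two such nested expressions, \<open>mod_eqI\<close> leaves their unreduced forms open;
  resolving with \<open>cong_strip\<close> instantiates them with the inner reductions removed, and
  a polynomial identity over the integers remains.\<close>

lemma cong_stripI: "[x = y] (mod c) \<Longrightarrow> [x mod c = y] (mod (c::int))" by simp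
lemma mod_eqI: "[a = a'] (mod c) \<Longrightarrow> [b = b'] (mod c) \<Longrightarrow> a' = b' \<Longrightarrow> a mod c = b mod (c::int)"
  unfolding cong_def by simp
lemmas cong_strip = cong_stripI cong_add cong_diff cong_mult cong_uminus cong_pow

abbreviation "q \<equiv> int p"

lemma q_gt: "q > 4" using p_gt r_gt by simp
lemma one_mod_q [simp]: "1 mod q = 1" using q_gt by simp
lemma prime_q: "Factorial_Ring.prime q" using prime_p by simp

text \<open>The vertex and edge parts multiply by (v, w)(v', w') = (v + v', w + w' + v ^ v'), where
  v ^ v' is the wedge product restricted to the edges; a torus element t acts by t_s on vertex
  entries and by t_s t_s' on edge entries. The cocycle is itself alternating, so powers and inverses
  in the \<open>p\<close>-group are entrywise. Entries outside \<open>S\<close> or off the edges are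
  fixed at 1 or 0, which makes equality of functions on the whole type the right equality.\<close>

definition B :: "'s graph_elt monoid" where
  "B = \<lparr>carrier = {x.
      (\<forall>s. torus x s \<in> {0..<q} \<and> torus x s ^ r mod q = 1 \<and> (s \<notin> S \<longrightarrow> torus x s = 1)) \<and>
      (\<forall>s. vert x s \<in> {0..<q} \<and> (s \<notin> S \<longrightarrow> vert x s = 0)) \<and>
      (\<forall>s s'. edge x s s' \<in> {0..<q} \<and> (\<not> E s s' \<longrightarrow> edge x s s' = 0) \<and>
              edge x s' s = (- edge x s s') mod q)},
    monoid.mult = \<lambda>x y.
      (\<lambda>s. torus x s * torus y s mod q,
       \<lambda>s. (vert x s + torus x s * vert y s) mod q,
       \<lambda>s s'. (edge x s s' + torus x s * torus x s' * edge y s s' +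
          (if E s s' then vert x s * (torus x s' * vert y s') - vert x s' * (torus x s * vert y s) else 0)) mod q),
    one = (\<lambda>_. 1, \<lambda>_. 0, \<lambda>_ _. 0)\<rparr>"

abbreviation times_B (infixl "\<cdot>" 70) where "x \<cdot> y \<equiv> x \<otimes>\<^bsub>B\<^esub> y"

lemma carrier_B: "x \<in> carrier B \<longleftrightarrow>
      (\<forall>s. torus x s \<in> {0..<q} \<and> torus x s ^ r mod q = 1 \<and> (s \<notin> S \<longrightarrow> torus x s = 1)) \<and>
      (\<forall>s. vert x s \<in> {0..<q} \<and> (s \<notin> S \<longrightarrow> vert x s = 0)) \<and>
      (\<forall>s s'. edge x s s' \<in> {0..<q} \<and> (\<not> E s s' \<longrightarrow> edge x s s' = 0) \<and>
              edge x s' s = (- edge x s s') mod q)"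
  by (simp add: B_def)

lemma mult_B [simp]:
  "torus (x \<cdot> y) s = torus x s * torus y s mod q"
  "vert (x \<cdot> y) s = (vert x s + torus x s * vert y s) mod q"
  "edge (x \<cdot> y) s s' = (edge x s s' + torus x s * torus x s' * edge y s s' +
          (if E s s' then vert x s * (torus x s' * vert y s') - vert x s' * (torus x s * vert y s) else 0)) mod q"
  by (simp_all add: B_def)

lemma one_B [simp]: "torus \<one>\<^bsub>B\<^esub> s = 1" "vert \<one>\<^bsub>B\<^esub> s = 0" "edge \<one>\<^bsub>B\<^esub> s s' = 0"
  by (simp_all add: B_def)

lemma B_eqI:
  assumes "\<And>s. torus x s = torus y s" "\<And>s. vert x s = vert y s" "\<And>s s'. edge x s s' = edge y s s'"
  shows "x = y"
  using assms by (auto simp: prod_eq_iff fun_eq_iff)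

lemma torusD: assumes "x \<in> carrier B" shows "torus x s \<in> {0..<q}" "torus x s mod q = torus x s" "torus x s ^ r mod q = 1"
    "s \<notin> S \<Longrightarrow> torus x s = 1"
  using assms unfolding carrier_B by auto
lemma vertD: assumes "x \<in> carrier B" shows "vert x s \<in> {0..<q}" "vert x s mod q = vert x s"
    "s \<notin> S \<Longrightarrow> vert x s = 0"
  using assms unfolding carrier_B by auto
lemma edge_alt: assumes "x \<in> carrier B" shows "edge x s' s = (- edge x s s') mod q"
  using assms unfolding carrier_B by blast
lemma edgeD: assumes "x \<in> carrier B" shows "edge x s s' \<in> {0..<q}" "edge x s s' mod q = edge x s s'"
    "\<not> E s s' \<Longrightarrow> edge x s s' = 0"
proof -
  show "edge x s s' \<in> {0..<q}" "\<not> E s s' \<Longrightarrow> edge x s s' = 0" using assms unfolding carrier_B by blast+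
  then show "edge x s s' mod q = edge x s s'" by simp
qed

lemma mod_q_range [simp]: "0 \<le> a mod q" "a mod q < q" using q_gt by auto

lemma mult_closed:
  assumes "x \<in> carrier B" "y \<in> carrier B" shows "x \<cdot> y \<in> carrier B"
proof -
  have 1: "(torus x s * torus y s mod q) ^ r mod q = 1" for s
  proof -
    have "(torus x s * torus y s mod q) ^ r mod q = (torus x s ^ r mod q) * (torus y s ^ r mod q) mod q"
      by (simp add: power_mod power_mult_distrib mod_mult_eq)
    then show ?thesis using torusD(3)[OF assms(1)] torusD(3)[OF assms(2)] by simp
  qed
  have 2: "edge (x \<cdot> y) s' s = (- edge (x \<cdot> y) s s') mod q" for s s'
  proof -
    have E: "E s' s = E s s'" using E_sym by blast
    have "edge (x \<cdot> y) s' s = (- edge x s s' + torus x s' * torus x s * (- edge y s s') +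
          (if E s s' then vert x s' * (torus x s * vert y s) - vert x s * (torus x s' * vert y s') else 0)) mod q"
      by (unfold mult_B E, subst edge_alt[OF assms(1), of s' s], subst edge_alt[OF assms(2), of s' s])
        (cases "E s s'"; simp only: if_True if_False; rule mod_eqI, (rule cong_strip | rule cong_refl)+; simp add: algebra_simps)
    also have "\<dots> = (- edge (x \<cdot> y) s s') mod q"
      by (unfold mult_B, rule mod_eqI, (rule cong_strip | rule cong_refl)+) (simp add: algebra_simps)
    finally show ?thesis .
  qed
  show ?thesis unfolding carrier_B
    by (intro conjI allI 2)
       (simp_all add: 1 torusD(4)[OF assms(1)] torusD(4)[OF assms(2)] vertD(3)[OF assms(1)] vertD(3)[OF assms(2)]
         edgeD(3)[OF assms(1)] edgeD(3)[OF assms(2)])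
qed

lemma one_closed_B: "\<one>\<^bsub>B\<^esub> \<in> carrier B"
  unfolding carrier_B using q_gt by auto

lemma assoc_B: "x \<cdot> y \<cdot> z = x \<cdot> (y \<cdot> z)"
proof (rule B_eqI)
  fix s s'
  show "torus (x \<cdot> y \<cdot> z) s = torus (x \<cdot> (y \<cdot> z)) s"
    unfolding mult_B by (rule mod_eqI, (rule cong_strip | rule cong_refl)+) (simp add: algebra_simps)
  show "vert (x \<cdot> y \<cdot> z) s = vert (x \<cdot> (y \<cdot> z)) s"
    unfolding mult_B by (rule mod_eqI, (rule cong_strip | rule cong_refl)+) (simp add: algebra_simps)
  show "edge (x \<cdot> y \<cdot> z) s s' = edge (x \<cdot> (y \<cdot> z)) s s'"
    unfolding mult_B by (cases "E s s'"; simp only: if_True if_False; rule mod_eqI, (rule cong_strip | rule cong_refl)+) (simp_all add: algebra_simps)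
qed

text \<open>On the \<open>r\<close>-th roots of unity the power \<open>r - 1\<close> is inversion.
  No cross term appears in the edge part, because the wedge of a vector with its own negative
  vanishes.\<close>

definition inv_elt :: "'s graph_elt \<Rightarrow> 's graph_elt" where
  "inv_elt x = (let t = (\<lambda>s. torus x s ^ (r - 1) mod q) in
     (t, \<lambda>s. (- (t s * vert x s)) mod q, \<lambda>s s'. (- (t s * t s' * edge x s s')) mod q))"

lemma torus_inverse: assumes "x \<in> carrier B" shows "torus x s ^ (r - 1) * torus x s mod q = 1"
proof -
  have "torus x s ^ (r - 1) * torus x s = torus x s ^ r"
    using r_gt by (metis Suc_diff_1 less_trans power_Suc2 zero_less_numeral)
  then show ?thesis using torusD(3)[OF assms] by simp
qed

lemma inv_elt:
  assumes x: "x \<in> carrier B" shows "inv_elt x \<in> carrier B" "inv_elt x \<cdot> x = \<one>\<^bsub>B\<^esub>"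
proof -
  have *: "(torus x s ^ (r - 1) mod q) ^ r mod q = 1" for s
  proof -
    have "(torus x s ^ (r - 1) mod q) ^ r mod q = (torus x s ^ r mod q) ^ (r - 1) mod q"
      by (simp add: power_mod mult.commute flip: power_mult)
    then show ?thesis using torusD(3)[OF x] by simp
  qed
  have **: "(- (t * t' * edge x s' s)) mod q = (- ((- (t' * t * edge x s s')) mod q)) mod q" for s s' t t'
    by (subst edge_alt[OF x, of s' s], rule mod_eqI, (rule cong_strip | rule cong_refl)+) (simp add: algebra_simps)
  show "inv_elt x \<in> carrier B"
    unfolding carrier_B inv_elt_def Let_def fst_conv snd_conv
    by (intro conjI allI *  **[unfolded mult.assoc] **) (simp_all add: torusD(4)[OF x] vertD[OF x] edgeD[OF x])
  show "inv_elt x \<cdot> x = \<one>\<^bsub>B\<^esub>"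
  proof (rule B_eqI)
    fix s s'
    show "torus (inv_elt x \<cdot> x) s = torus \<one>\<^bsub>B\<^esub> s"
      using torus_inverse[OF x, of s] by (simp add: inv_elt_def mod_mult_left_eq)
    show "vert (inv_elt x \<cdot> x) s = vert \<one>\<^bsub>B\<^esub> s"
      unfolding mult_B one_B inv_elt_def Let_def fst_conv snd_conv
      by (rule mod_eqI[where b=0, simplified], (rule cong_strip | rule cong_refl)+) (simp add: algebra_simps)
    show "edge (inv_elt x \<cdot> x) s s' = edge \<one>\<^bsub>B\<^esub> s s'"
      unfolding mult_B one_B inv_elt_def Let_def fst_conv snd_conv
      by (cases "E s s'"; simp only: if_True if_False; rule mod_eqI[where b=0, simplified], (rule cong_strip | rule cong_refl)+) (simp_all add: algebra_simps)
  qed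
qed

lemma group_B: "group B"
proof (rule groupI)
  fix x assume x: "x \<in> carrier B"
  show "\<one>\<^bsub>B\<^esub> \<cdot> x = x" using x by (intro B_eqI) (simp_all add: torusD vertD edgeD)
  show "\<exists>y\<in>carrier B. y \<cdot> x = \<one>\<^bsub>B\<^esub>" using inv_elt[OF x] by blast
qed (simp_all add: mult_closed one_closed_B assoc_B)

sublocale B: group B by (rule group_B)

section \<open>The subgroups P, W and T\<close>

lemma p_pos [simp]: "0 < p" "Suc 0 < p" using p_gt r_gt by auto

text \<open>\<open>P_eq\<close> and \<open>W_eq\<close> describe the first two without coordinates,
  as the elements with trivial \<open>p\<close>-th power and the centre of \<open>P\<close>, so
  automorphisms preserve them. The complement \<open>T\<close> is preserved only up to conjugation,
  which is the content of \<open>torus_conj\<close>.\<close>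

definition P where "P = {x \<in> carrier B. \<forall>s. torus x s = 1}"
definition W where "W = {x \<in> P. \<forall>s. vert x s = 0}"
definition T where "T = {x \<in> carrier B. (\<forall>s. vert x s = 0) \<and> (\<forall>s s'. edge x s s' = 0)}"

lemma finite_B: "finite (carrier B)"
proof -
  let ?F = "{f :: 's \<Rightarrow> int. \<forall>s. (s \<in> S \<longrightarrow> f s \<in> {0..<q}) \<and> (s \<notin> S \<longrightarrow> f s = 0)}"
  let ?F1 = "{f :: 's \<Rightarrow> int. \<forall>s. (s \<in> S \<longrightarrow> f s \<in> {0..<q}) \<and> (s \<notin> S \<longrightarrow> f s = 1)}"
  let ?F2 = "{f. \<forall>x. (x \<in> S \<times> S \<longrightarrow> f x \<in> {0..<q}) \<and> (x \<notin> S \<times> S \<longrightarrow> f x = 0)}"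
  have "carrier B \<subseteq> ?F1 \<times> ?F \<times> (\<lambda>f s s'. f (s, s')) ` ?F2"
  proof
    fix x assume x: "x \<in> carrier B"
    have "(\<lambda>(s, s'). edge x s s') \<in> ?F2"
      using edgeD(1)[OF x] edgeD(3)[OF x] E_in E_sym by (simp add: mem_Times_iff split_beta) blast
    then have "edge x \<in> (\<lambda>f s s'. f (s, s')) ` ?F2"
      by (rule rev_image_eqI) auto
    then show "x \<in> ?F1 \<times> ?F \<times> (\<lambda>f s s'. f (s, s')) ` ?F2"
      using torusD(1,4)[OF x] vertD(1,3)[OF x] by (simp add: mem_Times_iff)
  qed
  moreover have "finite ?F1" "finite ?F" "finite ?F2"
    by (intro finite_set_of_finite_funs finite_cartesian_product finite_S; simp)+
  ultimately show ?thesis by (meson finite_SigmaI finite_imageI finite_subset)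
qed

lemma torus_pow: "torus (x [^]\<^bsub>B\<^esub> (n::nat)) s = torus x s ^ n mod q"
  by (induction n) (simp_all add: mod_mult_right_eq mult.commute)

lemma pow_P:
  assumes "x \<in> P"
  shows "x [^]\<^bsub>B\<^esub> (n::nat) \<in> P"
    "vert (x [^]\<^bsub>B\<^esub> n) s = int n * vert x s mod q"
    "edge (x [^]\<^bsub>B\<^esub> n) s s' = int n * edge x s s' mod q"
proof -
  have x: "x \<in> carrier B" "\<And>s. torus x s = 1" using assms by (auto simp: P_def)
  then show 1: "x [^]\<^bsub>B\<^esub> n \<in> P" by (simp add: P_def torus_pow)
  have t: "torus (x [^]\<^bsub>B\<^esub> m) s = 1" for m :: nat and s by (simp add: torus_pow x)
  show v: "vert (x [^]\<^bsub>B\<^esub> n) s = int n * vert x s mod q" for s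
    by (induction n) (simp_all add: t mod_simps algebra_simps)
  show "edge (x [^]\<^bsub>B\<^esub> n) s s' = int n * edge x s s' mod q"
  proof (induction n)
    case (Suc n)
    have v: "vert (x [^]\<^bsub>B\<^esub> n) s = int n * vert x s mod q" for s
      by (induction n) (simp_all add: t mod_simps algebra_simps)
    show ?case
      unfolding nat_pow_Suc B.nat_pow_Suc mult_B Suc v t
      by (cases "E s s'"; simp only: if_True if_False; rule mod_eqI, (rule cong_strip | rule cong_refl)+) (simp_all add: algebra_simps)
  qed simp
qed

lemma fermat: "[a ^ p = a] (mod q)"
proof (cases "q dvd a")
  case True
  then have "q dvd a ^ p" by (rule dvd_trans) (simp add: dvd_power)
  with True show ?thesis by (simp add: cong_def mod_eq_0_iff_dvd)
next
  case False
  have c: "[int (nat (a mod q)) = a] (mod q)" using q_gt by (simp add: cong_def)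
  with False have "\<not> p dvd nat (a mod q)" by (metis cong_dvd_iff int_dvd_int_iff)
  then have "[nat (a mod q) ^ (p - 1) = 1] (mod p)" using prime_p fermat_theorem by blast
  then have "[int (nat (a mod q)) ^ (p - 1) = 1] (mod q)" by (metis cong_int_iff of_nat_1 of_nat_power)
  moreover have "[int (nat (a mod q)) ^ (p - 1) = a ^ (p - 1)] (mod q)" using c by (rule cong_pow)
  ultimately have "[a ^ (p - 1) = 1] (mod q)" by (metis cong_sym cong_trans)
  then have "[a ^ (p - 1) * a = 1 * a] (mod q)" by (rule cong_scalar_right)
  moreover have "a ^ (p - 1) * a = a ^ p" using p_gt by (metis Suc_diff_1 less_nat_zero_code neq0_conv power_Suc2)
  ultimately show ?thesis by simp
qed

text \<open>By Fermat a torus entry equals its own \<open>p\<close>-th power modulo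
  \<open>p\<close>, so an element and its \<open>p\<close>-th power have the same torus
  part.\<close>

lemma P_eq: "P = {x \<in> carrier B. x [^]\<^bsub>B\<^esub> p = \<one>\<^bsub>B\<^esub>}"
proof (intro Set.set_eqI iffI)
  fix x assume "x \<in> P"
  then show "x \<in> {x \<in> carrier B. x [^]\<^bsub>B\<^esub> p = \<one>\<^bsub>B\<^esub>}"
    using B_eqI[of "x [^]\<^bsub>B\<^esub> p" "\<one>\<^bsub>B\<^esub>"] by (simp add: pow_P torus_pow) (simp add: P_def)
next
  fix x assume "x \<in> {x \<in> carrier B. x [^]\<^bsub>B\<^esub> p = \<one>\<^bsub>B\<^esub>}"
  then have x: "x \<in> carrier B" and xp: "x [^]\<^bsub>B\<^esub> p = \<one>\<^bsub>B\<^esub>" by auto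
  have "torus x s = 1" for s
    using fermat[of "torus x s"] torusD(2)[OF x, of s] torus_pow[of x p s] xp by (simp add: cong_def)
  with x show "x \<in> P" by (simp add: P_def)
qed

text \<open>The \<open>r\<close>-th power kills the torus part and lands in \<open>P\<close>, which
  has exponent \<open>p\<close>. This bounds the orders of the inner automorphisms.\<close>

lemma pow_pr: assumes "x \<in> carrier B" shows "x [^]\<^bsub>B\<^esub> (p * r) = \<one>\<^bsub>B\<^esub>"
proof -
  have "x [^]\<^bsub>B\<^esub> r \<in> P" using assms by (simp add: P_def torus_pow torusD)
  then have "(x [^]\<^bsub>B\<^esub> r) [^]\<^bsub>B\<^esub> p = \<one>\<^bsub>B\<^esub>" using P_eq by blast
  then show ?thesis using assms by (simp add: B.nat_pow_pow mult.commute)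
qed

lemma subgroup_P: "subgroup P B"
proof (rule B.subgroupI)
  show "inv\<^bsub>B\<^esub> x \<in> P" if "x \<in> P" for x
    using that B.nat_pow_inv[of x p] unfolding P_eq by auto
  have "\<one>\<^bsub>B\<^esub> \<in> P" by (simp add: P_def)
  then show "P \<noteq> {}" by blast
qed (auto simp: P_def)

lemma P_carrier: "x \<in> P \<Longrightarrow> x \<in> carrier B" by (simp add: P_def)
lemma W_carrier: "x \<in> W \<Longrightarrow> x \<in> carrier B" by (simp add: P_def W_def)
lemma T_carrier: "x \<in> T \<Longrightarrow> x \<in> carrier B" by (simp add: T_def)

lemma torus_inv: assumes "x \<in> carrier B" shows "torus (inv\<^bsub>B\<^esub> x) s * torus x s mod q = 1"
  using arg_cong[OF B.l_inv[OF assms], of "\<lambda>x. torus x s"] by simp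

lemma two_mult_dvd: "q dvd 2 * a \<longleftrightarrow> q dvd a"
proof -
  have "\<not> q dvd 2" using q_gt by (auto dest: zdvd_imp_le)
  then show ?thesis using prime_q prime_dvd_mult_iff by blast
qed

text \<open>Exchanging the factors changes the sign of the alternating edge term, so the two
  products differ by twice that term, and 2 is invertible modulo the odd prime
  \<open>p\<close>.\<close>

lemma commute_P:
  assumes x: "x \<in> P" and y: "y \<in> P"
  shows "x \<cdot> y = y \<cdot> x \<longleftrightarrow> (\<forall>s s'. E s s' \<longrightarrow> q dvd vert x s * vert y s' - vert x s' * vert y s)"
proof -
  have t: "torus x s = 1" "torus y s = 1" for s using x y by (auto simp: P_def)
  have *: "edge (x \<cdot> y) s s' = edge (y \<cdot> x) s s' \<longleftrightarrow> (E s s' \<longrightarrow> q dvd vert x s * vert y s' - vert x s' * vert y s)" for s s'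
  proof (cases "E s s'")
    case True
    have "edge (x \<cdot> y) s s' = edge (y \<cdot> x) s s' \<longleftrightarrow> q dvd 2 * (vert x s * vert y s' - vert x s' * vert y s)"
      using True by (simp add: t mod_eq_dvd_iff algebra_simps)
    then show ?thesis using True two_mult_dvd by blast
  qed (simp add: t add.commute)
  show ?thesis
  proof
    assume "x \<cdot> y = y \<cdot> x"
    with * show "\<forall>s s'. E s s' \<longrightarrow> q dvd vert x s * vert y s' - vert x s' * vert y s" by metis
  next
    assume h: "\<forall>s s'. E s s' \<longrightarrow> q dvd vert x s * vert y s' - vert x s' * vert y s"
    show "x \<cdot> y = y \<cdot> x"
    proof (rule B_eqI)
      show "edge (x \<cdot> y) s s' = edge (y \<cdot> x) s s'" for s s' using h * by blast
    qed (simp_all add: t add.commute)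
  qed
qed

definition gen :: "int \<Rightarrow> 's \<Rightarrow> 's graph_elt" where
  "gen c s = (\<lambda>_. 1, \<lambda>i. if i = s then c mod q else 0, \<lambda>_ _. 0)"

lemma gen_simps [simp]: "torus (gen c s) i = 1" "vert (gen c s) i = (if i = s then c mod q else 0)" "edge (gen c s) i j = 0"
  by (simp_all add: gen_def)

lemma gen_P: "s \<in> S \<Longrightarrow> gen c s \<in> P"
  unfolding P_def by (auto simp: carrier_B)

lemma gen_pow: assumes "s \<in> S" shows "gen 1 s [^]\<^bsub>B\<^esub> n = gen (int n) s"
  by (rule B_eqI) (simp_all add: torus_pow pow_P[OF gen_P[OF assms]])

text \<open>A nonzero vertex entry at \<open>s\<close> is exposed by the generator at a neighbour of
  \<open>s\<close>: the commutator with it shows that entry, up to the factor 2, on the edge between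
  them.\<close>

lemma W_eq: "W = {x \<in> P. \<forall>y \<in> P. x \<cdot> y = y \<cdot> x}"
proof (intro Set.set_eqI iffI)
  fix x assume "x \<in> W"
  then show "x \<in> {x \<in> P. \<forall>y \<in> P. x \<cdot> y = y \<cdot> x}"
    by (auto simp: W_def commute_P)
next
  fix x assume "x \<in> {x \<in> P. \<forall>y \<in> P. x \<cdot> y = y \<cdot> x}"
  then have x: "x \<in> P" and c: "\<And>y. y \<in> P \<Longrightarrow> x \<cdot> y = y \<cdot> x" by auto
  have "vert x s = 0" for s
  proof (cases "s \<in> S")
    case True
    then obtain s' where s': "E s s'" using no_isolated by blast
    then have ne: "s \<noteq> s'" "s' \<in> S" using E_irrefl E_in E_sym by blast+
    have "q dvd vert x s * vert (gen 1 s') s' - vert x s' * vert (gen 1 s') s"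
      using c[OF gen_P[OF ne(2)]] commute_P[OF x gen_P[OF ne(2)]] s' by blast
    then have "q dvd vert x s" using ne by simp
    then show ?thesis using vertD[OF P_carrier[OF x], of s] by auto
  qed (use vertD[OF P_carrier[OF x]] in auto)
  with x show "x \<in> W" by (simp add: W_def)
qed

definition tor :: "('s \<Rightarrow> int) \<Rightarrow> 's graph_elt" where "tor t = (t, \<lambda>_. 0, \<lambda>_ _. 0)"

lemma tor_simps [simp]: "torus (tor t) = t" "vert (tor t) i = 0" "edge (tor t) i j = 0"
  by (simp_all add: tor_def)

lemma tor_T: assumes "x \<in> carrier B" shows "tor (torus x) \<in> T"
  using torusD[OF assms] by (auto simp: T_def carrier_B)

lemma T_eq_tor: "x \<in> T \<Longrightarrow> x = tor (torus x)"
  by (auto simp: T_def intro!: B_eqI)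

lemma tor_in_T: "(\<And>s. t s \<in> {0..<q} \<and> t s ^ r mod q = 1 \<and> (s \<notin> S \<longrightarrow> t s = 1)) \<Longrightarrow> tor t \<in> T"
  by (auto simp: T_def carrier_B)

lemma T_comm: "x \<in> T \<Longrightarrow> y \<in> T \<Longrightarrow> x \<cdot> y = y \<cdot> x"
  by (rule B_eqI) (auto simp: T_def mult.commute)

lemma decomp: "x \<in> carrier B \<Longrightarrow> x = (\<lambda>_. 1, vert x, edge x) \<cdot> tor (torus x)"
  by (rule B_eqI) (simp_all add: torusD vertD edgeD)

lemma decomp_P: "x \<in> carrier B \<Longrightarrow> (\<lambda>_. 1, vert x, edge x) \<in> P"
  unfolding P_def mem_Collect_eq carrier_B[of "(_, _)"] fst_conv snd_conv
  by (intro conjI allI edge_alt edgeD(1,3) vertD(1,3) impI) (assumption | simp)+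

text \<open>
  On the entries of \<open>P\<close> with an index outside \<open>A\<close> this element acts by 2 or 4, and neither is 1 modulo
  \<open>p\<close>. So it commutes only with the elements of \<open>P\<close> that live on \<open>A\<close>.
\<close>

definition two_except :: "'s set \<Rightarrow> 's graph_elt" where
  "two_except A = tor (\<lambda>s. if s \<in> S - A then 2 else 1)"

lemma two_except_T: "two_except A \<in> T"
  unfolding two_except_def using two_pow q_gt by (intro tor_in_T) auto

lemma commute_two:
  assumes x: "x \<in> P" and c: "x \<cdot> two_except A = two_except A \<cdot> x"
  shows "s \<notin> A \<Longrightarrow> vert x s = 0" "a \<notin> A \<or> b \<notin> A \<Longrightarrow> edge x a b = 0"
proof -
  have xc: "x \<in> carrier B" and t: "\<And>s. torus x s = 1" using x by (auto simp: P_def)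
  show "vert x s = 0" if "s \<notin> A"
  proof (cases "s \<in> S")
    case True
    have "(2 * vert x s) mod q = vert x s mod q"
      using arg_cong[OF c, of "\<lambda>x. vert x s"] that True by (simp add: two_except_def t)
    then have "q dvd vert x s" by (simp add: mod_eq_dvd_iff)
    then show ?thesis using vertD[OF xc, of s] by auto
  qed (use vertD[OF xc] in auto)
  show "edge x a b = 0" if "a \<notin> A \<or> b \<notin> A"
  proof (cases "E a b")
    case True
    then have ab: "a \<in> S" "b \<in> S" using E_in E_sym by blast+
    \<comment> \<open>The factor by which \<open>two_except A\<close> acts on the entry at (a, b).
      It is 2 or 4 when an index lies outside \<open>A\<close>, so \<open>m - 1\<close> is 1 or 3,
      and \<open>q > 4\<close>.\<close>
    define m :: int where "m = (if a \<in> S - A then 2 else 1) * (if b \<in> S - A then 2 else 1)"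
    have "(m * edge x a b) mod q = edge x a b mod q"
      using arg_cong[OF c, of "\<lambda>x. edge x a b"] True by (simp add: two_except_def t m_def)
    then have "q dvd (m - 1) * edge x a b" by (simp add: mod_eq_dvd_iff algebra_simps)
    moreover have "\<not> q dvd m - 1" using that ab q_gt by (auto simp: m_def dest: zdvd_imp_le)
    ultimately have "q dvd edge x a b" using prime_q prime_dvd_mult_iff by blast
    then show ?thesis using edgeD[OF xc, of a b] by auto
  qed (use edgeD[OF xc] in auto)
qed

end

lemma AutoGroup_simps:
  "carrier (AutoGroup G) = auto G"
  "\<alpha> \<in> auto G \<Longrightarrow> \<beta> \<in> auto G \<Longrightarrow> \<alpha> \<otimes>\<^bsub>AutoGroup G\<^esub> \<beta> = compose (carrier G) \<alpha> \<beta>"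
  "\<one>\<^bsub>AutoGroup G\<^esub> = (\<lambda>x\<in>carrier G. x)"
  by (simp_all add: AutoGroup_def BijGroup_def auto_def)

lemma (in group) inv_cancel_left:
  assumes "y \<in> carrier G" "x \<in> carrier G"
  shows "inv y \<otimes> (y \<otimes> x) = x" "y \<otimes> (inv y \<otimes> x) = x"
  using assms by (simp_all flip: m_assoc)

lemma (in group) conj_mult:
  assumes "y \<in> carrier G" "a \<in> carrier G" "b \<in> carrier G"
  shows "y \<otimes> (a \<otimes> b) \<otimes> inv y = (y \<otimes> a \<otimes> inv y) \<otimes> (y \<otimes> b \<otimes> inv y)"
  using assms by (simp add: m_assoc inv_cancel_left)

lemma (in group) conj_iso:
  assumes y: "y \<in> carrier G"
  shows "(\<lambda>x. y \<otimes> x \<otimes> inv y) \<in> iso G G"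
proof (rule isoI)
  show "(\<lambda>x. y \<otimes> x \<otimes> inv y) \<in> hom G G"
    using y by (auto simp: hom_def conj_mult)
  show "bij_betw (\<lambda>x. y \<otimes> x \<otimes> inv y) (carrier G) (carrier G)"
  proof (rule bij_betw_byWitness[where f' = "\<lambda>x. inv y \<otimes> x \<otimes> y"])
    show "\<forall>x\<in>carrier G. inv y \<otimes> (y \<otimes> x \<otimes> inv y) \<otimes> y = x" "\<forall>x\<in>carrier G. y \<otimes> (inv y \<otimes> x \<otimes> y) \<otimes> inv y = x"
      using y by (simp_all add: m_assoc inv_cancel_left)
  qed (use y in auto)
qed

context graph_group begin

section \<open>How automorphisms treat P, W and the torus\<close>

lemma iso_mult: "\<alpha> \<in> iso B B \<Longrightarrow> x \<in> carrier B \<Longrightarrow> y \<in> carrier B \<Longrightarrow> \<alpha> (x \<cdot> y) = \<alpha> x \<cdot> \<alpha> y"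
  by (simp add: iso_def hom_mult)

lemma iso_closed: "\<alpha> \<in> iso B B \<Longrightarrow> x \<in> carrier B \<Longrightarrow> \<alpha> x \<in> carrier B"
  by (auto simp: iso_def hom_def)

lemma iso_surj: "\<alpha> \<in> iso B B \<Longrightarrow> x \<in> carrier B \<Longrightarrow> \<exists>x' \<in> carrier B. x = \<alpha> x'"
  by (auto simp: iso_def bij_betw_def)

lemma iso_eq: "\<alpha> \<in> iso B B \<Longrightarrow> x \<in> carrier B \<Longrightarrow> y \<in> carrier B \<Longrightarrow> \<alpha> x = \<alpha> y \<longleftrightarrow> x = y"
  by (auto simp: iso_def bij_betw_def inj_on_def)

lemma iso_one: "\<alpha> \<in> iso B B \<Longrightarrow> \<alpha> \<one>\<^bsub>B\<^esub> = \<one>\<^bsub>B\<^esub>"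
  by (simp add: iso_def hom_one group_B)

lemma iso_comm:
  assumes "\<alpha> \<in> iso B B" "x \<in> carrier B" "y \<in> carrier B"
  shows "\<alpha> x \<cdot> \<alpha> y = \<alpha> y \<cdot> \<alpha> x \<longleftrightarrow> x \<cdot> y = y \<cdot> x"
  using assms by (metis B.m_closed iso_eq iso_mult)

lemma iso_pow: "\<alpha> \<in> iso B B \<Longrightarrow> x \<in> carrier B \<Longrightarrow> \<alpha> (x [^]\<^bsub>B\<^esub> (n::nat)) = \<alpha> x [^]\<^bsub>B\<^esub> n"
  by (induction n) (simp_all add: iso_one iso_mult)

lemma iso_P:
  assumes a: "\<alpha> \<in> iso B B" and x: "x \<in> carrier B"
  shows "\<alpha> x \<in> P \<longleftrightarrow> x \<in> P"
  using iso_closed[OF a x] x iso_eq[OF a _ B.one_closed, of "x [^]\<^bsub>B\<^esub> p"]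
  by (simp add: P_eq iso_pow[OF a] iso_one[OF a])

lemma P_torus: "x \<in> P \<Longrightarrow> torus x s = 1" by (simp add: P_def)

lemma iso_W:
  assumes a: "\<alpha> \<in> iso B B" and x: "x \<in> carrier B"
  shows "\<alpha> x \<in> W \<longleftrightarrow> x \<in> W"
proof -
  have "(\<forall>y\<in>P. \<alpha> x \<cdot> y = y \<cdot> \<alpha> x) \<longleftrightarrow> (\<forall>y\<in>P. x \<cdot> y = y \<cdot> x)"
    using iso_surj[OF a] iso_P[OF a] iso_comm[OF a x] P_carrier by metis
  then show ?thesis unfolding W_eq using iso_P[OF a x] by blast
qed

lemma centralizer_two:
  assumes x: "x \<in> P" and c: "x \<cdot> two_except {} = two_except {} \<cdot> x"
  shows "x = \<one>\<^bsub>B\<^esub>"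
  using commute_two[OF x c] x by (intro B_eqI) (auto simp: P_def)

lemma torus_conj_inv: "y \<in> P \<Longrightarrow> x \<in> carrier B \<Longrightarrow> torus (y \<cdot> x \<cdot> inv\<^bsub>B\<^esub> y) s = torus x s"
  using subgroup.m_inv_closed[OF subgroup_P] by (simp add: P_def torusD)

text \<open>
  The image \<open>a\<close> of the regular element \<open>two_except {}\<close> acts on \<open>P\<close> without fixed points, so
  \<open>y \<mapsto> y a y\<^sup>-\<^sup>1 a\<^sup>-\<^sup>1\<close> is a bijection of \<open>P\<close>. This conjugates \<open>a\<close>, and with it the
  image of its centralizer \<open>T\<close>, into \<open>T\<close>.
\<close>

lemma torus_conj:
  assumes a: "\<alpha> \<in> iso B B"
  shows "\<exists>y\<in>P. \<forall>t\<in>T. y \<cdot> \<alpha> t \<cdot> inv\<^bsub>B\<^esub> y \<in> T"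
proof -
  define z where "z = two_except {}"
  have z: "z \<in> T" "z \<in> carrier B" using two_except_T T_carrier by (auto simp: z_def)
  define a where "a = \<alpha> z"
  have ac: "a \<in> carrier B" using a z iso_closed by (simp add: a_def)
  \<comment> \<open>Pulling back along \<alpha> turns a fixed point of \<open>a\<close> in
    \<open>P\<close> into a fixed point of \<open>two_except {}\<close>, which is trivial.\<close>
  have fpf: "x = \<one>\<^bsub>B\<^esub>" if x: "x \<in> P" and c: "x \<cdot> a = a \<cdot> x" for x
  proof -
    obtain x' where x': "x' \<in> carrier B" "x = \<alpha> x'" using iso_surj[OF a P_carrier[OF x]] by blast
    then have "x' \<in> P" using iso_P[OF a] x by simp
    moreover have "x' \<cdot> z = z \<cdot> x'" using c iso_comm[OF a x'(1) z(2)] by (simp add: a_def x')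
    ultimately have "x' = \<one>\<^bsub>B\<^esub>" using centralizer_two unfolding z_def by blast
    then show ?thesis using x' iso_one[OF a] by simp
  qed
  let ?f = "\<lambda>y. y \<cdot> a \<cdot> inv\<^bsub>B\<^esub> y \<cdot> inv\<^bsub>B\<^esub> a"
  have inj: "inj_on ?f P"
  proof (rule inj_onI)
    fix y y' assume y: "y \<in> P" "y' \<in> P" and eq: "?f y = ?f y'"
    have yc: "y \<in> carrier B" "y' \<in> carrier B" using y P_carrier by auto
    have "y \<cdot> a \<cdot> inv\<^bsub>B\<^esub> y = y' \<cdot> a \<cdot> inv\<^bsub>B\<^esub> y'"
      using eq ac yc by simp
    then have "inv\<^bsub>B\<^esub> y' \<cdot> (y \<cdot> a \<cdot> inv\<^bsub>B\<^esub> y) \<cdot> y = inv\<^bsub>B\<^esub> y' \<cdot> (y' \<cdot> a \<cdot> inv\<^bsub>B\<^esub> y') \<cdot> y"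
      by simp
    moreover have "inv\<^bsub>B\<^esub> y' \<cdot> (y \<cdot> a \<cdot> inv\<^bsub>B\<^esub> y) \<cdot> y = (inv\<^bsub>B\<^esub> y' \<cdot> y) \<cdot> a"
      using ac yc by (simp add: B.m_assoc)
    moreover have "inv\<^bsub>B\<^esub> y' \<cdot> (y' \<cdot> a \<cdot> inv\<^bsub>B\<^esub> y') \<cdot> y = a \<cdot> (inv\<^bsub>B\<^esub> y' \<cdot> y)"
      using ac yc by (simp add: B.m_assoc B.inv_cancel_left)
    ultimately have "inv\<^bsub>B\<^esub> y' \<cdot> y = \<one>\<^bsub>B\<^esub>"
      using fpf[of "inv\<^bsub>B\<^esub> y' \<cdot> y"] y subgroup_P by (simp add: subgroup.m_closed subgroup.m_inv_closed)
    then show "y = y'" using yc by (metis B.inv_equality B.inv_inv B.inv_closed)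
  qed
  \<comment> \<open>Torus parts multiply in an abelian group, so a commutator with \<open>a\<close>
    has torus part 1.\<close>
  have into: "?f ` P \<subseteq> P"
  proof
    fix x assume "x \<in> ?f ` P"
    then obtain y where y: "y \<in> P" "x = ?f y" by blast
    have "torus x s = 1" for s
      unfolding y(2) using mult_B(1)[of "y \<cdot> a \<cdot> inv\<^bsub>B\<^esub> y" "inv\<^bsub>B\<^esub> a" s] torus_conj_inv[OF y(1) ac, of s] torus_inv[OF ac, of s]
      by (simp only: mult.commute)
    moreover have "x \<in> carrier B" unfolding y(2) using ac P_carrier[OF y(1)] by simp
    ultimately show "x \<in> P" by (simp add: P_def)
  qed
  have fin: "finite P" by (rule finite_subset[OF _ finite_B]) (auto simp: P_def)
  have surj: "?f ` P = P" using endo_inj_surj[OF fin into inj] .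
  \<comment> \<open>The target of the conjugation is the torus part of \<open>a\<close>. It differs
    from \<open>a\<close> by an element of \<open>P\<close>, and surjectivity of the commutator map
    on \<open>P\<close> makes that element a value of the map.\<close>
  define \<tau> where "\<tau> = tor (torus a)"
  have tau: "\<tau> \<in> T" "\<tau> \<in> carrier B" using tor_T[OF ac] T_carrier by (auto simp: \<tau>_def)
  have "torus (\<tau> \<cdot> inv\<^bsub>B\<^esub> a) s = 1" for s
    using torus_inv[OF ac, of s] by (simp add: \<tau>_def mult.commute)
  then have "\<tau> \<cdot> inv\<^bsub>B\<^esub> a \<in> P" using tau ac by (simp add: P_def)
  then obtain y where y: "y \<in> P" "\<tau> \<cdot> inv\<^bsub>B\<^esub> a = ?f y" using surj by blast
  have yc: "y \<in> carrier B" using y P_carrier by blast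
  define \<beta> where "\<beta> = (\<lambda>x. y \<cdot> \<alpha> x \<cdot> inv\<^bsub>B\<^esub> y)"
  have b: "\<beta> \<in> iso B B"
    using iso_set_trans[OF a B.conj_iso[OF yc]] by (simp add: \<beta>_def o_def)
  have bz: "\<beta> z = \<tau>" using y ac yc tau by (simp add: \<beta>_def a_def)
  \<comment> \<open>Write \<beta> t as v \<sigma> with v in \<open>P\<close> and \<sigma> in
    \<open>T\<close>. It commutes with \<tau>, the image of the regular element, and so does
    \<sigma>; hence v does too, and v is trivial.\<close>
  have "\<beta> t \<in> T" if t: "t \<in> T" for t
  proof -
    define \<sigma> where "\<sigma> = tor (torus (\<beta> t))"
    have bt: "\<beta> t \<in> carrier B" using iso_closed[OF b] t T_carrier by blast
    have s: "\<sigma> \<in> T" "\<sigma> \<in> carrier B" using tor_T[OF bt] T_carrier by (auto simp: \<sigma>_def)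
    define v where "v = (\<lambda>_::'s. 1::int, vert (\<beta> t), edge (\<beta> t))"
    have v: "v \<in> P" "v \<in> carrier B" using decomp_P[OF bt] P_carrier by (auto simp: v_def)
    have d: "\<beta> t = v \<cdot> \<sigma>" using decomp[OF bt] by (simp add: \<sigma>_def v_def)
    have "\<beta> t \<cdot> \<tau> = \<tau> \<cdot> \<beta> t"
      using iso_comm[OF b T_carrier[OF t] z(2)] T_comm[OF t z(1)] by (simp add: bz)
    then have "(v \<cdot> \<tau>) \<cdot> \<sigma> = (\<tau> \<cdot> v) \<cdot> \<sigma>"
      unfolding d using T_comm[OF s(1) tau(1)] s tau v by (simp add: B.m_assoc)
    then have vt: "v \<cdot> \<tau> = \<tau> \<cdot> v" using s tau v by simp
    obtain v' where v': "v' \<in> carrier B" "v = \<beta> v'" using iso_surj[OF b v(2)] by blast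
    then have "v' \<in> P" using iso_P[OF b] v by simp
    moreover have "v' \<cdot> z = z \<cdot> v'" using vt iso_comm[OF b v'(1) z(2)] by (simp add: v' bz)
    ultimately have "v' = \<one>\<^bsub>B\<^esub>" using centralizer_two unfolding z_def by blast
    then have "v = \<one>\<^bsub>B\<^esub>" using v' iso_one[OF b] by simp
    then show ?thesis using d s by simp
  qed
  with y(1) show ?thesis unfolding \<beta>_def by blast
qed

text \<open>Vertex parts simply add in \<open>P\<close>, so they are blind to conjugation there.
  This allows \<alpha> to be replaced by a conjugate that preserves \<open>T\<close>.\<close>

lemma vert_conj_P:
  assumes "y \<in> P" "x \<in> P"
  shows "vert (y \<cdot> x \<cdot> inv\<^bsub>B\<^esub> y) i = vert x i"
proof -
  have c: "x \<in> carrier B" "y \<in> carrier B" "inv\<^bsub>B\<^esub> y \<in> P" using assms P_carrier subgroup.m_inv_closed[OF subgroup_P] by auto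
  have "vert (y \<cdot> inv\<^bsub>B\<^esub> y) i = 0" using c by simp
  then have "(vert y i + vert (inv\<^bsub>B\<^esub> y) i) mod q = 0"
    unfolding mult_B P_torus[OF assms(1)] by simp
  then have "(vert x i + (vert y i + vert (inv\<^bsub>B\<^esub> y) i)) mod q = vert x i"
    using vertD(2)[OF c(1), of i] by (metis add.right_neutral mod_add_right_eq)
  then show ?thesis using P_torus assms c(3) by (simp add: mod_simps algebra_simps)
qed

text \<open>
  All the \<open>K s\<close> have the same size, and an automorphism preserving \<open>T\<close> must therefore permute them.
\<close>

definition K where "K s = {t \<in> T. torus t s = 1}"

text \<open>Exchanging the coordinates \<open>s\<close> and \<open>s'\<close> is injective on the
  torus and moves the entry 1 from one place to the other.\<close>

lemma card_K_le: assumes "s \<in> S" "s' \<in> S" shows "card (K s) \<le> card (K s')"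
proof (rule card_inj_on_le)
  let ?f = "\<lambda>t. tor (\<lambda>i. torus t (Transposition.transpose s s' i))"
  show "inj_on ?f (K s)"
  proof (rule inj_onI)
    fix t t' assume t: "t \<in> K s" "t' \<in> K s" and "?f t = ?f t'"
    then have "(\<lambda>i. torus t (Transposition.transpose s s' i)) = (\<lambda>i. torus t' (Transposition.transpose s s' i))"
      by (metis tor_simps(1))
    then have "torus t i = torus t' i" for i
      by (metis transpose_involutory)
    then have "torus t = torus t'" by blast
    then show "t = t'" using t T_eq_tor unfolding K_def by (metis (no_types, lifting) mem_Collect_eq)
  qed
  show "?f ` K s \<subseteq> K s'"
  proof (rule image_subsetI)
    fix t assume t: "t \<in> K s"
    then have tc: "t \<in> carrier B" by (simp add: K_def T_carrier)
    have "Transposition.transpose s s' i \<notin> S" if "i \<notin> S" for i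
      using that assms by (auto simp: Transposition.transpose_def)
    then have "?f t \<in> T" using torusD[OF tc] by (intro tor_in_T) auto
    moreover have "torus (?f t) s' = 1" using t by (simp add: K_def)
    ultimately show "?f t \<in> K s'" by (simp add: K_def)
  qed
  show "finite (K s')" by (rule finite_subset[OF _ finite_B]) (auto simp: K_def T_def)
qed

text \<open>Elements of \<open>K s\<close> centralise the generator at \<open>s\<close>, so their
  images centralise its image x. A nonzero vertex entry of x at \<open>s'\<close> then forces these
  images into \<open>K s'\<close>, and by equality of sizes they fill it. But \<open>K s'\<close>
  contains an element that commutes only with those elements of \<open>P\<close> that live on
  \<open>s'\<close>.\<close>

lemma iso_gen:
  assumes b: "\<beta> \<in> iso B B" and T: "\<And>t. t \<in> T \<Longrightarrow> \<beta> t \<in> T" and s: "s \<in> S"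
  shows "\<exists>s'\<in>S. \<exists>c\<in>{0<..<q}. \<beta> (gen 1 s) = gen c s'"
proof -
  define g where "g = gen 1 s"
  have g: "g \<in> P" "g \<in> carrier B" using gen_P[OF s] P_carrier by (auto simp: g_def)
  define x where "x = \<beta> g"
  have x: "x \<in> P" "x \<in> carrier B" using iso_P[OF b] iso_closed[OF b] g by (auto simp: x_def)
  have "g \<notin> W" using s by (auto simp: W_def g_def intro!: exI[of _ s])
  then have "x \<notin> W" using iso_W[OF b g(2)] by (simp add: x_def)
  then obtain s' where s': "vert x s' \<noteq> 0" using x by (auto simp: W_def)
  then have s'S: "s' \<in> S" using vertD(3)[OF x(2)] by blast
  have "\<beta> ` K s \<subseteq> K s'"
  proof (rule image_subsetI)
    fix t assume t: "t \<in> K s"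
    then have tT: "t \<in> T" "torus t s = 1" and tc: "t \<in> carrier B" by (auto simp: K_def T_carrier)
    have "t \<cdot> g = g \<cdot> t"
      using tT torusD(2)[OF tc] by (intro B_eqI) (auto simp: g_def T_def)
    then have c: "\<beta> t \<cdot> x = x \<cdot> \<beta> t" using iso_comm[OF b tc g(2)] by (simp add: x_def)
    have bt: "\<beta> t \<in> T" "\<beta> t \<in> carrier B" using T[OF tT(1)] T_carrier by auto
    have "(torus (\<beta> t) s' * vert x s') mod q = vert x s' mod q"
      using arg_cong[OF c, of "\<lambda>x. vert x s'"] bt(1) by (simp add: T_def)
    then have "q dvd (torus (\<beta> t) s' - 1) * vert x s'" by (simp add: mod_eq_dvd_iff algebra_simps)
    moreover have "\<not> q dvd vert x s'" using s' vertD(1,2)[OF x(2), of s'] by (auto dest: zdvd_imp_le)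
    ultimately have "q dvd torus (\<beta> t) s' - 1" using prime_q prime_dvd_mult_iff by blast
    then have "[torus (\<beta> t) s' = 1] (mod q)" by (simp add: cong_iff_dvd_diff)
    then have "torus (\<beta> t) s' mod q = 1" by (simp add: cong_def)
    then have "torus (\<beta> t) s' = 1" using torusD(2)[OF bt(2)] by simp
    with bt show "\<beta> t \<in> K s'" by (simp add: K_def)
  qed
  moreover have "card (\<beta> ` K s) = card (K s)"
    by (intro card_image inj_onI) (use iso_eq[OF b] T_carrier in \<open>simp add: K_def\<close>)
  moreover have "finite (K s')" by (rule finite_subset[OF _ finite_B]) (auto simp: K_def T_def)
  ultimately have "\<beta> ` K s = K s'" using card_K_le[OF s'S s] by (intro card_seteq) auto
  moreover have "two_except {s'} \<in> K s'" using two_except_T[of "{s'}"] by (simp add: K_def) (simp add: two_except_def)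
  ultimately obtain t where t: "t \<in> K s" "two_except {s'} = \<beta> t" by blast
  then have tT: "t \<in> T" "torus t s = 1" and tc: "t \<in> carrier B" by (auto simp: K_def T_carrier)
  have "t \<cdot> g = g \<cdot> t"
    using tT torusD(2)[OF tc] by (intro B_eqI) (auto simp: g_def T_def)
  then have c: "x \<cdot> two_except {s'} = two_except {s'} \<cdot> x" using iso_comm[OF b tc g(2)] t by (simp add: x_def)
  \<comment> \<open>The one pair of indices left over by \<open>commute_two\<close> is
    \<open>(s', s')\<close>, which is not an edge.\<close>
  have "edge x a b = 0" for a b
    using commute_two(2)[OF x(1) c, of a b] edgeD(3)[OF x(2), of a b] E_irrefl by (cases "a = s' \<and> b = s'") auto
  then have "x = gen (vert x s') s'"
    using commute_two(1)[OF x(1) c] vertD(2)[OF x(2)] P_torus[OF x(1)]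
    by (intro B_eqI) (simp_all only: gen_simps singleton_iff split: if_splits, simp_all)
  moreover have "vert x s' \<in> {0<..<q}" using s' vertD(1)[OF x(2), of s'] by auto
  ultimately show ?thesis using s'S unfolding x_def g_def by blast
qed

text \<open>A suitable conjugate of \<alpha> by an element of \<open>P\<close> preserves
  \<open>T\<close> and falls under \<open>iso_gen\<close>; by \<open>vert_conj_P\<close> the vertex
  part is the same for \<alpha> itself.\<close>

lemma vert_iso_gen:
  assumes a: "\<alpha> \<in> iso B B" and s: "s \<in> S"
  shows "\<exists>s'\<in>S. \<exists>c\<in>{0<..<q}. \<forall>i. vert (\<alpha> (gen 1 s)) i = (if i = s' then c else 0)"
proof -
  obtain y where y: "y \<in> P" "\<And>t. t \<in> T \<Longrightarrow> y \<cdot> \<alpha> t \<cdot> inv\<^bsub>B\<^esub> y \<in> T" using torus_conj[OF a] by blast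
  define \<beta> where "\<beta> = (\<lambda>x. y \<cdot> \<alpha> x \<cdot> inv\<^bsub>B\<^esub> y)"
  have b: "\<beta> \<in> iso B B"
    using iso_set_trans[OF a B.conj_iso[OF P_carrier[OF y(1)]]] by (simp add: \<beta>_def o_def)
  have "\<And>t. t \<in> T \<Longrightarrow> \<beta> t \<in> T" using y by (simp add: \<beta>_def)
  then obtain s' c where s': "s' \<in> S" "c \<in> {0<..<q}" "\<beta> (gen 1 s) = gen c s'"
    using iso_gen[OF b _ s] by blast
  have "\<alpha> (gen 1 s) \<in> P" using iso_P[OF a] gen_P[OF s] P_carrier by blast
  then have "vert (\<beta> (gen 1 s)) i = vert (\<alpha> (gen 1 s)) i" for i
    unfolding \<beta>_def by (rule vert_conj_P[OF y(1)])
  then have "vert (\<alpha> (gen 1 s)) i = (if i = s' then c else 0)" for i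
    using s'(2) unfolding s'(3) by (metis gen_simps(2) greaterThanLessThan_iff mod_pos_pos_trivial less_imp_le)
  with s'(1,2) show ?thesis by blast
qed

section \<open>The monomial action on the vertices\<close>

definition act :: "('s graph_elt \<Rightarrow> 's graph_elt) \<Rightarrow> 's \<Rightarrow> 's" where
  "act \<alpha> = (\<lambda>s\<in>S. THE s'. vert (\<alpha> (gen 1 s)) s' \<noteq> 0)"

text \<open>Modulo \<open>W\<close>, an automorphism acts on the generators by a monomial matrix:
  \<open>act\<close> is its permutation, cut down to \<open>S\<close> so that it can belong to
  \<open>Bij S\<close>, and \<open>coef\<close> holds the nonzero entries.\<close>

definition coef :: "('s graph_elt \<Rightarrow> 's graph_elt) \<Rightarrow> 's \<Rightarrow> int" where
  "coef \<alpha> s = vert (\<alpha> (gen 1 s)) (act \<alpha> s)"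

lemma act_eqI:
  assumes "s \<in> S" "\<And>i. vert (\<alpha> (gen 1 s)) i = (if i = s' then c else 0)" "c \<noteq> 0"
  shows "act \<alpha> s = s'" "coef \<alpha> s = c"
proof -
  show "act \<alpha> s = s'"
    using assms by (auto simp: act_def intro!: the_equality split: if_splits)
  then show "coef \<alpha> s = c" by (simp add: coef_def assms)
qed

lemma act:
  assumes "\<alpha> \<in> iso B B" "s \<in> S"
  shows "act \<alpha> s \<in> S" "coef \<alpha> s \<in> {0<..<q}" "vert (\<alpha> (gen 1 s)) i = (if i = act \<alpha> s then coef \<alpha> s else 0)"
proof -
  obtain s' c where s': "s' \<in> S" "c \<in> {0<..<q}" "\<And>i. vert (\<alpha> (gen 1 s)) i = (if i = s' then c else 0)"
    using vert_iso_gen[OF assms] by blast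
  from s'(2) have "c \<noteq> 0" by simp
  note eq = act_eqI[of s \<alpha> s' c, OF assms(2) s'(3) this]
  show "act \<alpha> s \<in> S" "coef \<alpha> s \<in> {0<..<q}" "vert (\<alpha> (gen 1 s)) i = (if i = act \<alpha> s then coef \<alpha> s else 0)"
    unfolding eq using s' by blast+
qed

text \<open>Modulo \<open>W\<close>, which \<alpha> preserves and which has no vertex part, x is the
  power of \<open>gen 1 s\<close> with exponent c.\<close>

lemma vert_iso:
  assumes a: "\<alpha> \<in> iso B B" and x: "x \<in> P" and s: "s \<in> S" and v: "\<And>i. vert x i = (if i = s then c else 0)" and c: "c \<in> {0..<q}"
  shows "vert (\<alpha> x) i = c * vert (\<alpha> (gen 1 s)) i mod q"
proof -
  define g where "g = gen c s"
  have g: "g \<in> P" "g \<in> carrier B" using gen_P[OF s] P_carrier by (auto simp: g_def)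
  define w where "w = inv\<^bsub>B\<^esub> g \<cdot> x"
  have xc: "x \<in> carrier B" using x P_carrier by blast
  have wP: "w \<in> P" using subgroup_P g x by (simp add: w_def subgroup.m_closed subgroup.m_inv_closed)
  have wc: "w \<in> carrier B" using wP P_carrier by blast
  have xgw: "x = g \<cdot> w" using g xc by (simp add: w_def B.inv_cancel_left)
  have "vert w i = 0" for i
  proof -
    have "vert x i = (vert g i + vert w i) mod q"
      using xgw P_torus[OF g(1)] by simp
    then have "q dvd vert w i" using v[of i] c by (auto simp: g_def cong_def split: if_splits) (metis add_diff_cancel_left' mod_eq_dvd_iff mod_pos_pos_trivial minus_diff_eq dvd_minus_iff)
    then show ?thesis using vertD(1,2)[OF wc, of i] by auto
  qed
  then have "w \<in> W" using wP by (simp add: W_def)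
  then have "\<alpha> w \<in> W" using iso_W[OF a] wc by blast
  moreover have "\<alpha> g = \<alpha> (gen 1 s) [^]\<^bsub>B\<^esub> nat c"
    using iso_pow[OF a P_carrier[OF gen_P[OF s]], of 1 "nat c"] gen_pow[OF s, of "nat c"] c by (simp add: g_def)
  moreover have gP: "\<alpha> (gen 1 s) \<in> P" using iso_P[OF a] gen_P[OF s] P_carrier by blast
  moreover have "\<alpha> x = \<alpha> g \<cdot> \<alpha> w" unfolding xgw using iso_mult[OF a g(2) wc] .
  ultimately show ?thesis using c pow_P[OF gP, of "nat c"] by (simp add: W_def P_torus)
qed

text \<open>This is multiplication of monomial matrices. The product of two nonzero scalars stays
  nonzero because \<open>q\<close> is prime, so the entry found is the one that \<open>act\<close>
  selects.\<close>

lemma act_comp: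
  assumes a: "\<alpha> \<in> iso B B" and b: "\<beta> \<in> iso B B" and s: "s \<in> S"
  shows "act (compose (carrier B) \<alpha> \<beta>) s = act \<alpha> (act \<beta> s)"
    "coef (compose (carrier B) \<alpha> \<beta>) s = coef \<beta> s * coef \<alpha> (act \<beta> s) mod q"
proof -
  have g: "gen 1 s \<in> carrier B" using gen_P[OF s] P_carrier by blast
  have bP: "\<beta> (gen 1 s) \<in> P" using iso_P[OF b g] gen_P[OF s] by blast
  have *: "vert (compose (carrier B) \<alpha> \<beta> (gen 1 s)) i = (if i = act \<alpha> (act \<beta> s) then coef \<beta> s * coef \<alpha> (act \<beta> s) mod q else 0)" for i
  proof -
    have "vert (\<alpha> (\<beta> (gen 1 s))) i = coef \<beta> s * vert (\<alpha> (gen 1 (act \<beta> s))) i mod q"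
      using act[OF b s] by (intro vert_iso[OF a bP]) auto
    then show ?thesis using act(3)[OF a act(1)[OF b s]] g by (simp add: compose_eq)
  qed
  have "\<not> q dvd coef \<beta> s" "\<not> q dvd coef \<alpha> (act \<beta> s)"
    using act(2)[OF b s] act(2)[OF a act(1)[OF b s]] by (auto dest: zdvd_imp_le)
  then have "\<not> q dvd coef \<beta> s * coef \<alpha> (act \<beta> s)" using prime_q prime_dvd_mult_iff by blast
  then have ne: "coef \<beta> s * coef \<alpha> (act \<beta> s) mod q \<noteq> 0" by (simp add: mod_eq_0_iff_dvd)
  show "act (compose (carrier B) \<alpha> \<beta>) s = act \<alpha> (act \<beta> s)"
    by (rule act_eqI(1)[OF s _ ne], rule *)
  show "coef (compose (carrier B) \<alpha> \<beta>) s = coef \<beta> s * coef \<alpha> (act \<beta> s) mod q"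
    by (rule act_eqI(2)[OF s _ ne], rule *)
qed

lemma act_id: "s \<in> S \<Longrightarrow> act (\<lambda>x\<in>carrier B. x) s = s"
  using gen_P P_carrier by (intro act_eqI(1)[where c = 1]) auto

definition graph_auts where
  "graph_auts = {\<pi> \<in> Bij S. \<forall>s\<in>S. \<forall>s'\<in>S. E (\<pi> s) (\<pi> s') \<longleftrightarrow> E s s'}"

lemma auto_iso: "\<alpha> \<in> auto B \<Longrightarrow> \<alpha> \<in> iso B B"
  by (simp add: auto_def Bij_def iso_def)

text \<open>Adjacency is noncommutation: elements of \<open>P\<close> whose vertex parts are
  concentrated at u and at v, with nonzero scalars, fail to commute exactly when u and v are
  adjacent. Automorphisms preserve commutation.\<close>

lemma act_E:
  assumes a: "\<alpha> \<in> iso B B" and s: "s \<in> S" "s' \<in> S"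
  shows "E (act \<alpha> s) (act \<alpha> s') \<longleftrightarrow> E s s'"
proof -
  have *: "x \<cdot> y \<noteq> y \<cdot> x \<longleftrightarrow> E u v"
    if x: "x \<in> P" "\<And>i. vert x i = (if i = u then c else 0)" "c \<in> {0<..<q}"
    and y: "y \<in> P" "\<And>i. vert y i = (if i = v then d else 0)" "d \<in> {0<..<q}" for x y u v c d
  proof
    assume e: "E u v"
    have "\<not> q dvd c" "\<not> q dvd d" using x(3) y(3) by (auto dest: zdvd_imp_le)
    then have "\<not> q dvd c * d" using prime_q prime_dvd_mult_iff by blast
    moreover have "u \<noteq> v" using e E_irrefl by blast
    ultimately have "\<not> q dvd vert x u * vert y v - vert x v * vert y u" by (simp add: x(2) y(2))
    then show "x \<cdot> y \<noteq> y \<cdot> x" using e commute_P[OF x(1) y(1)] by blast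
  next
    assume "x \<cdot> y \<noteq> y \<cdot> x"
    then obtain i j where "E i j" "\<not> q dvd vert x i * vert y j - vert x j * vert y i"
      using commute_P[OF x(1) y(1)] by blast
    then show "E u v" using E_sym by (auto simp: x(2) y(2) split: if_splits)
  qed
  have g: "gen 1 s \<in> P" "gen 1 s' \<in> P" using gen_P s by auto
  then have ag: "\<alpha> (gen 1 s) \<in> P" "\<alpha> (gen 1 s') \<in> P" using iso_P[OF a] P_carrier by blast+
  have "E s s' \<longleftrightarrow> gen 1 s \<cdot> gen 1 s' \<noteq> gen 1 s' \<cdot> gen 1 s"
    using *[OF g(1) _ _ g(2), of s 1 s' 1] q_gt by simp
  moreover have "E (act \<alpha> s) (act \<alpha> s') \<longleftrightarrow> \<alpha> (gen 1 s) \<cdot> \<alpha> (gen 1 s') \<noteq> \<alpha> (gen 1 s') \<cdot> \<alpha> (gen 1 s)"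
    using *[OF ag(1) act(3)[OF a s(1)] act(2)[OF a s(1)] ag(2) act(3)[OF a s(2)] act(2)[OF a s(2)]] by simp
  ultimately show ?thesis using iso_comm[OF a P_carrier[OF g(1)] P_carrier[OF g(2)]] by blast
qed

interpretation Aut: group "AutoGroup B" by (rule B.AutoGroup)
interpretation BS: group "BijGroup S" by (rule group_BijGroup)

lemma act_Bij: assumes a: "\<alpha> \<in> auto B" shows "act \<alpha> \<in> Bij S"
proof -
  have a': "\<alpha> \<in> iso B B" using a by (rule auto_iso)
  define \<beta> where "\<beta> = inv\<^bsub>AutoGroup B\<^esub> \<alpha>"
  have b: "\<beta> \<in> auto B" using Aut.inv_closed a by (simp add: \<beta>_def AutoGroup_simps)
  have b': "\<beta> \<in> iso B B" using b by (rule auto_iso)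
  have "\<alpha> \<otimes>\<^bsub>AutoGroup B\<^esub> \<beta> = \<one>\<^bsub>AutoGroup B\<^esub>" "\<beta> \<otimes>\<^bsub>AutoGroup B\<^esub> \<alpha> = \<one>\<^bsub>AutoGroup B\<^esub>"
    using a unfolding \<beta>_def by (auto simp flip: AutoGroup_simps(1))
  then have "compose (carrier B) \<alpha> \<beta> = (\<lambda>x\<in>carrier B. x)" "compose (carrier B) \<beta> \<alpha> = (\<lambda>x\<in>carrier B. x)"
    using a b by (simp_all add: AutoGroup_simps)
  then have "act \<alpha> (act \<beta> s) = s" "act \<beta> (act \<alpha> s) = s" if "s \<in> S" for s
    using act_comp(1)[OF a' b' that] act_comp(1)[OF b' a' that] act_id[OF that] by auto
  then have "bij_betw (act \<alpha>) S S"
    using act(1)[OF a'] act(1)[OF b'] by (intro bij_betw_byWitness[where f' = "act \<beta>"]) auto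
  then show ?thesis by (simp add: Bij_def act_def)
qed

lemma act_graph_auts: "\<alpha> \<in> auto B \<Longrightarrow> act \<alpha> \<in> graph_auts"
  using act_Bij act_E auto_iso by (simp add: graph_auts_def)

lemma act_hom: "act \<in> hom (AutoGroup B) (BijGroup S)"
proof (rule homI)
  fix \<alpha> \<beta> assume "\<alpha> \<in> carrier (AutoGroup B)" "\<beta> \<in> carrier (AutoGroup B)"
  then have ab: "\<alpha> \<in> auto B" "\<beta> \<in> auto B" by (simp_all add: AutoGroup_simps)
  have "act (compose (carrier B) \<alpha> \<beta>) = compose S (act \<alpha>) (act \<beta>)"
    using act_comp(1)[OF ab[THEN auto_iso]] by (intro extensionalityI[of _ S]) (auto simp: act_def compose_def)
  then show "act (\<alpha> \<otimes>\<^bsub>AutoGroup B\<^esub> \<beta>) = act \<alpha> \<otimes>\<^bsub>BijGroup S\<^esub> act \<beta>"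
    using ab act_Bij by (simp add: AutoGroup_simps BijGroup_def)
qed (simp add: AutoGroup_simps BijGroup_def act_Bij)

text \<open>Coordinates are pulled back along \<sigma>, so a permutation of the generators is
  realised by its inverse.\<close>

definition permute :: "('s \<Rightarrow> 's) \<Rightarrow> 's graph_elt \<Rightarrow> 's graph_elt" where
  "permute \<sigma> x = (\<lambda>s. torus x (\<sigma> s), \<lambda>s. vert x (\<sigma> s), \<lambda>s s'. edge x (\<sigma> s) (\<sigma> s'))"

text \<open>The group law refers to the vertices only through \<open>E\<close>, so a relabelling of
  the coordinates that respects \<open>E\<close> is an automorphism.\<close>

lemma act_surj:
  assumes p: "\<pi> \<in> graph_auts"
  shows "\<exists>\<alpha>\<in>auto B. act \<alpha> = \<pi>"
proof -
  have bij: "bij_betw \<pi> S S" and ext: "\<pi> \<in> extensional S" and E: "\<And>s s'. s \<in> S \<Longrightarrow> s' \<in> S \<Longrightarrow> E (\<pi> s) (\<pi> s') \<longleftrightarrow> E s s'"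
    using p by (auto simp: graph_auts_def Bij_def)
  \<comment> \<open>The inverse of \<pi> on \<open>S\<close>; the identity elsewhere keeps the
    default entries in place.\<close>
  define \<sigma> where "\<sigma> = (\<lambda>s. if s \<in> S then inv_into S \<pi> s else s)"
  have \<sigma>S: "\<sigma> s \<in> S \<longleftrightarrow> s \<in> S" for s
    using bij by (auto simp: \<sigma>_def bij_betw_def inv_into_into)
  have \<sigma>\<pi>: "\<sigma> (\<pi> s) = s" "\<pi> (\<sigma> s) = s" if "s \<in> S" for s
    using bij that by (auto simp: \<sigma>_def bij_betw_def f_inv_into_f)
  have \<pi>S: "\<pi> s \<in> S" if "s \<in> S" for s using bij that by (auto simp: bij_betw_def)
  have \<sigma>inv: "\<exists>s'. \<sigma> s' = s" for s
    using \<sigma>\<pi>(1)[of s] by (cases "s \<in> S") (blast, auto simp: \<sigma>_def)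
  have \<sigma>E: "E (\<sigma> s) (\<sigma> s') \<longleftrightarrow> E s s'" for s s'
  proof (cases "s \<in> S \<and> s' \<in> S")
    case True
    then show ?thesis using E[of "\<sigma> s" "\<sigma> s'"] \<sigma>\<pi> \<sigma>S by simp
  next
    case False
    then show ?thesis using \<sigma>S E_in E_sym by blast
  qed
  have closed: "permute \<sigma> x \<in> carrier B" if x: "x \<in> carrier B" for x
    unfolding carrier_B permute_def fst_conv snd_conv
    using torusD(1,3,4)[OF x] vertD(1,3)[OF x] edgeD(1,3)[OF x] \<sigma>S \<sigma>E
    by (intro conjI allI edge_alt[OF x] impI) simp_all
  have hom: "permute \<sigma> (x \<cdot> y) = permute \<sigma> x \<cdot> permute \<sigma> y" for x y
    by (rule B_eqI) (simp_all add: permute_def \<sigma>E)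
  have inj: "inj_on (permute \<sigma>) (carrier B)"
  proof (rule inj_onI)
    fix x y assume eq: "permute \<sigma> x = permute \<sigma> y"
    have "torus x (\<sigma> s) = torus y (\<sigma> s)" "vert x (\<sigma> s) = vert y (\<sigma> s)" "edge x (\<sigma> s) (\<sigma> s') = edge y (\<sigma> s) (\<sigma> s')" for s s'
      using eq by (auto simp: permute_def fun_eq_iff)
    then show "x = y" using \<sigma>inv by (intro B_eqI) metis+
  qed
  have "permute \<sigma> ` carrier B = carrier B"
    using endo_inj_surj[OF finite_B _ inj] closed by blast
  then have bijb: "bij_betw (permute \<sigma>) (carrier B) (carrier B)" using inj by (simp add: bij_betw_def)
  define \<alpha> where "\<alpha> = restrict (permute \<sigma>) (carrier B)"
  have "\<alpha> \<in> auto B"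
    unfolding auto_def Bij_def using bijb closed hom
    by (auto simp: \<alpha>_def hom_def)
  moreover have "act \<alpha> = \<pi>"
  proof (rule extensionalityI[of _ S])
    fix s assume s: "s \<in> S"
    have "gen 1 s \<in> carrier B" using gen_P[OF s] P_carrier by blast
    moreover have "\<sigma> i = s \<longleftrightarrow> i = \<pi> s" for i
      using \<sigma>\<pi> \<sigma>S s by metis
    ultimately show "act \<alpha> s = \<pi> s"
      by (intro act_eqI(1)[OF s, where c = 1]) (auto simp: \<alpha>_def permute_def)
  qed (simp_all add: act_def ext)
  ultimately show ?thesis by blast
qed

section \<open>Rigidity: automorphisms that fix the generators and preserve the torus\<close>

lemma iso_fixes_torus:
  assumes b: "\<beta> \<in> iso B B" and T: "\<And>t. t \<in> T \<Longrightarrow> \<beta> t \<in> T" and g: "\<And>s. s \<in> S \<Longrightarrow> \<beta> (gen 1 s) = gen 1 s"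
    and t: "t \<in> T"
  shows "\<beta> t = t"
proof -
  have tc: "t \<in> carrier B" "\<beta> t \<in> carrier B" using t T T_carrier by auto
  have "torus (\<beta> t) s = torus t s" for s
  proof (cases "s \<in> S")
    case True
    have gc: "gen c s \<in> carrier B" for c using gen_P[OF True] P_carrier by blast
    define c where "c = torus t s"
    have c: "c \<in> {0..<q}" using torusD(1)[OF tc(1)] by (simp add: c_def)
    have "\<beta> (gen c s) = gen c s"
      using iso_pow[OF b gc, of 1 "nat c"] gen_pow[OF True, of "nat c"] c g[OF True] by simp
    \<comment> \<open>This relation reads off the entry of t at s from the action of t on the
      generator. Since \<beta> fixes \<open>gen 1 s\<close> and its power \<open>gen c s\<close>,
      the entry of \<beta> t is the same.\<close>
    moreover have "t \<cdot> gen 1 s = gen c s \<cdot> t"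
      using t torusD(2)[OF tc(1)] by (intro B_eqI) (auto simp: T_def c_def)
    ultimately have "\<beta> t \<cdot> gen 1 s = gen c s \<cdot> \<beta> t"
      using iso_mult[OF b tc(1) gc, of 1] iso_mult[OF b gc tc(1), of c] g[OF True] by simp
    from arg_cong[OF this, of "\<lambda>x. vert x s"] show ?thesis
      using T[OF t] torusD(2)[OF tc(2)] c by (simp add: T_def c_def)
  qed (simp add: torusD(4)[OF tc(1)] torusD(4)[OF tc(2)])
  then have "torus (\<beta> t) = torus t" by (rule ext)
  then show ?thesis using T_eq_tor[OF t] T_eq_tor[OF T[OF t]] by metis
qed

definition edge_elt :: "int \<Rightarrow> 's \<Rightarrow> 's \<Rightarrow> 's graph_elt" where
  "edge_elt c s s' = (\<lambda>_. 1, \<lambda>_. 0, \<lambda>a b. if (a, b) = (s, s') then c mod q else if (a, b) = (s', s) then (- c) mod q else 0)"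

lemma edge_elt_simps [simp]: "torus (edge_elt c s s') i = 1" "vert (edge_elt c s s') i = 0"
  "edge (edge_elt c s s') a b = (if (a, b) = (s, s') then c mod q else if (a, b) = (s', s) then (- c) mod q else 0)"
  by (simp_all add: edge_elt_def)

lemma edge_elt_carrier: assumes "E s s'" shows "edge_elt c s s' \<in> carrier B"
proof -
  have "s \<noteq> s'" "E s' s" using assms E_irrefl E_sym by blast+
  then show ?thesis unfolding carrier_B using assms by (auto simp: mod_minus_eq)
qed

text \<open>The edge element is the commutator of two generators, up to the factor 2, which is invertible.\<close>

lemma iso_fixes_edge_elt:
  assumes b: "\<beta> \<in> iso B B" and g: "\<And>s. s \<in> S \<Longrightarrow> \<beta> (gen 1 s) = gen 1 s" and E: "E s s'"
  shows "\<beta> (edge_elt c s s') = edge_elt c s s'"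
proof -
  have ne: "s \<noteq> s'" and E': "E s' s" and S: "s \<in> S" "s' \<in> S" using E E_irrefl E_sym E_in by blast+
  have gc: "gen d i \<in> carrier B" if "i \<in> S" for d i using gen_P[OF that] P_carrier by blast
  have fix_gen: "\<beta> (gen (int n) i) = gen (int n) i" if "i \<in> S" for n i
    using iso_pow[OF b gc[OF that], of 1 n] gen_pow[OF that, of n] g[OF that] by simp
  \<comment> \<open>The inverse of 2 modulo the odd prime \<open>p\<close>. Interchanging
    \<open>gen d s\<close> and \<open>gen 1 s'\<close> changes the edge entry by 2 d, so d has to be
    c divided by 2; it is a natural number so that \<open>gen d s\<close> is a power of
    \<open>gen 1 s\<close>.\<close>
  define m where "m = (p + 1) div 2"
  have "odd p" using prime_p p_gt r_gt prime_odd_nat by simp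
  then have m: "2 * int m = q + 1" by (auto simp: m_def elim!: oddE)
  define d where "d = nat (int m * c mod q)"
  have d: "int d = int m * c mod q" by (simp add: d_def)
  have d2: "(int d + int d) mod q = c mod q"
  proof -
    have "(int d + int d) mod q = ((2 * int m) * c) mod q" unfolding d by (simp add: mod_simps mult.assoc)
    also have "\<dots> = (c + q * c) mod q" unfolding m by (simp add: algebra_simps)
    finally show ?thesis by simp
  qed
  define x where "x = gen (int d) s \<cdot> gen (int 1) s'"
  define y where "y = gen (int 1) s' \<cdot> gen (int d) s"
  have xy: "x \<in> carrier B" "y \<in> carrier B" "\<beta> x = x" "\<beta> y = y"
    using gc S fix_gen iso_mult[OF b] by (simp_all add: x_def y_def g)
  have e: "edge_elt c s s' \<in> carrier B" using edge_elt_carrier[OF E] .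
  have "x = edge_elt c s s' \<cdot> y"
  proof (rule B_eqI)
    fix i j
    show "torus x i = torus (edge_elt c s s' \<cdot> y) i" by (simp add: x_def y_def)
    show "vert x i = vert (edge_elt c s s' \<cdot> y) i" using ne by (simp add: x_def y_def)
    consider "i = s \<and> j = s'" | "i = s' \<and> j = s" | "(i, j) \<noteq> (s, s') \<and> (i, j) \<noteq> (s', s)" by auto
    then show "edge x i j = edge (edge_elt c s s' \<cdot> y) i j"
    proof cases
      case 1
      have "int d mod q = (c mod q + (- int d) mod q) mod q"
        using d2 by (metis add_diff_cancel_right' diff_conv_add_uminus mod_add_eq)
      with 1 show ?thesis using E ne by (simp add: x_def y_def mod_simps)
    next
      case 2
      have "(- int d) mod q = ((- c) mod q + int d mod q) mod q"
      proof -
        have "q dvd (int d + int d) - c" using d2 by (simp only: mod_eq_dvd_iff)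
        moreover have "- int d - (- c + int d) = - ((int d + int d) - c)" by simp
        ultimately have "q dvd - int d - (- c + int d)" by (simp only: dvd_minus_iff)
        then show ?thesis by (simp only: mod_eq_dvd_iff mod_add_eq)
      qed
      with 2 show ?thesis using E' ne by (simp add: x_def y_def mod_simps)
    next
      case 3
      then show ?thesis using ne by (auto simp: x_def y_def)
    qed
  qed
  then have "edge_elt c s s' \<cdot> y = \<beta> (edge_elt c s s') \<cdot> y"
    using iso_mult[OF b e xy(2)] xy by simp
  then show ?thesis using e xy iso_closed[OF b e] by simp
qed

text \<open>Multiplying by an element that \<beta> is known to fix does not change the question. So
  nonzero entries can be cleared one at a time, edge entries by \<open>edge_elt\<close> and vertex
  entries by powers of generators, with induction on the size of the support.\<close>

lemma iso_fixes_P: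
  assumes b: "\<beta> \<in> iso B B" and g: "\<And>s. s \<in> S \<Longrightarrow> \<beta> (gen 1 s) = gen 1 s" and x: "x \<in> P"
  shows "\<beta> x = x"
proof -
  have cancel: "\<beta> x = x" if "e \<in> carrier B" "\<beta> e = e" "x \<in> carrier B" "\<beta> (e \<cdot> x) = e \<cdot> x" for e x
  proof -
    have "e \<cdot> \<beta> x = e \<cdot> x" using iso_mult[OF b that(1,3)] that(2,4) by simp
    then show ?thesis using that iso_closed[OF b that(3)] by simp
  qed
  have W: "\<beta> x = x" if "x \<in> W" for x
    using that
  proof (induction "card {(a, b). edge x a b \<noteq> 0}" arbitrary: x rule: less_induct)
    case less
    have xc: "x \<in> carrier B" using less.prems W_carrier by blast
    have tv: "torus x i = 1" "vert x i = 0" for i using less.prems by (auto simp: W_def P_def)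
    show ?case
    proof (cases "\<exists>a b. edge x a b \<noteq> 0")
      case True
      then obtain a b where ab: "edge x a b \<noteq> 0" by blast
      then have E: "E a b" using edgeD(3)[OF xc] by blast
      then have ne: "a \<noteq> b" using E_irrefl by blast
      let ?e = "edge_elt (- edge x a b) a b"
      have ex: "edge (?e \<cdot> x) i j = (if (i, j) \<in> {(a, b), (b, a)} then 0 else edge x i j)" for i j
      proof -
        have m: "edge (?e \<cdot> x) i j = (edge ?e i j + edge x i j) mod q"
          by (simp only: mult_B edge_elt_simps(1,2) tv mult_1 mult_zero_left mult_zero_right diff_self if_cancel add_0_right)
        consider "i = a \<and> j = b" | "i = b \<and> j = a" | "(i, j) \<notin> {(a, b), (b, a)}" by auto
        then show ?thesis
        proof cases
          case 1
          then show ?thesis unfolding m using ne by (simp add: mod_simps)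
        next
          case 2
          then have "edge x i j = (- edge x a b) mod q" using edge_alt[OF xc, of b a] by simp
          then show ?thesis unfolding m using ne 2 by (simp add: mod_simps)
        next
          case 3
          then have "(i, j) \<noteq> (a, b)" "(i, j) \<noteq> (b, a)" by blast+
          then have "edge ?e i j = 0" by (simp only: edge_elt_simps if_False)
          with 3 show ?thesis unfolding m using edgeD(2)[OF xc, of i j] by (simp only: if_False add_0)
        qed
      qed
      have fin: "finite {(i, j). edge x i j \<noteq> 0}"
        by (rule finite_subset[of _ "S \<times> S"]) (use edgeD(3)[OF xc] E_in E_sym finite_S in blast)+
      have "{(i, j). edge (?e \<cdot> x) i j \<noteq> 0} \<subset> {(i, j). edge x i j \<noteq> 0}"
        using ab by (auto simp only: ex split: if_splits)
      then have lt: "card {(i, j). edge (?e \<cdot> x) i j \<noteq> 0} < card {(i, j). edge x i j \<noteq> 0}"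
        using fin psubset_card_mono by blast
      have "?e \<cdot> x \<in> W"
        using edge_elt_carrier[OF E] xc by (simp add: W_def P_def tv)
      then have "\<beta> (?e \<cdot> x) = ?e \<cdot> x" using less.hyps[OF lt] by blast
      then show ?thesis using cancel[OF edge_elt_carrier[OF E] iso_fixes_edge_elt[OF b g E] xc] by blast
    next
      case False
      then have "x = \<one>\<^bsub>B\<^esub>" by (intro B_eqI) (auto simp: tv)
      then show ?thesis using iso_one[OF b] by simp
    qed
  qed
  show ?thesis
    using x
  proof (induction "card {a. vert x a \<noteq> 0}" arbitrary: x rule: less_induct)
    case less
    have xc: "x \<in> carrier B" using less.prems P_carrier by blast
    show ?case
    proof (cases "\<exists>a. vert x a \<noteq> 0")
      case True
      then obtain a where a: "vert x a \<noteq> 0" by blast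
      then have S: "a \<in> S" using vertD(3)[OF xc] by blast
      let ?e = "gen (- vert x a) a"
      have e: "?e \<in> P" "?e \<in> carrier B" using gen_P[OF S] P_carrier by auto
      \<comment> \<open>The residue as a natural exponent, so that \<open>?e\<close> is a power of
        \<open>gen 1 a\<close>.\<close>
      define n where "n = nat ((- vert x a) mod q)"
      have "?e = gen (int n) a" by (rule B_eqI) (auto simp: n_def)
      then have fe: "\<beta> ?e = ?e"
        using iso_pow[OF b P_carrier[OF gen_P[OF S]], of 1 n] gen_pow[OF S, of n] g[OF S] by simp
      have ex: "vert (?e \<cdot> x) i = (if i = a then 0 else vert x i)" for i
        using vertD(2)[OF xc, of i] by (simp add: mod_simps)
      have fin: "finite {i. vert x i \<noteq> 0}"
        by (rule finite_subset[OF _ finite_S]) (use vertD(3)[OF xc] in blast)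
      have "{i. vert (?e \<cdot> x) i \<noteq> 0} \<subset> {i. vert x i \<noteq> 0}"
        using a by (auto simp only: ex split: if_splits)
      then have lt: "card {i. vert (?e \<cdot> x) i \<noteq> 0} < card {i. vert x i \<noteq> 0}"
        using fin psubset_card_mono by blast
      have "?e \<cdot> x \<in> P" using subgroup.m_closed[OF subgroup_P e(1) less.prems] .
      then have "\<beta> (?e \<cdot> x) = ?e \<cdot> x" using less.hyps[OF lt] by blast
      then show ?thesis using cancel[OF e(2) fe xc] by blast
    next
      case False
      then have "x \<in> W" using less.prems by (simp add: W_def)
      then show ?thesis by (rule W)
    qed
  qed
qed

lemma iso_trivial:
  assumes b: "\<beta> \<in> iso B B" and T: "\<And>t. t \<in> T \<Longrightarrow> \<beta> t \<in> T" and g: "\<And>s. s \<in> S \<Longrightarrow> \<beta> (gen 1 s) = gen 1 s"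
    and x: "x \<in> carrier B"
  shows "\<beta> x = x"
proof -
  have v: "(\<lambda>_. 1, vert x, edge x) \<in> P" "(\<lambda>_. 1, vert x, edge x) \<in> carrier B" using decomp_P[OF x] P_carrier by auto
  have t: "tor (torus x) \<in> T" "tor (torus x) \<in> carrier B" using tor_T[OF x] T_carrier by auto
  have "\<beta> ((\<lambda>_. 1, vert x, edge x) \<cdot> tor (torus x)) = (\<lambda>_. 1, vert x, edge x) \<cdot> tor (torus x)"
    using iso_mult[OF b v(2) t(2)] iso_fixes_P[OF b g v(1)] iso_fixes_torus[OF b T g t(1)] by simp
  then show ?thesis using decomp[OF x] by metis
qed

section \<open>Inner automorphisms recognised by their order\<close>

lemma coef_id: assumes "s \<in> S" shows "coef (\<lambda>x\<in>carrier B. x) s = 1"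
  using gen_P[OF assms] P_carrier by (intro act_eqI(2)[OF assms, where s' = s]) auto

text \<open>With the vertices fixed, the composition rule for scalars loses its twist and becomes
  plain multiplication.\<close>

lemma coef_pow:
  assumes a: "\<alpha> \<in> auto B" and act: "\<And>s. s \<in> S \<Longrightarrow> act \<alpha> s = s" and s: "s \<in> S"
  shows "act (\<alpha> [^]\<^bsub>AutoGroup B\<^esub> (n::nat)) s = s \<and> coef (\<alpha> [^]\<^bsub>AutoGroup B\<^esub> n) s = coef \<alpha> s ^ n mod q"
proof (induction n)
  case 0
  show ?case using act_id[OF s] coef_id[OF s] by (simp only: Aut.nat_pow_0 AutoGroup_simps(3)) simp
next
  case (Suc n)
  have n: "\<alpha> [^]\<^bsub>AutoGroup B\<^esub> n \<in> auto B" using Aut.nat_pow_closed a by (simp add: AutoGroup_simps)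
  have "\<alpha> [^]\<^bsub>AutoGroup B\<^esub> Suc n = compose (carrier B) (\<alpha> [^]\<^bsub>AutoGroup B\<^esub> n) \<alpha>"
    using n a by (simp add: AutoGroup_simps)
  then show ?case
    using act_comp[OF auto_iso[OF n] auto_iso[OF a] s] Suc act[OF s] by (simp add: mod_simps)
qed

lemma carrier_BijGroup: "carrier (BijGroup S) = Bij S" by (simp add: BijGroup_def)

text \<open>The order of a permutation of \<open>S\<close> is at most \<open>card (Bij S)\<close>,
  which is below both primes. So it is coprime to \<open>p * r\<close>, which it also
  divides.\<close>

lemma act_trivial:
  assumes a: "\<alpha> \<in> auto B" and pr: "\<alpha> [^]\<^bsub>AutoGroup B\<^esub> (p * r) = \<one>\<^bsub>AutoGroup B\<^esub>" and s: "s \<in> S"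
  shows "act \<alpha> s = s"
proof -
  interpret h: group_hom "AutoGroup B" "BijGroup S" act
    using act_hom by (simp add: group_hom_def group_hom_axioms_def Aut.group_axioms BS.group_axioms)
  have ac: "act \<alpha> \<in> carrier (BijGroup S)" using act_Bij[OF a] by (simp add: BijGroup_def)
  have fin: "finite (carrier (BijGroup S))"
    by (rule finite_subset[OF _ finite_PiE[of S "\<lambda>_. S"]]) (use finite_S in \<open>auto simp: BijGroup_def Bij_def PiE_def bij_betw_def\<close>)
  have "act \<alpha> [^]\<^bsub>BijGroup S\<^esub> (p * r) = \<one>\<^bsub>BijGroup S\<^esub>"
    using h.hom_nat_pow[of \<alpha> "p * r"] pr a h.hom_one by (simp add: AutoGroup_simps)
  then have d: "BS.ord (act \<alpha>) dvd p * r" using BS.pow_eq_id[OF ac] by simp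
  have le: "BS.ord (act \<alpha>) \<le> card (Bij S)" "BS.ord (act \<alpha>) \<noteq> 0"
    using BS.ord_le_group_order[OF fin ac] BS.ord_ge_1[OF fin ac] carrier_BijGroup by (auto simp: order_def)
  then have "\<not> p dvd BS.ord (act \<alpha>)" "\<not> r dvd BS.ord (act \<alpha>)"
    using r_large p_gt by (auto dest!: dvd_imp_le)
  then have "coprime (BS.ord (act \<alpha>)) p" "coprime (BS.ord (act \<alpha>)) r"
    using prime_p prime_r by (metis coprime_commute prime_imp_coprime)+
  then have "coprime (BS.ord (act \<alpha>)) (p * r)" by simp
  then have "BS.ord (act \<alpha>) = 1" using d using coprime_common_divisor_nat[of _ "p * r" "BS.ord (act \<alpha>)"] by (simp add: coprime_common_divisor_nat)
  then have "act \<alpha> = \<one>\<^bsub>BijGroup S\<^esub>" using BS.ord_eq_1 ac by blast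
  then show ?thesis using s by (simp add: BijGroup_def)
qed

text \<open>The scalars satisfy c^(p r) = 1 modulo \<open>p\<close>, and Fermat removes the factor
  \<open>p\<close>, so they form an element of the torus. Once it is conjugated away and the torus
  is moved back into itself, every generator is fixed and \<open>iso_trivial\<close>
  applies.\<close>

lemma inner_if_pow:
  assumes a: "\<alpha> \<in> auto B" and pr: "\<alpha> [^]\<^bsub>AutoGroup B\<^esub> (p * r) = \<one>\<^bsub>AutoGroup B\<^esub>"
  shows "\<alpha> \<in> inner_auts B"
proof -
  have a': "\<alpha> \<in> iso B B" using a by (rule auto_iso)
  have triv: "act \<alpha> s = s" if "s \<in> S" for s using act_trivial[OF a pr that] .
  have c1: "coef \<alpha> s ^ r mod q = 1" if s: "s \<in> S" for s
  proof -
    have "coef (\<alpha> [^]\<^bsub>AutoGroup B\<^esub> (p * r)) s = 1"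
      unfolding pr AutoGroup_simps(3) by (rule coef_id[OF s])
    then have "coef \<alpha> s ^ (r * p) mod q = 1" using coef_pow[OF a triv s, of "p * r"] by (simp add: mult.commute)
    then have "(coef \<alpha> s ^ r) ^ p mod q = 1" by (simp add: power_mult)
    then show ?thesis using fermat[of "coef \<alpha> s ^ r"] by (simp add: cong_def)
  qed
  define C where "C = tor (\<lambda>s. if s \<in> S then coef \<alpha> s else 1)"
  have C: "C \<in> T" "C \<in> carrier B"
  proof -
    have "0 \<le> coef \<alpha> s \<and> coef \<alpha> s < q" if "s \<in> S" for s using act(2)[OF a' that] by simp
    then show "C \<in> T" unfolding C_def using c1 q_gt by (intro tor_in_T) auto
    then show "C \<in> carrier B" by (rule T_carrier)
  qed
  have iC: "inv\<^bsub>B\<^esub> C \<in> carrier B" using C by simp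
  define \<gamma> where "\<gamma> = (\<lambda>x. inv\<^bsub>B\<^esub> C \<cdot> \<alpha> x \<cdot> C)"
  have g: "\<gamma> \<in> iso B B"
    using iso_set_trans[OF a' B.conj_iso[OF iC]] C by (simp add: \<gamma>_def o_def)
  obtain y where y: "y \<in> P" "\<And>t. t \<in> T \<Longrightarrow> y \<cdot> \<gamma> t \<cdot> inv\<^bsub>B\<^esub> y \<in> T" using torus_conj[OF g] by blast
  have yc: "y \<in> carrier B" using y P_carrier by blast
  define \<beta> where "\<beta> = (\<lambda>x. y \<cdot> \<gamma> x \<cdot> inv\<^bsub>B\<^esub> y)"
  have b: "\<beta> \<in> iso B B"
    using iso_set_trans[OF g B.conj_iso[OF yc]] by (simp add: \<beta>_def o_def)
  have bT: "\<And>t. t \<in> T \<Longrightarrow> \<beta> t \<in> T" using y by (simp add: \<beta>_def)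
  have bg: "\<beta> (gen 1 s) = gen 1 s" if s: "s \<in> S" for s
  proof -
    have gP: "gen 1 s \<in> P" "gen 1 s \<in> carrier B" using gen_P[OF s] P_carrier by auto
    have gg: "\<gamma> (gen 1 s) \<in> P" using iso_P[OF g gP(2)] gP by blast
    have ac: "\<alpha> (gen 1 s) \<in> carrier B" using iso_closed[OF a' gP(2)] .
    obtain s' c where s': "s' \<in> S" "c \<in> {0<..<q}" "\<beta> (gen 1 s) = gen c s'"
      using iso_gen[OF b bT s] by blast
    \<comment> \<open>The vertex entry at s sees the normalisation by \<open>C\<close> but not the
      conjugation by y, so it pins down both \<open>s'\<close> and c.\<close>
    have "C \<cdot> \<gamma> (gen 1 s) = \<alpha> (gen 1 s) \<cdot> C"
      using C iC ac by (simp add: \<gamma>_def B.m_assoc B.inv_cancel_left)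
    from arg_cong[OF this, of "\<lambda>x. vert x s"]
    have "(coef \<alpha> s * vert (\<gamma> (gen 1 s)) s) mod q = coef \<alpha> s mod q"
      using act(3)[OF a' s, of s] triv[OF s] s by (simp add: C_def)
    moreover have "vert (\<gamma> (gen 1 s)) s = vert (\<beta> (gen 1 s)) s"
      unfolding \<beta>_def by (rule vert_conj_P[OF y(1) gg, symmetric])
    ultimately have "(coef \<alpha> s * (if s = s' then c else 0)) mod q = coef \<alpha> s mod q"
      using s' by (auto split: if_splits)
    then have "q dvd coef \<alpha> s * ((if s = s' then c else 0) - 1)" by (simp add: mod_eq_dvd_iff algebra_simps)
    moreover have "\<not> q dvd coef \<alpha> s" using act(2)[OF a' s] by (auto dest: zdvd_imp_le)
    ultimately have dv: "q dvd (if s = s' then c else 0) - 1" using prime_q prime_dvd_mult_iff by blast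
    then have eq: "s = s'" using q_gt by (auto split: if_splits)
    then have "q dvd c - 1" using dv by simp
    then have "c mod q = 1 mod q" by (simp only: mod_eq_dvd_iff)
    then have "c = 1" using s'(2) by simp
    with eq s'(3) show ?thesis by simp
  qed
  \<comment> \<open>The map \<beta> is \<alpha> followed by conjugation with y C^-1. As it is the
    identity, \<alpha> is conjugation with the inverse C y^-1.\<close>
  define h where "h = C \<cdot> inv\<^bsub>B\<^esub> y"
  have h: "h \<in> carrier B" using C yc by (simp add: h_def)
  have "\<alpha> x = h \<cdot> x \<cdot> inv\<^bsub>B\<^esub> h" if x: "x \<in> carrier B" for x
  proof -
    have ac: "\<alpha> x \<in> carrier B" using iso_closed[OF a' x] .
    have "x = y \<cdot> (inv\<^bsub>B\<^esub> C \<cdot> \<alpha> x \<cdot> C) \<cdot> inv\<^bsub>B\<^esub> y"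
      using iso_trivial[OF b bT bg x] by (simp add: \<beta>_def \<gamma>_def)
    then have "h \<cdot> x \<cdot> inv\<^bsub>B\<^esub> h = h \<cdot> (y \<cdot> (inv\<^bsub>B\<^esub> C \<cdot> \<alpha> x \<cdot> C) \<cdot> inv\<^bsub>B\<^esub> y) \<cdot> inv\<^bsub>B\<^esub> h" by simp
    also have "\<dots> = \<alpha> x"
      using C yc ac by (simp add: h_def B.m_assoc B.inv_mult_group B.inv_cancel_left)
    finally show ?thesis by simp
  qed
  then have "\<alpha> = (\<lambda>x\<in>carrier B. h \<cdot> x \<cdot> inv\<^bsub>B\<^esub> h)"
    using a by (intro extensionalityI[of _ "carrier B"]) (auto simp: auto_def Bij_def)
  then show ?thesis using h unfolding inner_auts_def by blast
qed

text \<open>Commuting with the regular torus element kills the component in \<open>P\<close>. The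
  remaining torus element acts trivially on every generator, so all its entries are 1.\<close>

lemma center_B:
  assumes x: "x \<in> carrier B" and c: "\<And>y. y \<in> carrier B \<Longrightarrow> x \<cdot> y = y \<cdot> x"
  shows "x = \<one>\<^bsub>B\<^esub>"
proof -
  have z: "two_except {} \<in> carrier B" using two_except_T T_carrier by blast
  define v where "v = (\<lambda>_::'s. 1::int, vert x, edge x)"
  have v: "v \<in> P" "v \<in> carrier B" using decomp_P[OF x] P_carrier by (auto simp: v_def)
  have t: "tor (torus x) \<in> T" "tor (torus x) \<in> carrier B" using tor_T[OF x] T_carrier by auto
  have d: "x = v \<cdot> tor (torus x)" using decomp[OF x] by (simp add: v_def)
  have "v = x \<cdot> inv\<^bsub>B\<^esub> tor (torus x)" using d v t x by (metis B.inv_solve_right)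
  have tz: "tor (torus x) \<cdot> two_except {} = two_except {} \<cdot> tor (torus x)"
    using T_comm[OF t(1) two_except_T] .
  have "(v \<cdot> two_except {}) \<cdot> tor (torus x) = x \<cdot> two_except {}"
    using d v t z tz by (metis B.m_assoc)
  also have "\<dots> = (two_except {} \<cdot> v) \<cdot> tor (torus x)"
    using c[OF z] d v t z by (metis B.m_assoc)
  finally have "v \<cdot> two_except {} = two_except {} \<cdot> v" using v t z by simp
  then have "v = \<one>\<^bsub>B\<^esub>" using centralizer_two v by blast
  then have xt: "x = tor (torus x)" using d t by simp
  have "torus x s = 1" for s
  proof (cases "s \<in> S")
    case True
    then have "x \<cdot> gen 1 s = gen 1 s \<cdot> x" using c gen_P P_carrier by blast
    from arg_cong[OF this, of "\<lambda>x. vert x s"] show ?thesis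
      using arg_cong[OF xt, of "\<lambda>x. vert x s"] torusD(2)[OF x] by simp
  qed (use torusD[OF x] in auto)
  then show ?thesis using xt by (intro B_eqI) (metis tor_simps one_B)+
qed

end

section \<open>Complete groups\<close>

text \<open>Completeness in terms of elements. It avoids the quotient \<open>Out G\<close> and
  functions cut down to the carrier, so it passes along isomorphisms without friction.\<close>

definition no_center_no_outer :: "('g, 'm) monoid_scheme \<Rightarrow> bool" where
  "no_center_no_outer G \<longleftrightarrow>
    (\<forall>z\<in>carrier G. (\<forall>g\<in>carrier G. z \<otimes>\<^bsub>G\<^esub> g = g \<otimes>\<^bsub>G\<^esub> z) \<longrightarrow> z = \<one>\<^bsub>G\<^esub>) \<and>
    (\<forall>\<alpha>\<in>iso G G. \<exists>g\<in>carrier G. \<forall>x\<in>carrier G. \<alpha> x = g \<otimes>\<^bsub>G\<^esub> x \<otimes>\<^bsub>G\<^esub> inv\<^bsub>G\<^esub> g)"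

declare AutoGroup_simps [simp]

lemma (in group) restrict_iso_auto: "\<alpha> \<in> iso G G \<Longrightarrow> restrict \<alpha> (carrier G) \<in> auto G"
  by (auto simp: auto_def Bij_def iso_def hom_def)

lemma (in group) inner_auts_subset: "inner_auts G \<subseteq> auto G"
  using conj_iso restrict_iso_auto unfolding inner_auts_def by blast

lemma (in group) id_inner: "(\<lambda>x\<in>carrier G. x) \<in> inner_auts G"
  unfolding inner_auts_def by (rule image_eqI[of _ _ \<one>]) auto

text \<open>Triviality of \<open>Out G\<close> says that every coset is \<open>inner_auts G\<close>
  itself. As the identity is inner, an automorphism lies in its own coset and is therefore
  inner.\<close>

lemma (in group) complete_group_iff: "complete_group G \<longleftrightarrow> no_center_no_outer G"
proof
  assume c: "complete_group G"
  interpret A: group "AutoGroup G" by (rule AutoGroup)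
  have "center G = {\<one>}" using c by (auto simp: complete_group_def trivial_group_def)
  moreover have "\<exists>g\<in>carrier G. \<forall>x\<in>carrier G. \<alpha> x = g \<otimes> x \<otimes> inv g" if a: "\<alpha> \<in> iso G G" for \<alpha>
  proof -
    let ?a = "restrict \<alpha> (carrier G)"
    have a': "?a \<in> auto G" using restrict_iso_auto[OF a] .
    have "carrier (Out G) = {inner_auts G}"
      using c by (simp add: complete_group_def trivial_group_def Out_def FactGroup_def)
    then have "inner_auts G #>\<^bsub>AutoGroup G\<^esub> ?a = inner_auts G"
      using a' by (auto simp: Out_def FactGroup_def RCOSETS_def)
    moreover have "?a \<in> inner_auts G #>\<^bsub>AutoGroup G\<^esub> ?a"
      using id_inner a' A.l_one[of ?a] by (force simp: r_coset_def simp del: AutoGroup_simps(2))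
    ultimately obtain g where g: "g \<in> carrier G" "?a = (\<lambda>x\<in>carrier G. g \<otimes> x \<otimes> inv g)"
      by (auto simp: inner_auts_def)
    have "\<alpha> x = g \<otimes> x \<otimes> inv g" if "x \<in> carrier G" for x
      using fun_cong[OF g(2), of x] that by simp
    with g(1) show ?thesis by blast
  qed
  ultimately show "no_center_no_outer G"
    unfolding no_center_no_outer_def center_def by blast
next
  assume c: "no_center_no_outer G"
  interpret A: group "AutoGroup G" by (rule AutoGroup)
  have "center G = {\<one>}" using c by (auto simp: no_center_no_outer_def center_def)
  moreover have "trivial_group (G\<lparr>carrier := {\<one>}\<rparr>)"
    using subgroup.subgroup_is_group[OF triv_subgroup is_group] by (simp add: trivial_group_def)
  moreover have "auto G \<subseteq> inner_auts G"
  proof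
    fix \<alpha> assume a: "\<alpha> \<in> auto G"
    then have "\<alpha> \<in> iso G G" by (simp add: auto_def Bij_def iso_def)
    then obtain g where g: "g \<in> carrier G" "\<And>x. x \<in> carrier G \<Longrightarrow> \<alpha> x = g \<otimes> x \<otimes> inv g"
      using c unfolding no_center_no_outer_def by blast
    then have "\<alpha> = (\<lambda>x\<in>carrier G. g \<otimes> x \<otimes> inv g)"
      using a by (intro extensionalityI[of _ "carrier G"]) (auto simp: auto_def Bij_def)
    with g(1) show "\<alpha> \<in> inner_auts G" unfolding inner_auts_def by blast
  qed
  then have inner: "inner_auts G = carrier (AutoGroup G)" using inner_auts_subset by auto
  have "carrier (AutoGroup G) \<lhd> AutoGroup G"
    by (intro A.normal_invI A.subgroup_self) (simp del: AutoGroup_simps)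
  then have "group (Out G)" unfolding Out_def inner by (rule normal.factorgroup_is_group)
  moreover have "carrier (Out G) \<subseteq> {\<one>\<^bsub>Out G\<^esub>}"
    unfolding Out_def inner FactGroup_def RCOSETS_def
    using A.coset_join2[OF _ A.subgroup_self] by (auto simp del: AutoGroup_simps)
  ultimately show "complete_group G"
    using group.trivial_group_subset[of "Out G"] by (simp add: complete_group_def)
qed

text \<open>Carries completeness from the automorphism group of \<open>B\<close>, whose elements are
  functions, to a copy on the natural numbers, and from a complete group to its copy inside a larger
  group.\<close>

lemma no_center_no_outer_iso:
  assumes G: "group G" and H: "group H" and \<theta>: "\<theta> \<in> iso G H" and c: "no_center_no_outer G"
  shows "no_center_no_outer H"
proof -
  interpret G: group G by fact
  interpret H: group H by fact
  have hom: "\<theta> \<in> hom G H" and bij: "bij_betw \<theta> (carrier G) (carrier H)" using \<theta> by (auto simp: iso_def)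
  interpret \<theta>: group_hom G H \<theta> using hom by (simp add: group_hom_def group_hom_axioms_def G H)
  have surj: "\<exists>x\<in>carrier G. y = \<theta> x" if "y \<in> carrier H" for y
    using bij that by (auto simp: bij_betw_def)
  have inj: "\<theta> x = \<theta> y \<longleftrightarrow> x = y" if "x \<in> carrier G" "y \<in> carrier G" for x y
    using bij that by (auto simp: bij_betw_def inj_on_def)
  show ?thesis
    unfolding no_center_no_outer_def
  proof (intro conjI ballI impI)
    fix z assume z: "z \<in> carrier H" and cz: "\<forall>g\<in>carrier H. z \<otimes>\<^bsub>H\<^esub> g = g \<otimes>\<^bsub>H\<^esub> z"
    obtain z' where z': "z' \<in> carrier G" "z = \<theta> z'" using surj[OF z] by blast
    have "z' \<otimes>\<^bsub>G\<^esub> g = g \<otimes>\<^bsub>G\<^esub> z'" if "g \<in> carrier G" for g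
      using cz z' that inj[of "z' \<otimes>\<^bsub>G\<^esub> g" "g \<otimes>\<^bsub>G\<^esub> z'"] by simp
    then show "z = \<one>\<^bsub>H\<^esub>" using c z' unfolding no_center_no_outer_def by auto
  next
    fix \<alpha> assume a: "\<alpha> \<in> iso H H"
    have inv: "inv_into (carrier G) \<theta> \<in> iso H G" using G.iso_set_sym[OF \<theta>] .
    have b: "inv_into (carrier G) \<theta> \<circ> (\<alpha> \<circ> \<theta>) \<in> iso G G"
      using iso_set_trans[OF iso_set_trans[OF \<theta> a] inv] by simp
    then obtain g where g: "g \<in> carrier G" "\<And>x. x \<in> carrier G \<Longrightarrow> inv_into (carrier G) \<theta> (\<alpha> (\<theta> x)) = g \<otimes>\<^bsub>G\<^esub> x \<otimes>\<^bsub>G\<^esub> inv\<^bsub>G\<^esub> g"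
      using bspec[OF conjunct2[OF c[unfolded no_center_no_outer_def]] b] by auto
    have "\<alpha> y = \<theta> g \<otimes>\<^bsub>H\<^esub> y \<otimes>\<^bsub>H\<^esub> inv\<^bsub>H\<^esub> \<theta> g" if y: "y \<in> carrier H" for y
    proof -
      obtain x where x: "x \<in> carrier G" "y = \<theta> x" using surj[OF y] by blast
      have "\<alpha> y \<in> carrier H" using a y by (auto simp: iso_def hom_def)
      then have "\<alpha> y \<in> \<theta> ` carrier G" using surj by blast
      then have "\<alpha> y = \<theta> (inv_into (carrier G) \<theta> (\<alpha> y))" by (simp add: f_inv_into_f)
      also have "\<dots> = \<theta> (g \<otimes>\<^bsub>G\<^esub> x \<otimes>\<^bsub>G\<^esub> inv\<^bsub>G\<^esub> g)" using g(2)[OF x(1)] x(2) by simp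
      finally show ?thesis using g(1) x by simp
    qed
    then show "\<exists>g\<in>carrier H. \<forall>x\<in>carrier H. \<alpha> x = g \<otimes>\<^bsub>H\<^esub> x \<otimes>\<^bsub>H\<^esub> inv\<^bsub>H\<^esub> g"
      by (intro bexI[of _ "\<theta> g"] ballI \<theta>.hom_closed g(1))
  qed
qed

lemma (in group) conj_hom: "(\<lambda>g. \<lambda>x\<in>carrier G. g \<otimes> x \<otimes> inv g) \<in> hom G (AutoGroup G)" (is "?i \<in> _")
proof (rule homI)
  have closed: "?i g \<in> auto G" if "g \<in> carrier G" for g
    using conj_iso[OF that] restrict_iso_auto by simp
  then show "?i g \<in> carrier (AutoGroup G)" if "g \<in> carrier G" for g using that by simp
  fix g h assume gh: "g \<in> carrier G" "h \<in> carrier G"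
  have "?i (g \<otimes> h) = compose (carrier G) (?i g) (?i h)"
    unfolding compose_def using gh by (intro restrict_ext) (simp add: m_assoc inv_mult_group)
  then show "?i (g \<otimes> h) = ?i g \<otimes>\<^bsub>AutoGroup G\<^esub> ?i h"
    using AutoGroup_simps(2)[OF closed[OF gh(1)] closed[OF gh(2)]] by simp
qed

text \<open>Burnside's argument. The equation x^m = 1 singles out the inner automorphisms, so an
  automorphism \<Phi> of the automorphism group permutes them and, the centre being trivial, comes
  from an automorphism f of \<open>G\<close>. Because x (inn g) x^-1 = inn (x g), the image \<Phi> x
  is then forced to be f x f^-1.\<close>

lemma (in group) AutoGroup_complete:
  assumes fin: "finite (carrier G)"
    and center: "\<And>z. z \<in> carrier G \<Longrightarrow> (\<And>g. g \<in> carrier G \<Longrightarrow> z \<otimes> g = g \<otimes> z) \<Longrightarrow> z = \<one>"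
    and inner: "inner_auts G = {\<alpha> \<in> auto G. \<alpha> [^]\<^bsub>AutoGroup G\<^esub> (m::nat) = \<one>\<^bsub>AutoGroup G\<^esub>}"
  shows "no_center_no_outer (AutoGroup G)"
proof -
  interpret A: group "AutoGroup G" by (rule AutoGroup)
  define inn where "inn = (\<lambda>g. \<lambda>x\<in>carrier G. g \<otimes> x \<otimes> inv g)"
  have inn: "inn g \<in> auto G" if "g \<in> carrier G" for g
    using conj_iso[OF that] restrict_iso_auto by (simp add: inn_def)
  have inn_auts: "inner_auts G = inn ` carrier G" by (simp add: inner_auts_def inn_def)
  have inn_inj: "g = h" if gh: "g \<in> carrier G" "h \<in> carrier G" and eq: "inn g = inn h" for g h
  proof -
    have "(inv h \<otimes> g) \<otimes> x = x \<otimes> (inv h \<otimes> g)" if x: "x \<in> carrier G" for x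
    proof -
      have "g \<otimes> x \<otimes> inv g = h \<otimes> x \<otimes> inv h" using fun_cong[OF eq, of x] x by (simp add: inn_def)
      then have "inv h \<otimes> (g \<otimes> x \<otimes> inv g) \<otimes> g = inv h \<otimes> (h \<otimes> x \<otimes> inv h) \<otimes> g" by simp
      then show ?thesis using gh x by (simp add: m_assoc inv_cancel_left)
    qed
    then have "inv h \<otimes> g = \<one>" using center[of "inv h \<otimes> g"] gh by simp
    then show ?thesis using gh by (metis inv_equality inv_inv inv_closed)
  qed
  have auto_closed: "x g \<in> carrier G" if "x \<in> auto G" "g \<in> carrier G" for x g
    using that by (auto simp: auto_def hom_def)
  have inn_mult: "inn g \<otimes>\<^bsub>AutoGroup G\<^esub> inn h = inn (g \<otimes> h)" if "g \<in> carrier G" "h \<in> carrier G" for g h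
    using hom_mult[OF conj_hom that] by (simp only: inn_def)
  have inn_conj: "x \<otimes>\<^bsub>AutoGroup G\<^esub> inn g = inn (x g) \<otimes>\<^bsub>AutoGroup G\<^esub> x" if x: "x \<in> auto G" and g: "g \<in> carrier G" for x g
  proof -
    interpret x: group_hom G G x using x by (simp add: auto_def group_hom_def group_hom_axioms_def is_group)
    have "compose (carrier G) x (inn g) = compose (carrier G) (inn (x g)) x"
      unfolding compose_def using g by (intro restrict_ext) (simp add: inn_def)
    then show ?thesis using AutoGroup_simps(2)[OF x inn[OF g]] AutoGroup_simps(2)[OF inn[OF auto_closed[OF x g]] x] by simp
  qed
  show ?thesis
    unfolding no_center_no_outer_def
  proof (intro conjI ballI impI)
    fix z assume z: "z \<in> carrier (AutoGroup G)" and cz: "\<forall>g\<in>carrier (AutoGroup G). z \<otimes>\<^bsub>AutoGroup G\<^esub> g = g \<otimes>\<^bsub>AutoGroup G\<^esub> z"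
    have za: "z \<in> auto G" using z by simp
    have "z g = g" if g: "g \<in> carrier G" for g
    proof -
      \<comment> \<open>Both sides equal z composed with \<open>inn g\<close>: the left by
        \<open>inn_conj\<close>, the right by centrality of z.\<close>
      have "inn (z g) \<otimes>\<^bsub>AutoGroup G\<^esub> z = inn g \<otimes>\<^bsub>AutoGroup G\<^esub> z"
        using inn_conj[OF za g] bspec[OF cz, of "inn g"] inn[OF g] unfolding AutoGroup_simps(1) by metis
      then have "inn (z g) = inn g"
        using A.right_cancel[of z "inn (z g)" "inn g"] za inn[OF g] inn[OF auto_closed[OF za g]] unfolding AutoGroup_simps(1) by metis
      then show ?thesis using inn_inj g auto_closed[OF za g] by blast
    qed
    then show "z = \<one>\<^bsub>AutoGroup G\<^esub>"
      using za by (auto simp: auto_def Bij_def intro!: extensionalityI[of _ "carrier G"])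
  next
    fix \<Phi> assume P: "\<Phi> \<in> iso (AutoGroup G) (AutoGroup G)"
    interpret P: group_hom "AutoGroup G" "AutoGroup G" \<Phi>
      using P by (simp add: iso_def group_hom_def group_hom_axioms_def A.is_group)
    have Pinj: "\<Phi> x = \<Phi> y \<Longrightarrow> x = y" if "x \<in> auto G" "y \<in> auto G" for x y
      using P that by (auto simp: iso_def bij_betw_def inj_on_def)
    have "\<exists>h\<in>carrier G. \<Phi> (inn g) = inn h" if g: "g \<in> carrier G" for g
    proof -
      have "inn g [^]\<^bsub>AutoGroup G\<^esub> m = \<one>\<^bsub>AutoGroup G\<^esub>" using inner inn_auts g by blast
      then have "\<Phi> (inn g) [^]\<^bsub>AutoGroup G\<^esub> m = \<one>\<^bsub>AutoGroup G\<^esub>"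
        using P.hom_nat_pow[of "inn g" m] inn[OF g] P.hom_one by (simp del: AutoGroup_simps(3))
      moreover have "\<Phi> (inn g) \<in> auto G" using P.hom_closed[of "inn g"] inn[OF g] by simp
      ultimately show ?thesis using inner inn_auts by blast
    qed
    then obtain f where f: "\<And>g. g \<in> carrier G \<Longrightarrow> f g \<in> carrier G \<and> \<Phi> (inn g) = inn (f g)" by metis
    have fhom: "f (g \<otimes> h) = f g \<otimes> f h" if "g \<in> carrier G" "h \<in> carrier G" for g h
    proof (rule inn_inj)
      have "inn (f (g \<otimes> h)) = \<Phi> (inn g \<otimes>\<^bsub>AutoGroup G\<^esub> inn h)" using f that inn_mult by simp
      also have "\<dots> = inn (f g) \<otimes>\<^bsub>AutoGroup G\<^esub> inn (f h)" using P.hom_mult[of "inn g" "inn h"] that inn f by simp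
      finally show "inn (f (g \<otimes> h)) = inn (f g \<otimes> f h)" using f that inn_mult by simp
    qed (use f that in auto)
    have finj: "inj_on f (carrier G)"
      using f Pinj inn inn_inj by (intro inj_onI) metis
    have "f ` carrier G = carrier G" using endo_inj_surj[OF fin _ finj] f by blast
    then have fiso: "f \<in> iso G G" using fhom f finj by (auto simp: iso_def hom_def bij_betw_def)
    define a where "a = restrict f (carrier G)"
    have a: "a \<in> auto G" using restrict_iso_auto[OF fiso] by (simp add: a_def)
    have "\<Phi> x = a \<otimes>\<^bsub>AutoGroup G\<^esub> x \<otimes>\<^bsub>AutoGroup G\<^esub> inv\<^bsub>AutoGroup G\<^esub> a" if x: "x \<in> carrier (AutoGroup G)" for x
    proof -
      have xa: "x \<in> auto G" "\<Phi> x \<in> auto G" using x P.hom_closed[OF x] by simp_all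
      \<comment> \<open>Apply \<Phi> to the relation \<open>inn_conj\<close> between x and
        \<open>inn g\<close>, then cancel \<Phi> x on the right.\<close>
      have "\<Phi> x (f g) = f (x g)" if g: "g \<in> carrier G" for g
      proof (rule inn_inj)
        have "inn (\<Phi> x (f g)) \<otimes>\<^bsub>AutoGroup G\<^esub> \<Phi> x = \<Phi> x \<otimes>\<^bsub>AutoGroup G\<^esub> \<Phi> (inn g)"
          using inn_conj[OF xa(2), of "f g"] f[OF g] by simp
        also have "\<dots> = \<Phi> (x \<otimes>\<^bsub>AutoGroup G\<^esub> inn g)" using P.hom_mult[OF x, of "inn g"] inn[OF g] by (simp del: AutoGroup_simps(2))
        also have "\<dots> = \<Phi> (inn (x g) \<otimes>\<^bsub>AutoGroup G\<^esub> x)" using inn_conj[OF xa(1) g] by simp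
        also have "\<dots> = inn (f (x g)) \<otimes>\<^bsub>AutoGroup G\<^esub> \<Phi> x"
          using P.hom_mult[OF _ x, of "inn (x g)"] inn f auto_closed[OF xa(1) g] by (simp del: AutoGroup_simps(2))
        finally show "inn (\<Phi> x (f g)) = inn (f (x g))"
          using A.r_cancel[of "\<Phi> x" "inn (\<Phi> x (f g))" "inn (f (x g))"] xa inn f g auto_closed by (simp del: AutoGroup_simps(2))
      qed (use f g auto_closed xa in auto)
      then have "compose (carrier G) (\<Phi> x) a = compose (carrier G) a x"
        using auto_closed[OF xa(1)] by (auto simp: compose_def a_def intro!: restrict_ext)
      then have "\<Phi> x \<otimes>\<^bsub>AutoGroup G\<^esub> a = a \<otimes>\<^bsub>AutoGroup G\<^esub> x" using xa a by simp
      then show ?thesis using xa a A.inv_solve_right[of "\<Phi> x" "a \<otimes>\<^bsub>AutoGroup G\<^esub> x" a] A.m_closed[of a x] x by (simp del: AutoGroup_simps(2))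
    qed
    moreover have "a \<in> carrier (AutoGroup G)" using a by simp
    ultimately show "\<exists>a\<in>carrier (AutoGroup G). \<forall>x\<in>carrier (AutoGroup G). \<Phi> x = a \<otimes>\<^bsub>AutoGroup G\<^esub> x \<otimes>\<^bsub>AutoGroup G\<^esub> inv\<^bsub>AutoGroup G\<^esub> a"
      by blast
  qed
qed

context graph_group begin

text \<open>The exponent is \<open>p * r\<close>. Conjugation is a homomorphism, so inner
  automorphisms inherit it from \<open>pow_pr\<close>; the converse is
  \<open>inner_if_pow\<close>.\<close>

lemma complete_Aut_B: "no_center_no_outer (AutoGroup B)"
proof (rule B.AutoGroup_complete[OF finite_B center_B])
  interpret A: group "AutoGroup B" by (rule B.AutoGroup)
  let ?i = "\<lambda>g. \<lambda>x\<in>carrier B. g \<cdot> x \<cdot> inv\<^bsub>B\<^esub> g"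
  show "inner_auts B = {\<alpha> \<in> auto B. \<alpha> [^]\<^bsub>AutoGroup B\<^esub> (p * r) = \<one>\<^bsub>AutoGroup B\<^esub>}"
  proof (intro equalityI subsetI)
    fix \<alpha> assume a: "\<alpha> \<in> inner_auts B"
    then obtain g where g: "g \<in> carrier B" "\<alpha> = ?i g" by (auto simp: inner_auts_def)
    interpret i: group_hom B "AutoGroup B" ?i
      using B.conj_hom by (simp add: group_hom_def group_hom_axioms_def A.is_group)
    have "\<alpha> [^]\<^bsub>AutoGroup B\<^esub> (p * r) = \<one>\<^bsub>AutoGroup B\<^esub>"
      unfolding g(2) using i.hom_nat_pow[OF g(1), of "p * r", symmetric] pow_pr[OF g(1)] i.hom_one by (simp only:)
    with a show "\<alpha> \<in> {\<alpha> \<in> auto B. \<alpha> [^]\<^bsub>AutoGroup B\<^esub> (p * r) = \<one>\<^bsub>AutoGroup B\<^esub>}"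
      using B.inner_auts_subset by blast
  qed (use inner_if_pow in blast)
qed

end

section \<open>A graph with prescribed symmetries\<close>

text \<open>
  The vertex \<open>Row g a\<close> has degree \<open>a + 1\<close>, so graph automorphisms preserve \<open>a\<close>. It is adjacent to
  \<open>Pt g\<close> and to the \<open>Val x\<close> with \<open>\<nu> (g\<^sup>-\<^sup>1 x) < a\<close>. So the rows at \<open>g\<close> together record the
  bijection \<open>x \<mapsto> \<nu> (g\<^sup>-\<^sup>1 x)\<close>, which leaves only the left translations.
\<close>

datatype 'g frucht_vertex = Row 'g nat | Pt 'g | Val 'g

text \<open>The numbering \<nu> turns the group-valued label g^-1 x of a pair into a number that
  thresholds can express. With at least two elements, all \<open>Pt\<close> and \<open>Val\<close>
  vertices have degree at least 2, which leaves the rows at level 0 as the only vertices of degree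
  1.\<close>

locale frucht = group G for G :: "('g, 'm) monoid_scheme" (structure) +
  fixes \<nu> :: "'g \<Rightarrow> nat" and n :: nat
  assumes nu: "bij_betw \<nu> (carrier G) {0..<n}" and n2: "n \<ge> 2"
begin

text \<open>The levels run from 0 to n inclusive: a row at level 0 hangs on its \<open>Pt\<close>
  alone, and the thresholds 1 to n separate the values 0 to n - 1 of \<nu>.\<close>

definition S where "S = (\<lambda>(g, a). Row g a) ` (carrier G \<times> {..n}) \<union> Pt ` carrier G \<union> Val ` carrier G"

fun E0 where
  "E0 (Row g a) (Pt h) \<longleftrightarrow> g = h \<and> a \<le> n \<and> g \<in> carrier G"
| "E0 (Row g a) (Val x) \<longleftrightarrow> \<nu> (inv g \<otimes> x) < a \<and> a \<le> n \<and> g \<in> carrier G \<and> x \<in> carrier G"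
| "E0 _ _ \<longleftrightarrow> False"

definition E where "E s s' \<longleftrightarrow> E0 s s' \<or> E0 s' s"

lemma E_simps [simp]:
  "E (Row g a) (Pt h) \<longleftrightarrow> g = h \<and> a \<le> n \<and> g \<in> carrier G"
  "E (Pt h) (Row g a) \<longleftrightarrow> g = h \<and> a \<le> n \<and> g \<in> carrier G"
  "E (Row g a) (Val x) \<longleftrightarrow> \<nu> (inv g \<otimes> x) < a \<and> a \<le> n \<and> g \<in> carrier G \<and> x \<in> carrier G"
  "E (Val x) (Row g a) \<longleftrightarrow> \<nu> (inv g \<otimes> x) < a \<and> a \<le> n \<and> g \<in> carrier G \<and> x \<in> carrier G"
  "\<not> E (Row g a) (Row h b)" "\<not> E (Pt g) (Pt h)" "\<not> E (Val g) (Val h)" "\<not> E (Pt g) (Val h)" "\<not> E (Val h) (Pt g)"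
  by (auto simp: E_def)

lemma S_simps [simp]: "Row g a \<in> S \<longleftrightarrow> g \<in> carrier G \<and> a \<le> n" "Pt g \<in> S \<longleftrightarrow> g \<in> carrier G" "Val g \<in> S \<longleftrightarrow> g \<in> carrier G"
  by (auto simp: S_def)

lemma fin_G: "finite (carrier G)" using nu bij_betw_finite by blast

lemma nu_lt: "g \<in> carrier G \<Longrightarrow> \<nu> g < n" using nu by (auto simp: bij_betw_def)

lemma nu_eq: "g \<in> carrier G \<Longrightarrow> h \<in> carrier G \<Longrightarrow> \<nu> g = \<nu> h \<longleftrightarrow> g = h"
  using nu by (auto simp: bij_betw_def inj_on_def)

lemma finite_S: "finite S" using fin_G by (simp add: S_def)

lemma E_sym: "E s s' \<Longrightarrow> E s' s" by (auto simp: E_def)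

lemma E_in: "E s s' \<Longrightarrow> s \<in> S"
  by (cases s; cases s') auto

lemma E_in2: "E s s' \<Longrightarrow> s' \<in> S" using E_sym E_in by blast

lemma no_isolated: "s \<in> S \<Longrightarrow> \<exists>s'. E s s'"
proof (cases s)
  case (Row g a)
  moreover assume "s \<in> S"
  ultimately show ?thesis by (intro exI[of _ "Pt g"]) simp
next
  case (Pt g)
  moreover assume "s \<in> S"
  ultimately show ?thesis by (intro exI[of _ "Row g 0"]) simp
next
  case (Val x)
  moreover assume "s \<in> S"
  ultimately show ?thesis using nu_lt[of "inv x \<otimes> x"] by (intro exI[of _ "Row x n"]) simp
qed

definition nbr where "nbr s = {s'. E s s'}"

text \<open>Translation by g^-1 and \<nu> are bijective, so the threshold a admits exactly a of the
  \<open>Val\<close> vertices; the \<open>Pt\<close> adds one.\<close>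

lemma card_nbr_Row:
  assumes "g \<in> carrier G" "a \<le> n" shows "card (nbr (Row g a)) = Suc a"
proof -
  let ?V = "{x \<in> carrier G. \<nu> (inv g \<otimes> x) < a}"
  have "nbr (Row g a) = insert (Pt g) (Val ` ?V)"
  proof (intro equalityI subsetI)
    fix s assume "s \<in> nbr (Row g a)"
    then show "s \<in> insert (Pt g) (Val ` ?V)" by (cases s) (auto simp: nbr_def)
  qed (use assms in \<open>auto simp: nbr_def\<close>)
  moreover have "card (Val ` ?V) = a"
  proof -
    have "bij_betw (\<lambda>x. \<nu> (inv g \<otimes> x)) ?V {..<a}"
    proof (rule bij_betwI')
      fix x y assume "x \<in> ?V" "y \<in> ?V"
      then show "\<nu> (inv g \<otimes> x) = \<nu> (inv g \<otimes> y) \<longleftrightarrow> x = y"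
        using assms by (simp add: nu_eq)
    next
      fix i assume i: "i \<in> {..<a}"
      then have "i \<in> \<nu> ` carrier G" using nu assms by (auto simp: bij_betw_def)
      then obtain y where "y \<in> carrier G" "\<nu> y = i" by blast
      then show "\<exists>x\<in>?V. i = \<nu> (inv g \<otimes> x)"
        using i assms by (intro bexI[of _ "g \<otimes> y"]) (auto simp: inv_cancel_left)
    qed auto
    then have "card ?V = a" using bij_betw_same_card by fastforce
    then show ?thesis by (subst card_image) (auto simp: inj_on_def)
  qed
  moreover have "Pt g \<notin> Val ` ?V" by auto
  moreover have "finite (Val ` ?V)" using fin_G by simp
  ultimately show ?thesis by simp
qed

lemma finite_nbr: "finite (nbr s)"
  by (rule finite_subset[OF _ finite_S]) (use E_in E_sym in \<open>auto simp: nbr_def\<close>)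

text \<open>The levels 0 and 1 suffice for \<open>Pt x\<close>, and \<open>Val x\<close> is adjacent
  to all n rows of top level.\<close>

lemma card_nbr_ge2:
  assumes "x \<in> carrier G" shows "card (nbr (Pt x)) \<ge> 2" "card (nbr (Val x)) \<ge> 2"
proof -
  have "{Row x 0, Row x 1} \<subseteq> nbr (Pt x)" using assms n2 by (auto simp: nbr_def)
  then have "card {Row x 0, Row x 1} \<le> card (nbr (Pt x))" by (rule card_mono[OF finite_nbr])
  then show "card (nbr (Pt x)) \<ge> 2" by simp
  have "card (carrier G) = n" using bij_betw_same_card[OF nu] by simp
  moreover have "card ((\<lambda>g. Row g n) ` carrier G) = card (carrier G)" by (rule card_image) (simp add: inj_on_def)
  moreover have "card ((\<lambda>g. Row g n) ` carrier G) \<le> card (nbr (Val x))"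
    by (rule card_mono[OF finite_nbr]) (use assms nu_lt in \<open>auto simp: nbr_def\<close>)
  ultimately show "card (nbr (Val x)) \<ge> 2" using n2 by linarith
qed

abbreviation "graph_auts \<equiv> {\<pi> \<in> Bij S. \<forall>s\<in>S. \<forall>s'\<in>S. E (\<pi> s) (\<pi> s') \<longleftrightarrow> E s s'}"

text \<open>Degrees and incidences reconstruct the labels. Rows at level 0 are the vertices of
  degree 1, their neighbours are the \<open>Pt\<close> vertices, and every other row is recognised
  by its \<open>Pt\<close> and its degree. The thresholds then compare values of \<nu>, which is
  injective.\<close>

lemma graph_aut_Pt:
  assumes p: "\<pi> \<in> graph_auts"
  shows "\<exists>h\<in>carrier G. \<forall>g\<in>carrier G. \<pi> (Pt g) = Pt (h \<otimes> g)"
proof -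
  have bij: "bij_betw \<pi> S S" and E: "\<And>s s'. s \<in> S \<Longrightarrow> s' \<in> S \<Longrightarrow> E (\<pi> s) (\<pi> s') \<longleftrightarrow> E s s'"
    using p by (auto simp: Bij_def)
  have \<pi>S: "\<pi> s \<in> S" if "s \<in> S" for s using bij that by (auto simp: bij_betw_def)
  have inj: "\<pi> s = \<pi> s' \<longleftrightarrow> s = s'" if "s \<in> S" "s' \<in> S" for s s' using bij that by (auto simp: bij_betw_def inj_on_def)
  have card_nbr: "card (nbr (\<pi> s)) = card (nbr s)" if s: "s \<in> S" for s
  proof -
    have "nbr (\<pi> s) = \<pi> ` nbr s"
    proof (intro equalityI subsetI)
      fix s' assume s': "s' \<in> nbr (\<pi> s)"
      then have "s' \<in> \<pi> ` S" using E_in E_sym bij by (auto simp: nbr_def bij_betw_def)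
      then obtain t where "t \<in> S" "s' = \<pi> t" by blast
      then show "s' \<in> \<pi> ` nbr s" using s' E[OF s] by (auto simp: nbr_def)
    next
      fix s' assume "s' \<in> \<pi> ` nbr s"
      then show "s' \<in> nbr (\<pi> s)" using E[OF s] E_in2 by (auto simp: nbr_def)
    qed
    moreover have "inj_on \<pi> (nbr s)"
    proof (rule inj_on_subset[OF bij_betw_imp_inj_on[OF bij]])
      show "nbr s \<subseteq> S" unfolding nbr_def using E_in2 by blast
    qed
    ultimately show ?thesis by (simp add: card_image)
  qed
  have "\<exists>g'\<in>carrier G. \<pi> (Row g 0) = Row g' 0" if g: "g \<in> carrier G" for g
  proof -
    have S: "\<pi> (Row g 0) \<in> S" and c: "card (nbr (\<pi> (Row g 0))) = 1"
      using \<pi>S card_nbr[of "Row g 0"] card_nbr_Row[OF g, of 0] g by simp_all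
    show ?thesis
    proof (cases "\<pi> (Row g 0)")
      case (Row g' b)
      then have "g' \<in> carrier G" "b \<le> n" using S by simp_all
      then show ?thesis using c card_nbr_Row[of g' b] Row by simp
    next
      case (Pt g')
      then show ?thesis using S c card_nbr_ge2(1)[of g'] by simp
    next
      case (Val g')
      then show ?thesis using S c card_nbr_ge2(2)[of g'] by simp
    qed
  qed
  then obtain \<sigma> where \<sigma>: "\<And>g. g \<in> carrier G \<Longrightarrow> \<sigma> g \<in> carrier G \<and> \<pi> (Row g 0) = Row (\<sigma> g) 0" by metis
  have Pt: "\<pi> (Pt g) = Pt (\<sigma> g)" if g: "g \<in> carrier G" for g
    using E[of "Row g 0" "Pt g"] \<sigma>[OF g] g by (cases "\<pi> (Pt g)") auto
  have Row: "\<pi> (Row g a) = Row (\<sigma> g) a" if g: "g \<in> carrier G" and a: "a \<le> n" for g a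
  proof -
    have e: "E (\<pi> (Row g a)) (Pt (\<sigma> g))" using E[of "Row g a" "Pt g"] g a Pt[OF g] by simp
    then obtain b where b: "\<pi> (Row g a) = Row (\<sigma> g) b" "b \<le> n" by (cases "\<pi> (Row g a)") auto
    then show ?thesis using card_nbr[of "Row g a"] card_nbr_Row[OF g a] card_nbr_Row[of "\<sigma> g" b] \<sigma>[OF g] g a by simp
  qed
  have "\<exists>y\<in>carrier G. \<pi> (Val x) = Val y" if x: "x \<in> carrier G" for x
  proof -
    have "E (Row x n) (Val x)" using x nu_lt[of "inv x \<otimes> x"] by simp
    then have "E (Row (\<sigma> x) n) (\<pi> (Val x))" using E[of "Row x n" "Val x"] Row[OF x] x by simp
    \<comment> \<open>A row has one neighbour that is not a \<open>Val\<close>, and it is already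
      the image of \<open>Pt x\<close>.\<close>
    moreover have "\<pi> (Val x) \<noteq> Pt (\<sigma> x)" using inj[of "Val x" "Pt x"] Pt[OF x] x by simp
    ultimately show ?thesis by (cases "\<pi> (Val x)") auto
  qed
  then obtain \<tau> where \<tau>: "\<And>x. x \<in> carrier G \<Longrightarrow> \<tau> x \<in> carrier G \<and> \<pi> (Val x) = Val (\<tau> x)" by metis
  have lt: "\<nu> (inv (\<sigma> g) \<otimes> \<tau> x) < a \<longleftrightarrow> \<nu> (inv g \<otimes> x) < a" if "g \<in> carrier G" "x \<in> carrier G" "a \<le> n" for g x a
    using E[of "Row g a" "Val x"] Row[of g a] \<tau>[of x] \<sigma>[of g] that by simp
  have "\<sigma> g = \<tau> \<one> \<otimes> g" if g: "g \<in> carrier G" for g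
  proof -
    let ?u = "inv (\<sigma> g) \<otimes> \<tau> \<one>"
    have c: "\<sigma> g \<in> carrier G" "\<tau> \<one> \<in> carrier G" "?u \<in> carrier G" using \<sigma>[OF g] \<tau>[OF one_closed] by auto
    \<comment> \<open>Two thresholds, each just above one of the two values, give both inequalities;
      \<open>nu_lt\<close> keeps these thresholds within the levels up to n.\<close>
    have "\<nu> ?u < Suc (\<nu> (inv g \<otimes> \<one>))" "\<nu> (inv g \<otimes> \<one>) < Suc (\<nu> ?u)"
      using lt[OF g one_closed, of "Suc (\<nu> (inv g \<otimes> \<one>))"] lt[OF g one_closed, of "Suc (\<nu> ?u)"] nu_lt[of "inv g \<otimes> \<one>"] nu_lt[OF c(3)] g
      by auto
    then have "\<nu> ?u = \<nu> (inv g)" using g by simp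
    then have "?u = inv g" using nu_eq[OF c(3)] g by simp
    then have "\<sigma> g \<otimes> ?u \<otimes> g = \<sigma> g \<otimes> inv g \<otimes> g" by simp
    then show ?thesis using c g by (simp add: m_assoc inv_cancel_left)
  qed
  then show ?thesis using Pt \<tau>[OF one_closed] by (intro bexI[of _ "\<tau> \<one>"]) auto
qed

definition translate where
  "translate h = (\<lambda>s\<in>S. case s of Row g a \<Rightarrow> Row (h \<otimes> g) a | Pt g \<Rightarrow> Pt (h \<otimes> g) | Val g \<Rightarrow> Val (h \<otimes> g))"

text \<open>Adjacency depends on g and x only through g^-1 x, which left translation
  preserves.\<close>

lemma translate_graph_aut:
  assumes h: "h \<in> carrier G" shows "translate h \<in> graph_auts"
proof -
  have in_S: "translate k s \<in> S" if "s \<in> S" "k \<in> carrier G" for s k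
    using that by (cases s) (auto simp: translate_def)
  have inv: "translate (inv k) (translate k s) = s" if "s \<in> S" "k \<in> carrier G" for s k
    using that in_S[OF that] by (cases s) (auto simp: translate_def inv_cancel_left)
  have inv': "translate k (translate (inv k) s) = s" if "s \<in> S" "k \<in> carrier G" for s k
    using inv[of s "inv k"] that by simp
  have "bij_betw (translate h) S S"
    by (rule bij_betw_byWitness[where f' = "translate (inv h)"]) (use in_S inv inv' h in auto)
  moreover have "E (translate h s) (translate h s') \<longleftrightarrow> E s s'" if "s \<in> S" "s' \<in> S" for s s'
    using that h by (cases s; cases s') (auto simp: translate_def inv_mult_group m_assoc inv_cancel_left)
  ultimately show ?thesis by (simp add: Bij_def) (simp add: translate_def)
qed

end

text \<open>Any prime divisor \<open>p\<close> of \<open>2\<^sup>r - 1\<close> works: the order of 2 modulo \<open>p\<close> is \<open>r\<close>, so \<open>r\<close> divides \<open>p - 1\<close>.\<close>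

lemma ex_prime_pair:
  "\<exists>p r. Factorial_Ring.prime p \<and> Factorial_Ring.prime r \<and> r > (N::nat) \<and> r > 3 \<and> p > r \<and> (2::int) ^ r mod int p = 1"
proof -
  obtain r :: nat where r: "Factorial_Ring.prime r" "r > max N 3" using bigger_prime by blast
  have "(2::nat) ^ r - 1 \<noteq> 1" using r power_strict_increasing[of 1 r "2::nat"] by auto
  then obtain p :: nat where p: "Factorial_Ring.prime p" "p dvd 2 ^ r - 1" using prime_factor_nat by blast
  have c: "[2 ^ r = 1] (mod p)" using p(2) by (simp add: cong_altdef_nat)
  have "ord p 2 dvd r" using c by (simp add: ord_divides')
  moreover have "ord p 2 \<noteq> 1"
  proof
    assume "ord p 2 = 1"
    then have "[2 ^ 1 = 1] (mod p)" using ord_divides[of 2 1 p] by simp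
    then have "p dvd 1" by (simp add: cong_altdef_nat)
    then show False using p(1) by simp
  qed
  ultimately have o: "ord p 2 = r" using r(1) by (metis prime_nat_iff)
  have "coprime p 2"
  proof (rule ccontr)
    assume "\<not> coprime p 2"
    then have "p = 2" using p(1) by (metis primes_coprime two_is_prime_nat)
    then have "even ((2::nat) ^ r - 1)" using p(2) by simp
    moreover have "even ((2::nat) ^ r)" using r by simp
    ultimately show False by simp
  qed
  then have dv: "r dvd p - 1" using order_divides_totient[of p 2] o totient_prime[OF p(1)] by simp
  have "p > 1" using p(1) prime_gt_1_nat by blast
  then have "p > r" using dvd_imp_le[OF dv] by linarith
  moreover have "(2::int) ^ r mod int p = 1"
  proof -
    have "[(2::int) ^ r = 1] (mod int p)" using c cong_int_iff[of "2 ^ r" 1 p] by simp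
    then show ?thesis using \<open>p > r\<close> r by (simp add: cong_def)
  qed
  ultimately show ?thesis using p r by auto
qed

text \<open>Every automorphism of \<open>B\<close> moves the vertices \<open>Pt g\<close> by a left
  translation, and the translating element depends multiplicatively on the automorphism. Every
  element occurs, because left translations are graph automorphisms and these lift to
  \<open>B\<close>.\<close>

lemma complete_group_cover:
  fixes G :: "('g, 'm) monoid_scheme" (structure)
  assumes "finite_group G"
  shows "\<exists>(H :: nat monoid) f. finite_group H \<and> complete_group H \<and> f \<in> epi H G"
proof -
  interpret group G using assms by (simp add: finite_group_def)
  have fin: "finite (carrier G)" using assms by (simp add: finite_group_def)
  have transfer: "\<exists>(H :: nat monoid) f. finite_group H \<and> complete_group H \<and> f \<in> epi H G"
    if K: "finite_group K" "no_center_no_outer K" and f: "f \<in> epi K G" for K :: "'k monoid" and f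
  proof -
    obtain H :: "nat monoid" where H: "finite_group H" "K \<cong> H" using finite_group_on_nat[OF K(1)] by blast
    then obtain \<theta> where \<theta>: "\<theta> \<in> iso K H" by (auto simp: is_iso_def)
    have g: "group K" "group H" using K H by (auto simp: finite_group_def)
    have c: "complete_group H" using no_center_no_outer_iso[OF g \<theta> K(2)] group.complete_group_iff[OF g(2)] by blast
    have i: "inv_into (carrier K) \<theta> \<in> iso H K" using group.iso_set_sym[OF g(1) \<theta>] .
    have "f \<circ> inv_into (carrier K) \<theta> \<in> epi H G"
    proof -
      have "f \<circ> inv_into (carrier K) \<theta> \<in> hom H G"
      proof (rule Group.hom_compose)
        show "inv_into (carrier K) \<theta> \<in> hom H K" "f \<in> hom K G" using i f by (simp_all add: epi_def iso_def)
      qed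
      moreover have "(f \<circ> inv_into (carrier K) \<theta>) ` carrier H = carrier G"
        unfolding image_comp[symmetric] using i f by (simp add: epi_def iso_def bij_betw_def)
      ultimately show ?thesis by (simp add: epi_def)
    qed
    with H(1) c show ?thesis by blast
  qed
  show ?thesis
  proof (cases "card (carrier G) \<ge> 2")
    case False
    \<comment> \<open>The trivial group is complete and covers itself; it is treated apart because
      the graph requires two elements.\<close>
    let ?K = "\<lparr>carrier = {0::nat}, monoid.mult = \<lambda>x y. 0, one = 0\<rparr>"
    have K: "group ?K" by (rule groupI) auto
    have "card (carrier G) = 1" using False fin one_closed by (metis One_nat_def Suc_1 card_0_eq empty_iff le_SucE not_less_eq_eq nat_le_linear le_zero_eq)
    then have c1: "carrier G = {\<one>}" using one_closed by (metis card_1_singletonE singletonD)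
    show ?thesis
    proof (rule transfer)
      show "finite_group ?K" using K by (simp add: finite_group_def)
      show "no_center_no_outer ?K" by (auto simp: no_center_no_outer_def iso_def hom_def)
      show "(\<lambda>_. \<one>) \<in> epi ?K G" using c1 by (auto simp: epi_def hom_def)
    qed
  next
    case True
    obtain \<nu> where nu: "bij_betw \<nu> (carrier G) {0..<card (carrier G)}"
      using fin ex_bij_betw_finite_nat by blast
    interpret F: frucht G \<nu> "card (carrier G)" by (intro frucht.intro frucht_axioms.intro is_group nu True)
    obtain p r :: nat where pr: "Factorial_Ring.prime p" "Factorial_Ring.prime r" "r > card (Bij F.S)" "r > 3" "p > r" "(2::int) ^ r mod int p = 1"
      using ex_prime_pair[of "card (Bij F.S)"] by (elim exE conjE) (rule that; assumption)
    have irrefl: "\<not> F.E s s" for s by (cases s) auto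
    interpret Q: graph_group F.S F.E p r
      by (rule graph_group.intro[OF F.finite_S F.E_sym irrefl F.E_in F.no_isolated pr(1,2,5,4,6,3)])
    let ?A = "AutoGroup Q.B"
    interpret A: group ?A by (rule Q.B.AutoGroup)
    \<comment> \<open>Reads the group element off a \<open>Pt\<close> vertex; the value \<one> at
      the other vertices is a default.\<close>
    define u where "u = (\<lambda>s. case s of Pt g \<Rightarrow> g | _ \<Rightarrow> \<one>)"
    define f where "f = (\<lambda>\<alpha>. u (Q.act \<alpha> (Pt \<one>)))"
    have gr: "Q.graph_auts = F.graph_auts" by (simp add: Q.graph_auts_def)
    have hx: "\<exists>h\<in>carrier G. \<forall>g\<in>carrier G. Q.act \<alpha> (Pt g) = Pt (h \<otimes> g)" if "\<alpha> \<in> auto Q.B" for \<alpha>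
      using F.graph_aut_Pt Q.act_graph_auts[OF that] gr by blast
    have fact: "f \<alpha> \<in> carrier G" "g \<in> carrier G \<Longrightarrow> Q.act \<alpha> (Pt g) = Pt (f \<alpha> \<otimes> g)" if a: "\<alpha> \<in> auto Q.B" for \<alpha> g
    proof -
      obtain h where h: "h \<in> carrier G" "\<And>g. g \<in> carrier G \<Longrightarrow> Q.act \<alpha> (Pt g) = Pt (h \<otimes> g)" using hx[OF a] by blast
      then have "f \<alpha> = h" by (simp add: f_def u_def)
      with h show "f \<alpha> \<in> carrier G" "g \<in> carrier G \<Longrightarrow> Q.act \<alpha> (Pt g) = Pt (f \<alpha> \<otimes> g)" by auto
    qed
    have "f \<in> hom ?A G"
    proof (rule homI)
      fix \<alpha> \<beta> assume "\<alpha> \<in> carrier ?A" "\<beta> \<in> carrier ?A"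
      then have ab: "\<alpha> \<in> auto Q.B" "\<beta> \<in> auto Q.B" by simp_all
      have "Q.act (\<alpha> \<otimes>\<^bsub>?A\<^esub> \<beta>) (Pt \<one>) = Q.act \<alpha> (Q.act \<beta> (Pt \<one>))"
        using Q.act_comp(1)[OF Q.auto_iso Q.auto_iso, OF ab, of "Pt \<one>"] ab by simp
      also have "\<dots> = Pt (f \<alpha> \<otimes> f \<beta>)" using fact ab by simp
      finally have "u (Q.act (\<alpha> \<otimes>\<^bsub>?A\<^esub> \<beta>) (Pt \<one>)) = f \<alpha> \<otimes> f \<beta>" by (simp only: u_def frucht_vertex.case)
      then show "f (\<alpha> \<otimes>\<^bsub>?A\<^esub> \<beta>) = f \<alpha> \<otimes> f \<beta>" by (simp only: f_def)
    qed (use fact in simp)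
    moreover have "carrier G \<subseteq> f ` carrier ?A"
    proof
      fix h assume h: "h \<in> carrier G"
      obtain \<alpha> where a: "\<alpha> \<in> auto Q.B" "Q.act \<alpha> = F.translate h"
        using Q.act_surj[of "F.translate h"] F.translate_graph_aut[OF h] gr by auto
      have "f \<alpha> = h" using h by (simp add: f_def a(2) u_def F.translate_def)
      then show "h \<in> f ` carrier ?A" using a(1) by auto
    qed
    ultimately have epi: "f \<in> epi ?A G" using fact by (auto simp: epi_def)
    have "finite (auto Q.B)"
      by (rule finite_subset[OF _ finite_PiE[of "carrier Q.B" "\<lambda>_. carrier Q.B"]])
         (use Q.finite_B in \<open>auto simp: auto_def Bij_def PiE_def bij_betw_def\<close>)
    then have "finite_group ?A" using A.is_group by (simp add: finite_group_def)
    then show ?thesis using transfer Q.complete_Aut_B epi by blast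
  qed
qed

section \<open>Normal subgroups up to isomorphism and the retraction onto a complete one\<close>

lemma is_normal_subgroup_of_iso:
  fixes \<Gamma> :: "('h, 'n) monoid_scheme" (structure)
  assumes n: "is_normal_subgroup_of G \<Gamma>" and \<Gamma>: "group \<Gamma>" and \<Gamma>': "group \<Gamma>'" and \<theta>: "\<theta> \<in> iso \<Gamma> \<Gamma>'"
  shows "is_normal_subgroup_of G \<Gamma>'"
proof -
  interpret \<Gamma>: group \<Gamma> by fact
  interpret \<Gamma>': group \<Gamma>' by fact
  have hom: "\<theta> \<in> hom \<Gamma> \<Gamma>'" and bij: "bij_betw \<theta> (carrier \<Gamma>) (carrier \<Gamma>')" using \<theta> by (auto simp: iso_def)
  interpret \<theta>: group_hom \<Gamma> \<Gamma>' \<theta> using hom by (simp add: group_hom_def group_hom_axioms_def \<Gamma> \<Gamma>')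
  obtain H where H: "H \<lhd> \<Gamma>" "G \<cong> \<Gamma>\<lparr>carrier := H\<rparr>" using n by (auto simp: is_normal_subgroup_of_def)
  interpret H: normal H \<Gamma> by fact
  have HG: "H \<subseteq> carrier \<Gamma>" by (rule H.subset)
  have "\<theta> ` H \<lhd> \<Gamma>'"
  proof (rule \<Gamma>'.normal_invI)
    show "subgroup (\<theta> ` H) \<Gamma>'" using \<theta>.subgroup_img_is_subgroup[OF H.subgroup_axioms] .
    fix x h assume x: "x \<in> carrier \<Gamma>'" and h: "h \<in> \<theta> ` H"
    obtain y where y: "y \<in> carrier \<Gamma>" "x = \<theta> y" using x bij by (auto simp: bij_betw_def)
    obtain g where g: "g \<in> H" "h = \<theta> g" using h by blast
    have "x \<otimes>\<^bsub>\<Gamma>'\<^esub> h \<otimes>\<^bsub>\<Gamma>'\<^esub> inv\<^bsub>\<Gamma>'\<^esub> x = \<theta> (y \<otimes> g \<otimes> inv y)"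
      using y g HG by (simp add: subset_iff)
    moreover have "y \<otimes> g \<otimes> inv y \<in> H" using H.inv_op_closed2[OF y(1) g(1)] .
    ultimately show "x \<otimes>\<^bsub>\<Gamma>'\<^esub> h \<otimes>\<^bsub>\<Gamma>'\<^esub> inv\<^bsub>\<Gamma>'\<^esub> x \<in> \<theta> ` H" by simp
  qed
  moreover have "\<theta> \<in> iso (\<Gamma>\<lparr>carrier := H\<rparr>) (\<Gamma>'\<lparr>carrier := \<theta> ` H\<rparr>)"
  proof (rule isoI)
    show "\<theta> \<in> hom (\<Gamma>\<lparr>carrier := H\<rparr>) (\<Gamma>'\<lparr>carrier := \<theta> ` H\<rparr>)"
      by (rule homI) (use HG in \<open>simp_all add: subset_iff\<close>)
    show "bij_betw \<theta> (carrier (\<Gamma>\<lparr>carrier := H\<rparr>)) (carrier (\<Gamma>'\<lparr>carrier := \<theta> ` H\<rparr>))"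
      using inj_on_subset[OF bij_betw_imp_inj_on[OF bij] HG] by (simp add: bij_betw_def)
  qed
  then have "G \<cong> \<Gamma>'\<lparr>carrier := \<theta> ` H\<rparr>" using iso_trans[OF H(2)] is_isoI by blast
  ultimately show ?thesis unfolding is_normal_subgroup_of_def by blast
qed

text \<open>Conjugation by g on the normal subgroup agrees with conjugation by some f g inside it,
  as all automorphisms are inner; the trivial centre makes f g unique. Uniqueness makes f
  multiplicative and the identity on the subgroup, hence surjective.\<close>

lemma complete_normal_retract:
  fixes \<Gamma> :: "('h, 'n) monoid_scheme" (structure)
  assumes C: "complete_group C" and n: "is_normal_subgroup_of C \<Gamma>" and \<Gamma>: "group \<Gamma>"
  shows "\<exists>f. f \<in> epi \<Gamma> C"
proof -
  interpret \<Gamma>: group \<Gamma> by fact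
  interpret C: group C using C by (simp add: complete_group_def)
  obtain H where H: "H \<lhd> \<Gamma>" "C \<cong> \<Gamma>\<lparr>carrier := H\<rparr>" using n by (auto simp: is_normal_subgroup_of_def)
  interpret H: normal H \<Gamma> by fact
  let ?H = "\<Gamma>\<lparr>carrier := H\<rparr>"
  interpret H': group ?H by (rule H.subgroup_is_group[OF \<Gamma>])
  have HG: "h \<in> H \<Longrightarrow> h \<in> carrier \<Gamma>" for h by (rule H.mem_carrier)
  obtain \<theta> where \<theta>: "\<theta> \<in> iso C ?H" using H(2) by (auto simp: is_iso_def)
  have cH: "no_center_no_outer ?H"
    using no_center_no_outer_iso[OF C.is_group H'.is_group \<theta>] C.complete_group_iff C by blast
  have invH: "inv\<^bsub>?H\<^esub> h = inv h" if "h \<in> H" for h using \<Gamma>.m_inv_consistent[OF H.subgroup_axioms that] .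
  have ex: "\<exists>h\<in>H. \<forall>x\<in>H. g \<otimes> x \<otimes> inv g = h \<otimes> x \<otimes> inv h" if g: "g \<in> carrier \<Gamma>" for g
  proof -
    let ?c = "\<lambda>x. g \<otimes> x \<otimes> inv g"
    have "?c \<in> iso ?H ?H"
    proof (rule isoI)
      show "?c \<in> hom ?H ?H" using H.inv_op_closed2[OF g] HG g by (auto intro!: homI simp: \<Gamma>.conj_mult)
      have "bij_betw ?c H H"
      proof (rule bij_betw_byWitness[where f' = "\<lambda>x. inv g \<otimes> x \<otimes> g"])
        show "\<forall>x\<in>H. inv g \<otimes> ?c x \<otimes> g = x" "\<forall>x\<in>H. ?c (inv g \<otimes> x \<otimes> g) = x"
          using g HG by (simp_all add: \<Gamma>.m_assoc \<Gamma>.inv_cancel_left)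
      qed (use H.inv_op_closed2[OF g] H.inv_op_closed1[OF g] in blast)+
      then show "bij_betw ?c (carrier ?H) (carrier ?H)" by simp
    qed
    then have "\<exists>h\<in>carrier ?H. \<forall>x\<in>carrier ?H. ?c x = h \<otimes>\<^bsub>?H\<^esub> x \<otimes>\<^bsub>?H\<^esub> inv\<^bsub>?H\<^esub> h"
      using bspec[OF conjunct2[OF cH[unfolded no_center_no_outer_def]]] by blast
    then show ?thesis using invH by simp
  qed
  then obtain f where f: "\<And>g. g \<in> carrier \<Gamma> \<Longrightarrow> f g \<in> H"
    "\<And>g x. g \<in> carrier \<Gamma> \<Longrightarrow> x \<in> H \<Longrightarrow> g \<otimes> x \<otimes> inv g = f g \<otimes> x \<otimes> inv (f g)"
    by metis
  have unique: "a = b" if ab: "a \<in> H" "b \<in> H" and eq: "\<And>x. x \<in> H \<Longrightarrow> a \<otimes> x \<otimes> inv a = b \<otimes> x \<otimes> inv b" for a b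
  proof -
    let ?z = "inv b \<otimes> a"
    have z: "?z \<in> H" using ab by (simp add: H.m_closed H.m_inv_closed)
    have "?z \<otimes> x = x \<otimes> ?z" if x: "x \<in> H" for x
    proof -
      have "inv b \<otimes> (a \<otimes> x \<otimes> inv a) \<otimes> a = inv b \<otimes> (b \<otimes> x \<otimes> inv b) \<otimes> a" using eq[OF x] by simp
      then show ?thesis using ab x HG by (simp add: \<Gamma>.m_assoc \<Gamma>.inv_cancel_left)
    qed
    then have "?z = \<one>" using cH z unfolding no_center_no_outer_def by simp
    then show ?thesis using ab HG by (metis \<Gamma>.inv_equality \<Gamma>.inv_inv \<Gamma>.inv_closed)
  qed
  have fid: "f h = h" if "h \<in> H" for h
    by (rule unique[symmetric]) (use f that HG in auto)
  have "f \<in> hom \<Gamma> ?H"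
  proof (rule homI)
    fix g g' assume g: "g \<in> carrier \<Gamma>" "g' \<in> carrier \<Gamma>"
    have fH: "f g \<in> H" "f g' \<in> H" "f (g \<otimes> g') \<in> H" using f(1) g by simp_all
    have "f (g \<otimes> g') = f g \<otimes> f g'"
    proof (rule unique)
      fix x assume x: "x \<in> H"
      have c: "g' \<otimes> x \<otimes> inv g' \<in> H" using H.inv_op_closed2[OF g(2) x] .
      have "f (g \<otimes> g') \<otimes> x \<otimes> inv (f (g \<otimes> g')) = g \<otimes> (g' \<otimes> x \<otimes> inv g') \<otimes> inv g"
        using f(2)[of "g \<otimes> g'" x] g x HG by (simp add: \<Gamma>.m_assoc \<Gamma>.inv_mult_group)
      also have "\<dots> = f g \<otimes> (f g' \<otimes> x \<otimes> inv (f g')) \<otimes> inv (f g)"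
        using f(2)[OF g(1) c] f(2)[OF g(2) x] by simp
      also have "\<dots> = (f g \<otimes> f g') \<otimes> x \<otimes> inv (f g \<otimes> f g')"
        using fH x HG by (simp add: \<Gamma>.m_assoc \<Gamma>.inv_mult_group)
      finally show "f (g \<otimes> g') \<otimes> x \<otimes> inv (f (g \<otimes> g')) = (f g \<otimes> f g') \<otimes> x \<otimes> inv (f g \<otimes> f g')" .
    qed (use fH H.m_closed in auto)
    then show "f (g \<otimes> g') = f g \<otimes>\<^bsub>?H\<^esub> f g'" by simp
  qed (use f(1) in simp)
  then have f_hom: "f \<in> hom \<Gamma> ?H" .
  have f_img: "f ` carrier \<Gamma> = H"
  proof
    show "f ` carrier \<Gamma> \<subseteq> H" using f(1) by (rule image_subsetI)
    show "H \<subseteq> f ` carrier \<Gamma>"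
    proof
      fix h assume h: "h \<in> H"
      have "f h \<in> f ` carrier \<Gamma>" using HG[OF h] by (rule imageI)
      then show "h \<in> f ` carrier \<Gamma>" unfolding fid[OF h] .
    qed
  qed
  have "inv_into (carrier C) \<theta> \<in> iso ?H C" using C.iso_set_sym[OF \<theta>] .
  then have j: "inv_into (carrier C) \<theta> \<in> hom ?H C" "inv_into (carrier C) \<theta> ` H = carrier C"
    by (simp_all add: iso_def bij_betw_def)
  note i = f_hom f_img j
  have "inv_into (carrier C) \<theta> \<circ> f \<in> hom \<Gamma> C" by (rule Group.hom_compose[OF i(1,3)])
  moreover have "(inv_into (carrier C) \<theta> \<circ> f) ` carrier \<Gamma> = carrier C" unfolding image_comp[symmetric] i(2,4) ..
  ultimately show ?thesis unfolding epi_def by blast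
qed

section \<open>Quotients and towers of Galois extensions\<close>

text \<open>Formulated with a subset \<open>K\<close> in place of an embedding, so that fixed fields
  and intermediate fields enter as plain sets; \<open>K = {}\<close> gives all
  automorphisms.\<close>

definition auts :: "('b, 'n) ring_scheme \<Rightarrow> 'b set \<Rightarrow> ('b \<Rightarrow> 'b) set" where
  "auts N K = {\<theta> \<in> Bij (carrier N). \<theta> \<in> ring_hom N N \<and> (\<forall>a\<in>K. \<theta> a = a)}"

definition fixed_points :: "('b, 'n) ring_scheme \<Rightarrow> ('b \<Rightarrow> 'b) set \<Rightarrow> 'b set" where
  "fixed_points N Q = {x \<in> carrier N. \<forall>\<theta>\<in>Q. \<theta> x = x}"

lemma relative_auts_eq: "relative_auts k N \<phi> = auts N (\<phi> ` carrier k)"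
  by (simp add: relative_auts_def auts_def)

lemma finite_galois_extension_iff:
  "finite_galois_extension k N \<phi> \<longleftrightarrow> finite_field_extension k N \<phi> \<and> fixed_points N (auts N (\<phi> ` carrier k)) = \<phi> ` carrier k"
  by (simp add: finite_galois_extension_def relative_auts_eq fixed_points_def)

context field begin

lemma autsD:
  assumes "\<theta> \<in> auts R K"
  shows "\<theta> \<in> Bij (carrier R)" "\<theta> \<in> ring_hom R R" "\<And>a. a \<in> K \<Longrightarrow> \<theta> a = a" "\<And>x. x \<in> carrier R \<Longrightarrow> \<theta> x \<in> carrier R"
    "bij_betw \<theta> (carrier R) (carrier R)" "\<theta> \<in> extensional (carrier R)"
  using assms by (auto simp: auts_def Bij_def ring_hom_def)

lemma auts_eqI:
  assumes "\<theta> \<in> auts R K" "\<tau> \<in> auts R K'" "\<And>x. x \<in> carrier R \<Longrightarrow> \<theta> x = \<tau> x"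
  shows "\<theta> = \<tau>"
  using autsD(6)[OF assms(1)] autsD(6)[OF assms(2)] assms(3) by (rule extensionalityI)

lemma auts_mono: "K \<subseteq> K' \<Longrightarrow> auts R K' \<subseteq> auts R K"
  by (auto simp: auts_def)

lemma auts_compose:
  assumes "\<theta> \<in> auts R K" "\<tau> \<in> auts R K" "K \<subseteq> carrier R" shows "compose (carrier R) \<theta> \<tau> \<in> auts R K"
proof -
  note s = autsD[OF assms(1)] autsD[OF assms(2)]
  have "\<theta> \<circ> \<tau> \<in> ring_hom R R" using ring_hom_trans s by blast
  then have "compose (carrier R) \<theta> \<tau> \<in> ring_hom R R"
    by (auto simp: ring_hom_def compose_eq)
  then show ?thesis using compose_Bij s assms(3) by (auto simp: auts_def compose_eq subset_iff)
qed

lemma auts_inv: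
  assumes s: "\<theta> \<in> auts R K" and K: "K \<subseteq> carrier R"
  shows "(\<lambda>x\<in>carrier R. inv_into (carrier R) \<theta> x) \<in> auts R K"
proof -
  let ?t = "\<lambda>x\<in>carrier R. inv_into (carrier R) \<theta> x"
  note s' = autsD[OF s]
  have "\<theta> \<in> ring_iso R R" using s' by (simp add: ring_iso_def)
  then have "inv_into (carrier R) \<theta> \<in> ring_iso R R" by (rule ring_iso_set_sym[OF ring_axioms])
  then have "inv_into (carrier R) \<theta> \<in> ring_hom R R" by (simp add: ring_iso_def)
  then have "?t \<in> ring_hom R R" by (auto simp: ring_hom_def)
  moreover have "inv_into (carrier R) \<theta> a = a" if "a \<in> K" for a
    using s'(3)[OF that] s'(5) K that by (metis bij_betw_inv_into_left subsetD)
  ultimately show ?thesis using restrict_inv_into_Bij[OF s'(1)] K by (auto simp: auts_def)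
qed

text \<open>Dedekind's theorem, by elimination: evaluate a relation at y x, subtract \<psi> y times
  the relation at x, and \<psi> drops out.\<close>

lemma independent_characters:
  assumes "finite C" "\<And>\<chi>. \<chi> \<in> C \<Longrightarrow> \<chi> \<in> ring_hom R R"
    and "\<And>\<chi> \<chi>'. \<chi> \<in> C \<Longrightarrow> \<chi>' \<in> C \<Longrightarrow> \<chi> \<noteq> \<chi>' \<Longrightarrow> \<exists>y\<in>carrier R. \<chi> y \<noteq> \<chi>' y"
    and "\<And>\<chi>. \<chi> \<in> C \<Longrightarrow> c \<chi> \<in> carrier R"
    and "\<And>x. x \<in> carrier R \<Longrightarrow> (\<Oplus>\<chi>\<in>C. c \<chi> \<otimes> \<chi> x) = \<zero>"
  shows "\<forall>\<chi>\<in>C. c \<chi> = \<zero>"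
  using assms
proof (induction C arbitrary: c rule: finite_induct)
  case (insert \<psi> C)
  have closed: "\<chi> x \<in> carrier R" if "\<chi> \<in> insert \<psi> C" "x \<in> carrier R" for \<chi> x
    using insert.prems(1)[OF that(1)] that(2) by (rule ring_hom_closed)
  have mult: "\<chi> (x \<otimes> y) = \<chi> x \<otimes> \<chi> y" if "\<chi> \<in> insert \<psi> C" "x \<in> carrier R" "y \<in> carrier R" for \<chi> x y
    using ring_hom_mult[OF insert.prems(1)[OF that(1)] that(2,3)] .
  note c = insert.prems(3)
  have sum: "(\<Oplus>\<chi>\<in>C. c \<chi> \<otimes> \<chi> x) = \<ominus> (c \<psi> \<otimes> \<psi> x)" if x: "x \<in> carrier R" for x
  proof -
    have "c \<psi> \<otimes> \<psi> x \<oplus> (\<Oplus>\<chi>\<in>C. c \<chi> \<otimes> \<chi> x) = \<zero>"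
      using insert.prems(4)[OF x] insert.hyps closed x c by (subst (asm) finsum_insert) auto
    moreover have "(\<Oplus>\<chi>\<in>C. c \<chi> \<otimes> \<chi> x) \<in> carrier R" using closed x c by (intro finsum_closed) auto
    ultimately show ?thesis using closed[of \<psi> x] x c[of \<psi>]
      by (intro minus_equality[symmetric]) (auto simp: a_comm)
  qed
  have X0: "c \<chi> = \<zero>" if ch: "\<chi> \<in> C" for \<chi>
  proof -
    have ne: "\<chi> \<noteq> \<psi>" using ch insert.hyps by blast
    then obtain y where y: "y \<in> carrier R" "\<chi> y \<noteq> \<psi> y" using insert.prems(2)[of \<chi> \<psi>] ch by blast
    \<comment> \<open>These are the coefficients after eliminating \<psi>. The choice of y makes the
      extra factor at the given \<chi> nonzero, so that coefficient vanishes.\<close>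
    have "\<forall>\<chi>\<in>C. c \<chi> \<otimes> (\<chi> y \<ominus> \<psi> y) = \<zero>"
    proof (rule insert.IH[of "\<lambda>\<chi>. c \<chi> \<otimes> (\<chi> y \<ominus> \<psi> y)"])
      fix x assume x: "x \<in> carrier R"
      have "(\<Oplus>\<chi>\<in>C. c \<chi> \<otimes> (\<chi> y \<ominus> \<psi> y) \<otimes> \<chi> x) = (\<Oplus>\<chi>\<in>C. c \<chi> \<otimes> \<chi> (y \<otimes> x) \<oplus> (\<ominus> \<psi> y) \<otimes> (c \<chi> \<otimes> \<chi> x))"
      proof (intro finsum_cong' refl)
        fix \<rho> assume "\<rho> \<in> C"
        then show "c \<rho> \<otimes> (\<rho> y \<ominus> \<psi> y) \<otimes> \<rho> x = c \<rho> \<otimes> \<rho> (y \<otimes> x) \<oplus> \<ominus> \<psi> y \<otimes> (c \<rho> \<otimes> \<rho> x)"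
          using closed[of \<rho> x] closed[of \<rho> y] closed[of \<psi> y] c[of \<rho>] x y
          by (simp add: mult[of \<rho> y x] minus_eq l_distr r_distr l_minus r_minus) (simp add: m_ac)
      qed (use closed x y c in auto)
      also have "\<dots> = (\<Oplus>\<chi>\<in>C. c \<chi> \<otimes> \<chi> (y \<otimes> x)) \<oplus> (\<Oplus>\<chi>\<in>C. (\<ominus> \<psi> y) \<otimes> (c \<chi> \<otimes> \<chi> x))"
        using closed x y c by (intro finsum_addf) auto
      also have "(\<Oplus>\<chi>\<in>C. (\<ominus> \<psi> y) \<otimes> (c \<chi> \<otimes> \<chi> x)) = (\<ominus> \<psi> y) \<otimes> (\<Oplus>\<chi>\<in>C. c \<chi> \<otimes> \<chi> x)"
        using closed x y c insert.hyps by (intro finsum_rdistr[symmetric]) auto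
      also have "(\<Oplus>\<chi>\<in>C. c \<chi> \<otimes> \<chi> (y \<otimes> x)) \<oplus> (\<ominus> \<psi> y) \<otimes> (\<Oplus>\<chi>\<in>C. c \<chi> \<otimes> \<chi> x) = \<zero>"
        using closed[of \<psi> x] closed[of \<psi> y] c[of \<psi>] x y
        by (simp add: sum mult[of \<psi> y x] l_minus r_minus) (simp add: m_ac l_neg)
      finally show "(\<Oplus>\<chi>\<in>C. c \<chi> \<otimes> (\<chi> y \<ominus> \<psi> y) \<otimes> \<chi> x) = \<zero>" .
    qed (use insert.prems closed y ch in auto)
    then have "c \<chi> \<otimes> (\<chi> y \<ominus> \<psi> y) = \<zero>" using ch by (rule bspec)
    moreover have "\<chi> y \<ominus> \<psi> y \<noteq> \<zero>" using y closed ch by (simp add: r_right_minus_eq)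
    ultimately show ?thesis using closed[of \<chi> y] closed[of \<psi> y] ch y c integral by (metis insertCI minus_closed)
  qed
  have "(\<Oplus>\<chi>\<in>C. c \<chi> \<otimes> \<chi> \<one>) = (\<Oplus>\<chi>\<in>C. \<zero>)"
    using X0 closed by (intro finsum_cong') auto
  then have "\<ominus> (c \<psi> \<otimes> \<psi> \<one>) = \<zero>" using sum[of \<one>] by (simp add: finsum_zero)
  moreover have "\<psi> \<one> = \<one>" using insert.prems(1)[of \<psi>] by (simp add: ring_hom_one)
  ultimately have "c \<psi> = \<zero>" using c[of \<psi>] by (metis insertI1 minus_minus minus_zero r_one)
  show ?case
  proof
    fix \<chi> assume "\<chi> \<in> insert \<psi> C"
    then consider "\<chi> = \<psi>" | "\<chi> \<in> C" by (rule insertE)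
    then show "c \<chi> = \<zero>"
    proof cases
      case 1
      show ?thesis unfolding 1 by (rule \<open>c \<psi> = \<zero>\<close>)
    qed (rule X0)
  qed
next
  case empty
  show ?case by simp
qed

text \<open>The sum of the elements of \<open>Q\<close> takes values fixed by \<open>Q\<close>,
  hence fixed by \<tau>. If \<tau> were outside \<open>Q\<close>, then \<open>Q\<close> and its
  translate by \<tau> would be disjoint, and the difference of their sums would be a relation with
  coefficients 1 and -1, against independence. No degrees have to be counted.\<close>

lemma artin:
  assumes fin: "finite Q" and ne: "Q \<noteq> {}" and Q: "Q \<subseteq> auts R {}"
    and closed: "\<And>\<theta> \<tau>. \<theta> \<in> Q \<Longrightarrow> \<tau> \<in> Q \<Longrightarrow> compose (carrier R) \<theta> \<tau> \<in> Q"
    and t: "\<tau> \<in> auts R (fixed_points R Q)"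
  shows "\<tau> \<in> Q"
proof (rule ccontr)
  assume nQ: "\<tau> \<notin> Q"
  define tr where "tr x = (\<Oplus>\<theta>\<in>Q. \<theta> x)" for x
  have QD: "\<theta> \<in> ring_hom R R" "\<theta> \<in> extensional (carrier R)" "bij_betw \<theta> (carrier R) (carrier R)" "x \<in> carrier R \<Longrightarrow> \<theta> x \<in> carrier R" if "\<theta> \<in> Q" for \<theta> x
    using autsD(2,6,5,4)[OF subsetD[OF Q that]] by blast+
  note tD = autsD[OF t]
  have cancel: "\<rho> = \<rho>'" if c: "\<rho> \<in> extensional (carrier R)" "\<rho>' \<in> extensional (carrier R)" "\<theta> \<in> Q"
    "compose (carrier R) \<rho> \<theta> = compose (carrier R) \<rho>' \<theta>" for \<rho> \<rho>' \<theta>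
  proof (rule extensionalityI[OF c(1,2)])
    fix x assume "x \<in> carrier R"
    then obtain y where "y \<in> carrier R" "x = \<theta> y" using QD(3)[OF c(3)] by (auto simp: bij_betw_def)
    then show "\<rho> x = \<rho>' x" using fun_cong[OF c(4), of y] by (simp add: compose_eq)
  qed
  have left: "\<rho> = \<rho>'" if "\<theta> \<in> auts R {}" "\<rho> \<in> Q" "\<rho>' \<in> Q"
    "compose (carrier R) \<theta> \<rho> = compose (carrier R) \<theta> \<rho>'" for \<rho> \<rho>' \<theta>
  proof (rule extensionalityI[OF QD(2)[OF that(2)] QD(2)[OF that(3)]])
    fix x assume x: "x \<in> carrier R"
    then have "\<theta> (\<rho> x) = \<theta> (\<rho>' x)" using fun_cong[OF that(4), of x] by (simp add: compose_eq)
    then show "\<rho> x = \<rho>' x" using autsD(5)[OF that(1)] QD(4)[OF that(2) x] QD(4)[OF that(3) x]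
      by (auto simp: bij_betw_def inj_on_def)
  qed
  have ta: "\<tau> \<in> auts R {}" using t auts_mono[of "{}"] by blast
  \<comment> \<open>Left composition with an element of \<open>Q\<close> only permutes the
    summands.\<close>
  have tr_fixed: "tr x \<in> fixed_points R Q" if x: "x \<in> carrier R" for x
  proof -
    have "\<theta> (tr x) = tr x" if s: "\<theta> \<in> Q" for \<theta>
    proof -
      interpret s: ring_hom_cring R R \<theta>
        using QD(1)[OF s] by (intro ring_hom_cring.intro ring_hom_cring_axioms.intro is_cring)
      have inj: "inj_on (compose (carrier R) \<theta>) Q" by (rule inj_onI) (rule left[OF subsetD[OF Q s]]; assumption)
      have im: "compose (carrier R) \<theta> ` Q = Q"
        by (rule endo_inj_surj[OF fin image_subsetI inj]) (rule closed[OF s])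
      have "\<theta> (tr x) = (\<Oplus>\<rho>\<in>Q. \<theta> (\<rho> x))"
        unfolding tr_def using fin QD(4) x by (subst s.hom_finsum) (auto simp: o_def)
      also have "\<dots> = (\<Oplus>\<rho>\<in>Q. compose (carrier R) \<theta> \<rho> x)"
        using x QD(4) s by (intro finsum_cong') (auto simp: compose_eq)
      also have "\<dots> = (\<Oplus>\<rho>\<in>compose (carrier R) \<theta> ` Q. \<rho> x)"
        using inj x QD(4) im by (intro finsum_reindex[symmetric]) auto
      finally show ?thesis by (simp add: im tr_def)
    qed
    moreover have "tr x \<in> carrier R" unfolding tr_def using QD(4) x by (intro finsum_closed) auto
    ultimately show ?thesis by (simp add: fixed_points_def)
  qed
  interpret t: ring_hom_cring R R \<tau>
    using tD(2) by (intro ring_hom_cring.intro ring_hom_cring_axioms.intro is_cring)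
  let ?tQ = "compose (carrier R) \<tau> ` Q"
  have tQD: "\<chi> \<in> auts R {}" if "\<chi> \<in> ?tQ" for \<chi> using that Q ta auts_compose[of _ "{}"] by auto
  \<comment> \<open>Right composition with \<theta> permutes the finite set \<open>Q\<close>, so if
    \<tau> composed with \<theta> were in \<open>Q\<close>, then \<tau> itself would be.\<close>
  have disj: "Q \<inter> ?tQ = {}"
  proof (rule ccontr)
    assume "Q \<inter> ?tQ \<noteq> {}"
    then obtain \<theta> \<theta>' where s: "\<theta> \<in> Q" "\<theta>' \<in> Q" "\<theta>' = compose (carrier R) \<tau> \<theta>" by blast
    have inj: "inj_on (\<lambda>\<rho>. compose (carrier R) \<rho> \<theta>) Q" by (rule inj_onI) (rule cancel[OF QD(2) QD(2) s(1)]; assumption)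
    have "(\<lambda>\<rho>. compose (carrier R) \<rho> \<theta>) ` Q = Q"
      by (rule endo_inj_surj[OF fin image_subsetI inj]) (rule closed[OF _ s(1)])
    then obtain \<rho> where "\<rho> \<in> Q" "\<theta>' = compose (carrier R) \<rho> \<theta>" using s(2) by blast
    then have "\<tau> = \<rho>" using cancel[OF tD(6) QD(2) s(1)] s(3) by simp
    then show False using nQ \<open>\<rho> \<in> Q\<close> by simp
  qed
  define c where "c \<chi> = (if \<chi> \<in> Q then \<one> else \<ominus> \<one>)" for \<chi>
  have hom: "\<chi> \<in> ring_hom R R" "\<chi> \<in> extensional (carrier R)" "x \<in> carrier R \<Longrightarrow> \<chi> x \<in> carrier R" if "\<chi> \<in> Q \<union> ?tQ" for \<chi> x
    using autsD(2,6,4)[of \<chi> "{}"] Q tQD that by blast+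
  obtain \<theta> where s: "\<theta> \<in> Q" using ne by blast
  have "\<forall>\<chi>\<in>Q \<union> ?tQ. c \<chi> = \<zero>"
  proof (rule independent_characters)
    fix x assume x: "x \<in> carrier R"
    have inj: "inj_on (compose (carrier R) \<tau>) Q" by (rule inj_onI) (rule left[OF ta]; assumption)
    have "(\<Oplus>\<chi>\<in>Q \<union> ?tQ. c \<chi> \<otimes> \<chi> x) = (\<Oplus>\<chi>\<in>Q. c \<chi> \<otimes> \<chi> x) \<oplus> (\<Oplus>\<chi>\<in>?tQ. c \<chi> \<otimes> \<chi> x)"
      using fin disj x hom(3) by (intro finsum_Un_disjoint) (auto simp: c_def)
    also have "(\<Oplus>\<chi>\<in>Q. c \<chi> \<otimes> \<chi> x) = tr x"
      unfolding tr_def using x QD(4) by (intro finsum_cong') (auto simp: c_def)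
    also have "(\<Oplus>\<chi>\<in>?tQ. c \<chi> \<otimes> \<chi> x) = (\<Oplus>\<chi>\<in>?tQ. \<ominus> \<one> \<otimes> \<chi> x)"
      using disj x hom(3) by (intro finsum_cong') (auto simp: c_def)
    also have "\<dots> = \<ominus> \<one> \<otimes> (\<Oplus>\<chi>\<in>?tQ. \<chi> x)"
      using fin x hom(3) by (intro finsum_rdistr[symmetric]) auto
    also have "(\<Oplus>\<chi>\<in>?tQ. \<chi> x) = (\<Oplus>\<rho>\<in>Q. compose (carrier R) \<tau> \<rho> x)"
      using inj x hom(3) by (intro finsum_reindex) auto
    also have "\<dots> = (\<Oplus>\<rho>\<in>Q. \<tau> (\<rho> x))"
      using x QD(4) tD(4) by (intro finsum_cong') (auto simp: compose_eq)
    also have "\<dots> = \<tau> (tr x)"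
      unfolding tr_def using fin QD(4) x by (subst t.hom_finsum) (auto simp: o_def)
    also have "\<dots> = tr x" using tD(3) tr_fixed[OF x] by blast
    finally show "(\<Oplus>\<chi>\<in>Q \<union> ?tQ. c \<chi> \<otimes> \<chi> x) = \<zero>"
      using tr_fixed[OF x] by (simp add: fixed_points_def l_minus r_neg)
  next
    fix \<chi> \<chi>' assume "\<chi> \<in> Q \<union> ?tQ" "\<chi>' \<in> Q \<union> ?tQ" "\<chi> \<noteq> \<chi>'"
    then show "\<exists>y\<in>carrier R. \<chi> y \<noteq> \<chi>' y" using extensionalityI[OF hom(2) hom(2), of \<chi> \<chi>'] by blast
  next
    show "finite (Q \<union> ?tQ)" using fin by simp
    show "\<chi> \<in> ring_hom R R" if "\<chi> \<in> Q \<union> ?tQ" for \<chi> using hom(1)[OF that] .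
    show "c \<chi> \<in> carrier R" for \<chi> by (simp add: c_def)
  qed
  then have "c \<theta> = \<zero>" using s by blast
  then show False using s by (simp add: c_def)
qed

text \<open>An automorphism over \<open>K\<close> is determined by its values on a finite spanning
  list, and each value is a root of a fixed nonzero polynomial over \<open>K\<close>.\<close>

lemma finite_auts:
  assumes K: "subfield K R" and fd: "finite_dimension K (carrier R)"
  shows "finite (auts R K)"
proof -
  have KR: "K \<subseteq> carrier R" using subfieldE(3)[OF K] .
  obtain n where n: "dimension n K (carrier R)" using fd by (auto simp: finite_dimension_def)
  obtain Us where Us: "set Us \<subseteq> carrier R" "Span K Us = carrier R" using exists_base[OF K n] by blast
  have "\<exists>A. finite A \<and> (\<forall>\<theta>\<in>auts R K. \<theta> u \<in> A)" if u: "u \<in> carrier R" for u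
  proof -
    have "(algebraic over K) u" using finite_dimension_imp_algebraic[OF K carrier_is_subring fd u] .
    then obtain p where p: "p \<in> carrier (K[X])" "p \<noteq> []" "eval p u = \<zero>"
      using algebraicE[OF subfieldE(1)[OF K] u] by blast
    have sp: "set p \<subseteq> K" using p(1) by (auto simp: univ_poly_def polynomial_def)
    have "\<theta> u \<in> {x. is_root p x}" if s: "\<theta> \<in> auts R K" for \<theta>
    proof -
      note sD = autsD[OF s]
      interpret s: ring_hom_ring R R \<theta> using sD(2) by (intro ring_hom_ringI2 ring_axioms)
      have "map \<theta> p = p" using sp sD(3) by (intro map_idI) auto
      then have "eval p (\<theta> u) = \<theta> (eval p u)" using s.eval_hom'[OF u, of p] sp KR by auto
      then show ?thesis using p sD(4)[OF u] by (simp add: is_root_def)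
    qed
    moreover have "p \<in> carrier (poly_ring R)" using carrier_polynomial_shell[OF subfieldE(1)[OF K] p(1)] .
    then have "finite {x. is_root p x}" by (rule finite_number_of_roots)
    ultimately show ?thesis by blast
  qed
  then obtain A where A: "\<And>u. u \<in> carrier R \<Longrightarrow> finite (A u) \<and> (\<forall>\<theta>\<in>auts R K. \<theta> u \<in> A u)" by metis
  have "inj_on (\<lambda>\<theta>. restrict \<theta> (set Us)) (auts R K)"
  proof (rule inj_onI)
    fix \<theta> \<tau> assume s: "\<theta> \<in> auts R K" and t: "\<tau> \<in> auts R K" and eq: "restrict \<theta> (set Us) = restrict \<tau> (set Us)"
    interpret s: ring_hom_ring R R \<theta> using autsD(2)[OF s] by (intro ring_hom_ringI2 ring_axioms)
    interpret t: ring_hom_ring R R \<tau> using autsD(2)[OF t] by (intro ring_hom_ringI2 ring_axioms)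
    have mU: "map \<theta> Us = map \<tau> Us" using eq by (auto simp: fun_eq_iff) (metis restrict_apply')
    show "\<theta> = \<tau>"
    proof (rule auts_eqI[OF s t])
      fix x assume "x \<in> carrier R"
      then obtain Ks where Ks: "set Ks \<subseteq> K" "x = combine Ks Us"
        using Span_eq_combine_set[OF K Us(1)] Us(2) by blast
      have mK: "map \<theta> Ks = Ks" "map \<tau> Ks = Ks" using Ks(1) autsD(3)[OF s] autsD(3)[OF t] by (auto intro!: map_idI)
      show "\<theta> x = \<tau> x"
        using s.combine_hom[of Ks Us] t.combine_hom[of Ks Us] Ks Us(1) KR mU mK by auto
    qed
  qed
  moreover have "(\<lambda>\<theta>. restrict \<theta> (set Us)) ` auts R K \<subseteq> (\<Pi>\<^sub>E u\<in>set Us. A u)"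
    using A Us(1) by auto
  moreover have "finite (\<Pi>\<^sub>E u\<in>set Us. A u)" using A Us(1) by (intro finite_PiE) auto
  ultimately show ?thesis by (meson finite_imageD finite_subset)
qed

end

section \<open>Galois groups and their transport along isomorphisms\<close>

abbreviation aut_group :: "('b, 'n) ring_scheme \<Rightarrow> 'b set \<Rightarrow> ('b \<Rightarrow> 'b) monoid" where
  "aut_group N K \<equiv> BijGroup (carrier N)\<lparr>carrier := auts N K\<rparr>"

lemma Gal_eq: "Gal k N \<phi> = aut_group N (\<phi> ` carrier k)"
  by (simp add: Gal_def relative_auts_eq)

lemma aut_group_simps:
  "\<theta> \<in> auts N K \<Longrightarrow> \<tau> \<in> auts N K \<Longrightarrow> \<theta> \<otimes>\<^bsub>aut_group N K\<^esub> \<tau> = compose (carrier N) \<theta> \<tau>"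
  "\<one>\<^bsub>aut_group N K\<^esub> = (\<lambda>x\<in>carrier N. x)"
  by (simp_all add: BijGroup_def auts_def)

context field begin

lemma id_auts: "K \<subseteq> carrier R \<Longrightarrow> (\<lambda>x\<in>carrier R. x) \<in> auts R K"
  by (auto simp: auts_def id_Bij ring_hom_def)

lemma subgroup_auts: assumes "K \<subseteq> carrier R" shows "subgroup (auts R K) (BijGroup (carrier R))"
proof (intro subgroup.intro)
  fix x assume x: "x \<in> auts R K"
  show "inv\<^bsub>BijGroup (carrier R)\<^esub> x \<in> auts R K"
    using auts_inv[OF x assms] inv_BijGroup[OF autsD(1)[OF x]] by simp
next
  fix x y assume xy: "x \<in> auts R K" "y \<in> auts R K"
  show "x \<otimes>\<^bsub>BijGroup (carrier R)\<^esub> y \<in> auts R K"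
    using auts_compose[OF xy assms] autsD(1)[OF xy(1)] autsD(1)[OF xy(2)] by (simp add: BijGroup_def)
qed (use id_auts[OF assms] in \<open>auto simp: BijGroup_def auts_def\<close>)

lemma group_aut_group: "K \<subseteq> carrier R \<Longrightarrow> group (aut_group R K)"
  using subgroup.subgroup_is_group[OF subgroup_auts group_BijGroup] .

end

lemma conj_auts:
  assumes M: "ring M" and \<eta>: "\<eta> \<in> ring_iso N M" and \<theta>: "\<theta> \<in> ring_iso M N"
    and inv: "\<And>x. x \<in> carrier N \<Longrightarrow> \<theta> (\<eta> x) = x" "\<And>y. y \<in> carrier M \<Longrightarrow> \<eta> (\<theta> y) = y"
    and K: "K \<subseteq> carrier N" and s: "\<sigma> \<in> auts N K"
  shows "(\<lambda>y\<in>carrier M. \<eta> (\<sigma> (\<theta> y))) \<in> auts M (\<eta> ` K)"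
proof -
  have si: "\<sigma> \<in> ring_iso N N" using s by (simp add: auts_def Bij_def ring_iso_def)
  have "\<eta> \<circ> (\<sigma> \<circ> \<theta>) \<in> ring_iso M M" using ring_iso_set_trans[OF ring_iso_set_trans[OF \<theta> si] \<eta>] .
  then have i: "\<eta> \<circ> (\<sigma> \<circ> \<theta>) \<in> ring_hom M M" "bij_betw (\<eta> \<circ> (\<sigma> \<circ> \<theta>)) (carrier M) (carrier M)" by (auto simp: ring_iso_def)
  have "bij_betw (\<lambda>y\<in>carrier M. \<eta> (\<sigma> (\<theta> y))) (carrier M) (carrier M)"
    using i(2) by (rule bij_betw_cong[THEN iffD1, rotated]) simp
  moreover have "(\<lambda>y\<in>carrier M. \<eta> (\<sigma> (\<theta> y))) \<in> ring_hom M M"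
  proof -
    interpret ring M by fact
    show ?thesis using i(1) by (auto simp: ring_hom_def)
  qed
  moreover have "\<eta> a \<in> carrier M" if "a \<in> K" for a using \<eta> K that by (auto simp: ring_iso_def ring_hom_def)
  moreover have "\<sigma> a = a" if "a \<in> K" for a using s that by (simp add: auts_def)
  ultimately show ?thesis using inv(1) K by (auto simp: auts_def Bij_def subset_iff)
qed

text \<open>Conjugation by \<eta> carries automorphisms and fixed points across. The base field may
  change as well, since only its image in the top field enters; this serves both the passage to
  fields on lists and the replacement of \<open>k\<close> by an isomorphic copy.\<close>

lemma galois_transport:
  assumes g: "finite_galois_extension k N \<phi>" and L: "field L" and M: "field M" and \<iota>: "\<iota> \<in> ring_hom L M"
    and \<eta>: "\<eta> \<in> ring_iso N M" and im: "\<eta> ` \<phi> ` carrier k = \<iota> ` carrier L"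
  shows "finite_galois_extension L M \<iota>" "Gal k N \<phi> \<cong> Gal L M \<iota>"
proof -
  have k: "field k" and N: "field N" and \<phi>: "\<phi> \<in> ring_hom k N"
    and fd: "ring.finite_dimension N (\<phi> ` carrier k) (carrier N)"
    and fp: "fixed_points N (auts N (\<phi> ` carrier k)) = \<phi> ` carrier k"
    using g by (auto simp: finite_galois_extension_iff finite_field_extension_def)
  interpret k: field k by fact
  interpret N: field N by fact
  interpret M: field M by fact
  interpret \<phi>: ring_hom_ring k N \<phi> using ring_hom_ringI2[OF k.ring_axioms N.ring_axioms \<phi>] .
  let ?K = "\<phi> ` carrier k"
  have Ksub: "subfield ?K N"
    using \<phi>.img_is_subfield(2)[OF k.carrier_is_subfield] N.one_not_zero by simp
  have K: "?K \<subseteq> carrier N" using subfieldE(3)[OF Ksub] .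
  have hom: "\<eta> \<in> ring_hom N M" and bij: "bij_betw \<eta> (carrier N) (carrier M)" using \<eta> by (auto simp: ring_iso_def)
  interpret \<eta>: ring_hom_ring N M \<eta> using ring_hom_ringI2[OF N.ring_axioms M.ring_axioms hom] .
  define \<theta> where "\<theta> = inv_into (carrier N) \<eta>"
  have \<theta>: "\<theta> \<in> ring_iso M N" using ring_iso_set_sym[OF N.ring_axioms \<eta>] by (simp add: \<theta>_def)
  have inv: "\<And>x. x \<in> carrier N \<Longrightarrow> \<theta> (\<eta> x) = x" "\<And>y. y \<in> carrier M \<Longrightarrow> \<eta> (\<theta> y) = y"
    using bij by (auto simp: \<theta>_def bij_betw_def f_inv_into_f)
  have \<theta>c: "\<theta> y \<in> carrier N" if "y \<in> carrier M" for y using \<theta> that by (auto simp: ring_iso_def ring_hom_def)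
  have K': "\<eta> ` ?K \<subseteq> carrier M" using K by auto
  have \<theta>K: "\<theta> ` \<eta> ` ?K = ?K" using inv(1) K by (force simp: image_image subset_iff)
  obtain n where "N.dimension n ?K (carrier N)" using fd by (auto simp: N.finite_dimension_def)
  then have "M.dimension n (\<eta> ` ?K) (\<eta> ` carrier N)"
    using \<eta>.inj_hom_dimension[OF Ksub _ bij_betw_imp_inj_on[OF bij]] M.one_not_zero by simp
  then have "M.finite_dimension (\<iota> ` carrier L) (carrier M)"
    using bij im by (auto simp: M.finite_dimension_def bij_betw_def)
  moreover have "fixed_points M (auts M (\<eta> ` ?K)) = \<eta> ` ?K"
  proof
    show "\<eta> ` ?K \<subseteq> fixed_points M (auts M (\<eta> ` ?K))" using K' by (auto simp: fixed_points_def auts_def)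
    show "fixed_points M (auts M (\<eta> ` ?K)) \<subseteq> \<eta> ` ?K"
    proof
      fix y assume y: "y \<in> fixed_points M (auts M (\<eta> ` ?K))"
      then have yc: "y \<in> carrier M" by (simp add: fixed_points_def)
      have "\<sigma> (\<theta> y) = \<theta> y" if s: "\<sigma> \<in> auts N ?K" for \<sigma>
      proof -
        have "\<eta> (\<sigma> (\<theta> y)) = y" using y conj_auts[OF M.ring_axioms \<eta> \<theta> inv K s] yc by (auto simp: fixed_points_def)
        then show ?thesis using inv(1)[of "\<sigma> (\<theta> y)"] N.autsD(4)[OF s \<theta>c[OF yc]] by simp
      qed
      then have "\<theta> y \<in> ?K" using fp \<theta>c[OF yc] by (auto simp: fixed_points_def)
      then show "y \<in> \<eta> ` ?K" using inv(2)[OF yc] by (metis imageI)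
    qed
  qed
  ultimately show "finite_galois_extension L M \<iota>"
    using L M \<iota> im by (simp add: finite_galois_extension_iff finite_field_extension_def)
  let ?F = "\<lambda>\<sigma>. \<lambda>y\<in>carrier M. \<eta> (\<sigma> (\<theta> y))"
  let ?G = "\<lambda>\<tau>. \<lambda>x\<in>carrier N. \<theta> (\<tau> (\<eta> x))"
  have F: "?F \<sigma> \<in> auts M (\<eta> ` ?K)" if "\<sigma> \<in> auts N ?K" for \<sigma> using conj_auts[OF M.ring_axioms \<eta> \<theta> inv K that] .
  have G: "?G \<tau> \<in> auts N ?K" if "\<tau> \<in> auts M (\<eta> ` ?K)" for \<tau>
    using conj_auts[OF N.ring_axioms \<theta> \<eta> inv(2,1) K' that] unfolding \<theta>K .
  have "?F \<in> iso (aut_group N ?K) (aut_group M (\<eta> ` ?K))"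
  proof (rule isoI)
    show "?F \<in> hom (aut_group N ?K) (aut_group M (\<eta> ` ?K))"
    proof (rule homI)
      fix \<sigma> \<tau> assume "\<sigma> \<in> carrier (aut_group N ?K)" "\<tau> \<in> carrier (aut_group N ?K)"
      then have st: "\<sigma> \<in> auts N ?K" "\<tau> \<in> auts N ?K" by simp_all
      have "?F (compose (carrier N) \<sigma> \<tau>) = compose (carrier M) (?F \<sigma>) (?F \<tau>)"
        unfolding compose_def
      proof (rule restrict_ext)
        fix y assume y: "y \<in> carrier M"
        have "\<tau> (\<theta> y) \<in> carrier N" using N.autsD(4)[OF st(2) \<theta>c[OF y]] .
        then show "\<eta> ((\<lambda>x\<in>carrier N. \<sigma> (\<tau> x)) (\<theta> y)) = ?F \<sigma> (?F \<tau> y)"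
          using y \<theta>c inv(1) by simp
      qed
      then show "?F (\<sigma> \<otimes>\<^bsub>aut_group N ?K\<^esub> \<tau>) = ?F \<sigma> \<otimes>\<^bsub>aut_group M (\<eta> ` ?K)\<^esub> ?F \<tau>"
        by (simp only: aut_group_simps(1)[OF st] aut_group_simps(1)[OF F[OF st(1)] F[OF st(2)]])
    qed (use F in simp)
    have "bij_betw ?F (auts N ?K) (auts M (\<eta> ` ?K))"
    proof (rule bij_betw_byWitness[where f' = ?G])
      show "\<forall>\<sigma>\<in>auts N ?K. ?G (?F \<sigma>) = \<sigma>"
      proof
        fix \<sigma> assume s: "\<sigma> \<in> auts N ?K"
        show "?G (?F \<sigma>) = \<sigma>"
          by (rule N.auts_eqI[OF G[OF F[OF s]] s]) (use inv N.autsD(4)[OF s] in simp)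
      qed
      show "\<forall>\<tau>\<in>auts M (\<eta> ` ?K). ?F (?G \<tau>) = \<tau>"
      proof
        fix \<tau> assume t: "\<tau> \<in> auts M (\<eta> ` ?K)"
        show "?F (?G \<tau>) = \<tau>"
          by (rule M.auts_eqI[OF F[OF G[OF t]] t]) (use inv M.autsD(4)[OF t] \<theta>c in simp)
      qed
    qed (use F G in blast)+
    then show "bij_betw ?F (carrier (aut_group N ?K)) (carrier (aut_group M (\<eta> ` ?K)))" by simp
  qed
  then show "Gal k N \<phi> \<cong> Gal L M \<iota>" unfolding Gal_eq im[symmetric] is_iso_def by blast
qed

text \<open>Lets a Galois group be exhibited on a field of any type, in particular on a tensor
  product.\<close>

lemma is_galois_group_overI:
  fixes k :: "('a, 'm) ring_scheme" and N :: "('b, 'n) ring_scheme"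
  assumes g: "finite_galois_extension k N \<phi>" and G: "finite_group G" "G \<cong> Gal k N \<phi>"
  shows "is_galois_group_over G k"
proof -
  have "finite_field_extension k N \<phi>" using g by (simp add: finite_galois_extension_iff)
  then obtain N' :: "'a list ring" and \<eta> where N': "\<eta> \<in> ring_iso N N'" "finite_field_extension k N' (\<eta> \<circ> \<phi>)"
    using finite_field_extension_on_lists by blast
  then have f: "field k" "field N'" "\<eta> \<circ> \<phi> \<in> ring_hom k N'" by (auto simp: finite_field_extension_def)
  note t = galois_transport[OF g f N'(1) image_comp]
  show ?thesis unfolding is_galois_group_over_def
    using G t(1) iso_trans[OF G(2) t(2)] by blast
qed

lemma is_galois_group_overD:
  assumes "is_galois_group_over G (k :: ('a, 'm) ring_scheme)"
  obtains N :: "'a list ring" and \<phi> where "finite_galois_extension k N \<phi>" "G \<cong> Gal k N \<phi>" "finite_group G"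
  using assms by (auto simp: is_galois_group_over_def)

text \<open>With \<open>Q\<close> the kernel and \<open>F\<close> its fixed field,
  \<open>artin\<close> is used at both levels: the restrictions exhaust the automorphisms of
  \<open>F\<close> over \<open>K\<close>, because their fixed points are \<open>K\<close>, and
  automorphisms trivial on \<open>F\<close> already lie in \<open>Q\<close>. So both
  \<open>G\<close> and the automorphism group of \<open>F\<close> are the quotient by
  \<open>Q\<close>.\<close>

lemma galois_quotient:
  fixes k :: "('a, 'm) ring_scheme"
  assumes G: "is_galois_group_over \<Gamma> k" and f: "f \<in> epi \<Gamma> G" and fG: "finite_group G"
  shows "is_galois_group_over G k"
proof -
  obtain N :: "'a list ring" and \<phi> where g: "finite_galois_extension k N \<phi>" and iso: "\<Gamma> \<cong> Gal k N \<phi>" and fin: "finite_group \<Gamma>"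
    using is_galois_group_overD[OF G] .
  have k: "field k" and N: "field N" and \<phi>: "\<phi> \<in> ring_hom k N"
    and fd: "ring.finite_dimension N (\<phi> ` carrier k) (carrier N)"
    and fp: "fixed_points N (auts N (\<phi> ` carrier k)) = \<phi> ` carrier k"
    using g by (auto simp: finite_galois_extension_iff finite_field_extension_def)
  interpret k: field k by fact
  interpret N: field N by fact
  interpret \<phi>: ring_hom_ring k N \<phi> using ring_hom_ringI2[OF k.ring_axioms N.ring_axioms \<phi>] .
  interpret \<Gamma>: group \<Gamma> using fin by (simp add: finite_group_def)
  interpret G: group G using fG by (simp add: finite_group_def)
  define K where "K = \<phi> ` carrier k"
  have Ksub: "subfield K N"
    using \<phi>.img_is_subfield(2)[OF k.carrier_is_subfield] N.one_not_zero by (simp add: K_def)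
  have KN: "K \<subseteq> carrier N" using subfieldE(3)[OF Ksub] .
  interpret A: group "aut_group N K" using N.group_aut_group[OF KN] .
  have finA: "finite (auts N K)" using N.finite_auts[OF Ksub] fd by (simp add: K_def)
  obtain \<theta> where \<theta>: "\<theta> \<in> iso (aut_group N K) \<Gamma>"
    using \<Gamma>.iso_sym[OF iso] by (auto simp: is_iso_def Gal_eq K_def)
  define h where "h = f \<circ> \<theta>"
  have hh: "h \<in> hom (aut_group N K) G"
    unfolding h_def by (rule Group.hom_compose) (use \<theta> f in \<open>auto simp: iso_def epi_def\<close>)
  have hs: "h ` carrier (aut_group N K) = carrier G"
    unfolding h_def image_comp[symmetric] using \<theta> f by (simp add: iso_def epi_def bij_betw_def)
  interpret h: group_hom "aut_group N K" G h
    using hh by (simp add: group_hom_def group_hom_axioms_def A.is_group G.is_group)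
  define Q where "Q = kernel (aut_group N K) G h"
  have QA: "Q \<subseteq> auts N K" by (auto simp: Q_def kernel_def)
  have Qcomp: "compose (carrier N) \<sigma> \<tau> \<in> Q" if st: "\<sigma> \<in> Q" "\<tau> \<in> Q" for \<sigma> \<tau>
  proof -
    have "\<sigma> \<otimes>\<^bsub>aut_group N K\<^esub> \<tau> \<in> Q" using subgroup.m_closed[OF h.subgroup_kernel] st by (simp add: Q_def)
    then show ?thesis unfolding aut_group_simps(1)[OF subsetD[OF QA st(1)] subsetD[OF QA st(2)]] .
  qed
  have Q0: "(\<lambda>x\<in>carrier N. x) \<in> Q"
    using subgroup.one_closed[OF h.subgroup_kernel] unfolding aut_group_simps(2) Q_def .
  define F where "F = fixed_points N Q"
  have FN: "F \<subseteq> carrier N" by (auto simp: F_def fixed_points_def)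
  have KF: "K \<subseteq> F" using KN QA by (auto simp: F_def fixed_points_def auts_def)
  have Fsub: "subfield F N"
  proof (rule N.subfieldI'[OF N.subringI])
    have Qhom: "ring_hom_ring N N q" if "q \<in> Q" for q
      using N.autsD(2)[of q K] QA that by (intro ring_hom_ringI2 N.ring_axioms) auto
    have fixF: "q x = x" if "q \<in> Q" "x \<in> F" for q x
      using that by (simp add: F_def fixed_points_def)
    have Qh: "q (x \<otimes>\<^bsub>N\<^esub> y) = q x \<otimes>\<^bsub>N\<^esub> q y" "q (x \<oplus>\<^bsub>N\<^esub> y) = q x \<oplus>\<^bsub>N\<^esub> q y" "q (\<ominus>\<^bsub>N\<^esub> x) = \<ominus>\<^bsub>N\<^esub> q x"
      if "q \<in> Q" "x \<in> carrier N" "y \<in> carrier N" for q x y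
    proof -
      interpret q: ring_hom_ring N N q using Qhom[OF that(1)] .
      show "q (x \<otimes>\<^bsub>N\<^esub> y) = q x \<otimes>\<^bsub>N\<^esub> q y" "q (x \<oplus>\<^bsub>N\<^esub> y) = q x \<oplus>\<^bsub>N\<^esub> q y" "q (\<ominus>\<^bsub>N\<^esub> x) = \<ominus>\<^bsub>N\<^esub> q x"
        using that by simp_all
    qed
    show "\<one>\<^bsub>N\<^esub> \<in> F" using KF subringE(3)[OF subfieldE(1)[OF Ksub]] by blast
    show "\<ominus>\<^bsub>N\<^esub> x \<in> F" if "x \<in> F" for x
    proof -
      have "q (\<ominus>\<^bsub>N\<^esub> x) = \<ominus>\<^bsub>N\<^esub> x" if q: "q \<in> Q" for q
        by (simp only: Qh(3)[OF q subsetD[OF FN \<open>x \<in> F\<close>] subsetD[OF FN \<open>x \<in> F\<close>]] fixF[OF q \<open>x \<in> F\<close>])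
      then show ?thesis using that by (simp add: F_def fixed_points_def)
    qed
    show "x \<otimes>\<^bsub>N\<^esub> y \<in> F" if "x \<in> F" "y \<in> F" for x y
    proof -
      have "q (x \<otimes>\<^bsub>N\<^esub> y) = x \<otimes>\<^bsub>N\<^esub> y" if q: "q \<in> Q" for q
        by (simp only: Qh(1)[OF q subsetD[OF FN \<open>x \<in> F\<close>] subsetD[OF FN \<open>y \<in> F\<close>]] fixF[OF q \<open>x \<in> F\<close>] fixF[OF q \<open>y \<in> F\<close>])
      then show ?thesis using that by (simp add: F_def fixed_points_def)
    qed
    show "x \<oplus>\<^bsub>N\<^esub> y \<in> F" if "x \<in> F" "y \<in> F" for x y
    proof -
      have "q (x \<oplus>\<^bsub>N\<^esub> y) = x \<oplus>\<^bsub>N\<^esub> y" if q: "q \<in> Q" for q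
        by (simp only: Qh(2)[OF q subsetD[OF FN \<open>x \<in> F\<close>] subsetD[OF FN \<open>y \<in> F\<close>]] fixF[OF q \<open>x \<in> F\<close>] fixF[OF q \<open>y \<in> F\<close>])
      then show ?thesis using that by (simp add: F_def fixed_points_def)
    qed
    show "inv\<^bsub>N\<^esub> x \<in> F" if x: "x \<in> F - {\<zero>\<^bsub>N\<^esub>}" for x
    proof -
      have xc: "x \<in> carrier N" "x \<in> Units N" using x FN N.field_Units by auto
      then have ic: "inv\<^bsub>N\<^esub> x \<in> carrier N" by simp
      have "q (inv\<^bsub>N\<^esub> x) = inv\<^bsub>N\<^esub> x" if q: "q \<in> Q" for q
      proof -
        interpret q: ring_hom_ring N N q using Qhom[OF q] .
        have qx: "q x = x" using x q by (simp add: F_def fixed_points_def)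
        have "inv\<^bsub>N\<^esub> x \<otimes>\<^bsub>N\<^esub> x = \<one>\<^bsub>N\<^esub>" using xc by simp
        then have "q (inv\<^bsub>N\<^esub> x \<otimes>\<^bsub>N\<^esub> x) = q \<one>\<^bsub>N\<^esub>" by (simp only:)
        then have "q (inv\<^bsub>N\<^esub> x) \<otimes>\<^bsub>N\<^esub> x = \<one>\<^bsub>N\<^esub>" unfolding q.hom_mult[OF ic xc(1)] qx q.hom_one .
        then show ?thesis using N.inv_unique[of "q (inv\<^bsub>N\<^esub> x)" x "inv\<^bsub>N\<^esub> x"] xc ic by simp
      qed
      with ic show ?thesis by (simp add: F_def fixed_points_def)
    qed
  qed (rule FN)
  define M where "M = N\<lparr>carrier := F\<rparr>"
  have Ms: "carrier M = F" "monoid.mult M = monoid.mult N" "ring.add M = ring.add N" "one M = one N" "ring.zero M = ring.zero N"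
    by (simp_all add: M_def)
  interpret M: field M using N.subfield_iff(2)[OF Fsub] by (simp add: M_def)
  have rh: "\<And>p. p \<in> ring_hom M M \<longleftrightarrow> (p \<in> F \<rightarrow> F \<and> (\<forall>x\<in>F. \<forall>y\<in>F. p (x \<otimes>\<^bsub>N\<^esub> y) = p x \<otimes>\<^bsub>N\<^esub> p y \<and> p (x \<oplus>\<^bsub>N\<^esub> y) = p x \<oplus>\<^bsub>N\<^esub> p y) \<and> p \<one>\<^bsub>N\<^esub> = \<one>\<^bsub>N\<^esub>)"
    by (auto simp: ring_hom_def Ms)
  have \<phi>M: "\<phi> \<in> ring_hom k M" using \<phi> KF by (auto simp: ring_hom_def Ms K_def)
  have Fclosed: "x \<otimes>\<^bsub>N\<^esub> y \<in> F" "x \<oplus>\<^bsub>N\<^esub> y \<in> F" if "x \<in> F" "y \<in> F" for x y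
    using M.m_closed[of x y] M.a_closed[of x y] that by (simp_all add: Ms)
  \<comment> \<open>If \<open>F\<close> were infinite dimensional over \<open>K\<close>, the
    inclusion of \<open>M\<close> into \<open>N\<close> would exhibit an infinite dimensional
    subalgebra of the finite dimensional \<open>N\<close>.\<close>
  have fdM: "M.finite_dimension K F"
  proof (rule ccontr)
    assume inf: "\<not> M.finite_dimension K F"
    have "(\<lambda>x. x) \<in> ring_hom M N" using FN by (auto simp: ring_hom_def Ms)
    then interpret i: ring_hom_ring M N "\<lambda>x. x" by (rule ring_hom_ringI2[OF M.ring_axioms N.ring_axioms])
    have "field (M\<lparr>carrier := K\<rparr>)" using N.subfield_iff(2)[OF Ksub] by (simp add: M_def)
    then have KM: "subfield K M" using M.subfield_iff(1) KF by (simp add: Ms)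
    have sM: "subalgebra K F M" using M.carrier_is_subalgebra[of K] KF by (simp add: Ms)
    have "\<not> N.finite_dimension K F"
      using i.infinite_dimension_hom[OF KM _ _ sM] inf N.one_not_zero by simp
    moreover have "subalgebra K F N"
    proof (intro subalgebra.intro subalgebra_axioms.intro)
      show "subgroup F (add_monoid N)" using subring.axioms(1)[OF subfieldE(1)[OF Fsub]] .
      show "k \<otimes>\<^bsub>N\<^esub> v \<in> F" if "k \<in> K" "v \<in> F" for k v using Fclosed(1) that KF by blast
    qed
    then have "N.finite_dimension K F"
      using N.subalbegra_incl_imp_finite_dimension[OF Ksub _ _ FN] fd by (simp add: K_def)
    ultimately show False by simp
  qed
  define res where "res = (\<lambda>\<sigma> :: 'a list \<Rightarrow> 'a list. restrict \<sigma> F)"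
  \<comment> \<open>\<open>Q\<close> is a kernel, hence normal: q \<sigma> = \<sigma> q' with q' in
    \<open>Q\<close>. So q fixes \<sigma> x whenever x lies in \<open>F\<close>.\<close>
  have stable: "\<sigma> x \<in> F" if s: "\<sigma> \<in> auts N K" and x: "x \<in> F" for \<sigma> x
  proof -
    have xc: "x \<in> carrier N" "\<sigma> x \<in> carrier N" using x FN N.autsD(4)[OF s] by auto
    have "q (\<sigma> x) = \<sigma> x" if q: "q \<in> Q" for q
    proof -
      have qA: "q \<in> carrier (aut_group N K)" "\<sigma> \<in> carrier (aut_group N K)" using q QA s by auto
      define q' where "q' = inv\<^bsub>aut_group N K\<^esub> \<sigma> \<otimes>\<^bsub>aut_group N K\<^esub> (q \<otimes>\<^bsub>aut_group N K\<^esub> \<sigma>)"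
      have q'A: "q' \<in> carrier (aut_group N K)" unfolding q'_def using A.m_closed A.inv_closed qA by blast
      have "h q = \<one>\<^bsub>G\<^esub>" using q by (simp add: Q_def kernel_def)
      then have "h q' = \<one>\<^bsub>G\<^esub>" unfolding q'_def using qA h.hom_closed[OF qA(2)]
        by (simp only: h.hom_mult h.hom_inv A.m_closed A.inv_closed G.l_one G.l_inv)
      then have q'Q: "q' \<in> Q" using q'A by (simp add: Q_def kernel_def)
      have "\<sigma> \<otimes>\<^bsub>aut_group N K\<^esub> q' = q \<otimes>\<^bsub>aut_group N K\<^esub> \<sigma>"
        unfolding q'_def using qA A.m_closed[OF qA] A.inv_closed[OF qA(2)]
        by (simp only: A.m_assoc[symmetric] A.r_inv A.l_one A.m_closed)
      then have "compose (carrier N) \<sigma> q' = compose (carrier N) q \<sigma>"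
        using aut_group_simps(1)[of \<sigma> N K q'] aut_group_simps(1)[of q N K \<sigma>] qA q'A by simp
      from fun_cong[OF this, of x] have "\<sigma> (q' x) = q (\<sigma> x)" using xc by (simp add: compose_eq)
      moreover have "q' x = x" using q'Q x by (simp add: F_def fixed_points_def)
      ultimately show ?thesis by simp
    qed
    then show ?thesis using xc by (simp add: F_def fixed_points_def)
  qed
  have res: "res \<sigma> \<in> auts M K" if s: "\<sigma> \<in> auts N K" for \<sigma>
  proof -
    define \<sigma>' where "\<sigma>' = (\<lambda>x\<in>carrier N. inv_into (carrier N) \<sigma> x)"
    have s': "\<sigma>' \<in> auts N K" using N.auts_inv[OF s KN] by (simp add: \<sigma>'_def)
    have b: "bij_betw \<sigma> (carrier N) (carrier N)" using N.autsD(5)[OF s] .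
    have "bij_betw \<sigma> F F"
    proof (rule bij_betw_byWitness[where f' = \<sigma>'])
      show "\<forall>x\<in>F. \<sigma>' (\<sigma> x) = x" using b FN N.autsD(4)[OF s] by (auto simp: \<sigma>'_def bij_betw_def)
      show "\<forall>x\<in>F. \<sigma> (\<sigma>' x) = x" using b FN by (auto simp: \<sigma>'_def bij_betw_def f_inv_into_f subset_iff)
    qed (use stable[OF s] stable[OF s'] in blast)+
    moreover have "res \<sigma> \<in> ring_hom M M"
    proof -
      note hom = N.autsD(2)[OF s]
      have "\<one>\<^bsub>N\<^esub> \<in> F" using M.one_closed by (simp add: Ms)
      then show ?thesis
        unfolding rh using stable[OF s] ring_hom_mult[OF hom] ring_hom_add[OF hom] ring_hom_one[OF hom] FN Fclosed
        by (simp add: res_def subset_iff)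
    qed
    ultimately show ?thesis using N.autsD(3)[OF s] KF by (auto simp: auts_def Bij_def Ms res_def)
  qed
  let ?R = "res ` auts N K"
  have fixR: "fixed_points M ?R = K"
  proof
    show "K \<subseteq> fixed_points M ?R" using KF by (auto simp: fixed_points_def Ms res_def auts_def)
    show "fixed_points M ?R \<subseteq> K"
    proof
      fix x assume x: "x \<in> fixed_points M ?R"
      then have xF: "x \<in> F" by (simp add: fixed_points_def Ms)
      then have "\<forall>\<sigma>\<in>auts N K. \<sigma> x = x" using x by (simp add: fixed_points_def res_def)
      then show "x \<in> K" using fp xF FN by (auto simp: fixed_points_def K_def)
    qed
  qed
  have res_comp: "res (compose (carrier N) \<sigma> \<tau>) = compose (carrier M) (res \<sigma>) (res \<tau>)" if "\<sigma> \<in> auts N K" "\<tau> \<in> auts N K" for \<sigma> \<tau>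
    unfolding res_def Ms compose_def
  proof (rule restrict_ext)
    fix x assume x: "x \<in> F"
    then show "(\<lambda>x\<in>carrier N. \<sigma> (\<tau> x)) x = restrict \<sigma> F (restrict \<tau> F x)"
      using FN stable[OF that(2) x] by auto
  qed
  have surj: "?R = auts M K"
  proof
    show "?R \<subseteq> auts M K" using res by blast
    show "auts M K \<subseteq> ?R"
    proof
      fix \<tau> assume t: "\<tau> \<in> auts M K"
      show "\<tau> \<in> ?R"
      proof (rule M.artin)
        show "finite ?R" using finA by simp
        show "?R \<noteq> {}" using N.id_auts[OF KN] by blast
        show "?R \<subseteq> auts M {}" using res M.auts_mono[of "{}" K] by blast
        show "compose (carrier M) \<sigma> \<rho> \<in> ?R" if "\<sigma> \<in> ?R" "\<rho> \<in> ?R" for \<sigma> \<rho>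
        proof -
          obtain \<sigma>' \<rho>' where sr: "\<sigma>' \<in> auts N K" "\<rho>' \<in> auts N K" "\<sigma> = res \<sigma>'" "\<rho> = res \<rho>'" using \<open>\<sigma> \<in> ?R\<close> \<open>\<rho> \<in> ?R\<close> by blast
          then show ?thesis using res_comp[OF sr(1,2)] N.auts_compose[OF sr(1,2) KN] by (metis imageI)
        qed
        show "\<tau> \<in> auts M (fixed_points M ?R)" using t by (simp add: fixR)
      qed
    qed
  qed
  have gM: "finite_galois_extension k M \<phi>"
  proof -
    have "fixed_points M (auts M K) = K" using fixR surj by simp
    then show ?thesis using k M.field_axioms \<phi>M fdM
      by (simp add: finite_galois_extension_iff finite_field_extension_def Ms flip: K_def)
  qed
  interpret AM: group "aut_group M K" using M.group_aut_group[of K] KF by (simp add: Ms)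
  have "res \<in> hom (aut_group N K) (aut_group M K)"
  proof (rule homI)
    fix \<sigma> \<tau> assume "\<sigma> \<in> carrier (aut_group N K)" "\<tau> \<in> carrier (aut_group N K)"
    then have st: "\<sigma> \<in> auts N K" "\<tau> \<in> auts N K" by simp_all
    show "res (\<sigma> \<otimes>\<^bsub>aut_group N K\<^esub> \<tau>) = res \<sigma> \<otimes>\<^bsub>aut_group M K\<^esub> res \<tau>"
      unfolding aut_group_simps(1)[OF st] aut_group_simps(1)[OF res[OF st(1)] res[OF st(2)]] by (rule res_comp[OF st])
  qed (use res in simp)
  then interpret r: group_hom "aut_group N K" "aut_group M K" res
    by (simp add: group_hom_def group_hom_axioms_def A.is_group AM.is_group)
  have "kernel (aut_group N K) (aut_group M K) res = Q"
  proof
    show "Q \<subseteq> kernel (aut_group N K) (aut_group M K) res"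
    proof
      fix \<sigma> assume s: "\<sigma> \<in> Q"
      have "res \<sigma> = (\<lambda>x\<in>carrier M. x)"
        unfolding res_def Ms by (rule restrict_ext) (use s in \<open>simp add: F_def fixed_points_def\<close>)
      then show "\<sigma> \<in> kernel (aut_group N K) (aut_group M K) res"
        using s QA unfolding kernel_def aut_group_simps(2) by auto
    qed
    show "kernel (aut_group N K) (aut_group M K) res \<subseteq> Q"
    proof
      fix \<sigma> assume "\<sigma> \<in> kernel (aut_group N K) (aut_group M K) res"
      then have s: "\<sigma> \<in> auts N K" and r: "res \<sigma> = (\<lambda>x\<in>carrier M. x)"
        unfolding kernel_def aut_group_simps(2) by auto
      have "\<sigma> x = x" if "x \<in> F" for x using fun_cong[OF r, of x] that by (simp add: res_def Ms)
      then have sF: "\<sigma> \<in> auts N F" using s by (simp add: auts_def)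
      show "\<sigma> \<in> Q"
      proof (rule N.artin[OF _ _ _ Qcomp])
        show "finite Q" using finite_subset[OF QA finA] .
        show "Q \<noteq> {}" using Q0 by blast
        show "Q \<subseteq> auts N {}" using QA N.auts_mono[of "{}" K] by blast
        show "\<sigma> \<in> auts N (fixed_points N Q)" using sF by (simp add: F_def)
      qed
    qed
  qed
  then have "(aut_group N K) Mod Q \<cong> aut_group M K" using r.FactGroup_iso surj by simp
  moreover have "(aut_group N K) Mod Q \<cong> G" using h.FactGroup_iso[OF hs] by (simp add: Q_def)
  then have "G \<cong> (aut_group N K) Mod Q"
    using group.iso_sym[OF normal.factorgroup_is_group[OF h.normal_kernel]] by (simp add: Q_def)
  ultimately have "G \<cong> aut_group M K" by (rule iso_trans[rotated])
  then have "G \<cong> Gal k M \<phi>" by (simp add: Gal_eq K_def)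
  then show ?thesis using is_galois_group_overI[OF gM fG] by blast
qed

text \<open>Whether automorphisms over \<open>K\<close> preserve the intermediate field
  \<open>E\<close> is not known in advance. Those that do include the automorphisms over
  \<open>E\<close>, which push the fixed points into \<open>E\<close>, and the extensions granted by
  the last hypothesis, which push them down to \<open>K\<close>. By \<open>artin\<close> they are
  then all the automorphisms over \<open>K\<close>, and normality follows from the stability of
  \<open>E\<close>.\<close>

lemma galois_tower:
  assumes gL: "finite_galois_extension k L \<psi>" and gM: "finite_galois_extension L M \<iota>"
    and ext: "\<And>\<sigma>. \<sigma> \<in> relative_auts k L \<psi> \<Longrightarrow> \<exists>\<sigma>'\<in>Bij (carrier M) \<inter> ring_hom M M. \<forall>y\<in>carrier L. \<sigma>' (\<iota> y) = \<iota> (\<sigma> y)"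
  shows "finite_galois_extension k M (\<iota> \<circ> \<psi>)" "finite_group (Gal k M (\<iota> \<circ> \<psi>))" "is_normal_subgroup_of (Gal L M \<iota>) (Gal k M (\<iota> \<circ> \<psi>))"
proof -
  have k: "field k" and L: "field L" and \<psi>: "\<psi> \<in> ring_hom k L"
    and fdL: "ring.finite_dimension L (\<psi> ` carrier k) (carrier L)"
    and fpL: "fixed_points L (auts L (\<psi> ` carrier k)) = \<psi> ` carrier k"
    using gL by (auto simp: finite_galois_extension_iff finite_field_extension_def)
  have M: "field M" and \<iota>: "\<iota> \<in> ring_hom L M"
    and fdM: "ring.finite_dimension M (\<iota> ` carrier L) (carrier M)"
    and fpM: "fixed_points M (auts M (\<iota> ` carrier L)) = \<iota> ` carrier L"
    using gM by (auto simp: finite_galois_extension_iff finite_field_extension_def)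
  interpret k: field k by fact
  interpret L: field L by fact
  interpret M: field M by fact
  interpret \<psi>: ring_hom_ring k L \<psi> using ring_hom_ringI2[OF k.ring_axioms L.ring_axioms \<psi>] .
  interpret \<iota>: ring_hom_ring L M \<iota> using ring_hom_ringI2[OF L.ring_axioms M.ring_axioms \<iota>] .
  define K where "K = \<iota> ` \<psi> ` carrier k"
  define E where "E = \<iota> ` carrier L"
  have k': "subfield (\<psi> ` carrier k) L"
    using \<psi>.img_is_subfield(2)[OF k.carrier_is_subfield] L.one_not_zero by simp
  have Esub: "subfield E M"
    using \<iota>.img_is_subfield(2)[OF L.carrier_is_subfield] M.one_not_zero by (simp add: E_def)
  have Ksub: "subfield K M"
    using \<iota>.img_is_subfield(2)[OF k'] M.one_not_zero by (simp add: K_def)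
  have KE: "K \<subseteq> E" using subfieldE(3)[OF k'] by (auto simp: K_def E_def)
  have EM: "E \<subseteq> carrier M" using subfieldE(3)[OF Esub] .
  have KM: "K \<subseteq> carrier M" using KE EM by blast
  have inj: "inj_on \<iota> (carrier L)"
    using L.field_axioms M.field_axioms \<iota>.img_is_subfield(1)[OF L.carrier_is_subfield] M.one_not_zero by simp
  obtain n where "L.dimension n (\<psi> ` carrier k) (carrier L)" using fdL by (auto simp: L.finite_dimension_def)
  then have "M.dimension n K E"
    using \<iota>.inj_hom_dimension[OF k' _ inj] M.one_not_zero by (simp add: K_def E_def)
  then have "M.finite_dimension K E" by (auto simp: M.finite_dimension_def)
  then have fd: "M.finite_dimension K (carrier M)"
    using M.telescopic_base_dim(1)[OF Ksub Esub] fdM by (simp add: E_def)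
  have fin: "finite (auts M K)" using M.finite_auts[OF Ksub fd] .
  define Q where "Q = {\<tau> \<in> auts M K. \<tau> ` E \<subseteq> E}"
  have fixQ: "fixed_points M Q = K"
  proof
    show "K \<subseteq> fixed_points M Q" using KM by (auto simp: fixed_points_def Q_def auts_def)
    show "fixed_points M Q \<subseteq> K"
    proof
      fix x assume x: "x \<in> fixed_points M Q"
      have "auts M E \<subseteq> Q" using M.auts_mono[OF KE] by (auto simp: Q_def auts_def)
      then have "x \<in> fixed_points M (auts M E)" using x by (auto simp: fixed_points_def)
      then have "x \<in> E" using fpM by (simp add: E_def)
      then obtain y where y: "y \<in> carrier L" "x = \<iota> y" by (auto simp: E_def)
      have "\<sigma> y = y" if s: "\<sigma> \<in> auts L (\<psi> ` carrier k)" for \<sigma>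
      proof -
        obtain \<sigma>' where s': "\<sigma>' \<in> Bij (carrier M)" "\<sigma>' \<in> ring_hom M M" "\<And>y. y \<in> carrier L \<Longrightarrow> \<sigma>' (\<iota> y) = \<iota> (\<sigma> y)"
          using ext[of \<sigma>] s by (auto simp: relative_auts_eq)
        have "\<sigma>' a = a" if "a \<in> K" for a
          using that s'(3) L.autsD(3)[OF s] subfieldE(3)[OF k'] by (auto simp: K_def subset_iff)
        moreover have "\<sigma>' ` E \<subseteq> E" using s'(3) L.autsD(4)[OF s] by (auto simp: E_def)
        ultimately have "\<sigma>' \<in> Q" using s' by (simp add: Q_def auts_def)
        then have "\<sigma>' x = x" using x by (simp add: fixed_points_def)
        then have "\<iota> (\<sigma> y) = \<iota> y" using s'(3)[OF y(1)] y(2) by metis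
        then show ?thesis using inj L.autsD(4)[OF s y(1)] y(1) by (auto simp: inj_on_def)
      qed
      then have "y \<in> \<psi> ` carrier k" using fpL y(1) by (auto simp: fixed_points_def)
      then show "x \<in> K" using y by (simp add: K_def)
    qed
  qed
  have stable: "\<tau> ` E \<subseteq> E" if t: "\<tau> \<in> auts M K" for \<tau>
  proof -
    have "\<tau> \<in> Q"
    proof (rule M.artin)
      show "finite Q" using fin by (simp add: Q_def)
      have "(\<lambda>x\<in>carrier M. x) \<in> Q" using M.id_auts[OF KM] EM by (auto simp: Q_def)
      then show "Q \<noteq> {}" by blast
      show "Q \<subseteq> auts M {}" using M.auts_mono[of "{}" K] by (auto simp: Q_def)
      show "compose (carrier M) \<sigma> \<rho> \<in> Q" if "\<sigma> \<in> Q" "\<rho> \<in> Q" for \<sigma> \<rho>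
      proof -
        have a: "\<sigma> \<in> auts M K" "\<rho> \<in> auts M K" "\<sigma> ` E \<subseteq> E" "\<rho> ` E \<subseteq> E" using that by (auto simp: Q_def)
        have "compose (carrier M) \<sigma> \<rho> x \<in> E" if "x \<in> E" for x using a(3,4) that EM by (auto simp: compose_def)
        then show ?thesis using M.auts_compose[OF a(1,2) KM] by (auto simp: Q_def)
      qed
      show "\<tau> \<in> auts M (fixed_points M Q)" using t by (simp add: fixQ)
    qed
    then show ?thesis by (simp add: Q_def)
  qed
  have QK: "Q = auts M K" using stable by (auto simp: Q_def)
  have ik: "(\<iota> \<circ> \<psi>) ` carrier k = K" by (simp add: K_def image_comp)
  show "finite_galois_extension k M (\<iota> \<circ> \<psi>)"
    unfolding finite_galois_extension_iff finite_field_extension_def ik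
    using fixQ[unfolded QK] ring_hom_trans[OF \<psi> \<iota>] fd k M by blast
  have gal: "Gal k M (\<iota> \<circ> \<psi>) = aut_group M K" "Gal L M \<iota> = aut_group M E" by (simp_all only: Gal_eq ik E_def)
  interpret A: group "aut_group M K" using M.group_aut_group[OF KM] .
  show "finite_group (Gal k M (\<iota> \<circ> \<psi>))" using fin A.is_group by (simp add: gal finite_group_def)
  have sub: "subgroup (auts M E) (aut_group M K)"
    using group.subgroup_incl[OF group_BijGroup M.subgroup_auts[OF EM] M.subgroup_auts[OF KM] M.auts_mono[OF KE]] .
  have "auts M E \<lhd> aut_group M K"
  proof (rule A.normal_invI[OF sub])
    fix \<tau> \<rho> assume t: "\<tau> \<in> carrier (aut_group M K)" and r: "\<rho> \<in> auts M E"
    have tA: "\<tau> \<in> auts M K" using t by simp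
    have rA: "\<rho> \<in> carrier (aut_group M K)" using r M.auts_mono[OF KE] by auto
    have "inv\<^bsub>aut_group M K\<^esub> \<tau> \<in> carrier (aut_group M K)" using t by (rule A.inv_closed)
    then have iA: "inv\<^bsub>aut_group M K\<^esub> \<tau> \<in> auts M K" by simp
    define c where "c = \<tau> \<otimes>\<^bsub>aut_group M K\<^esub> \<rho> \<otimes>\<^bsub>aut_group M K\<^esub> inv\<^bsub>aut_group M K\<^esub> \<tau>"
    have tr: "\<tau> \<otimes>\<^bsub>aut_group M K\<^esub> \<rho> \<in> auts M K" using A.m_closed[OF t rA] by simp
    have cA: "c \<in> auts M K" unfolding c_def using A.m_closed[OF A.m_closed[OF t rA] A.inv_closed[OF t]] by simp
    have ceq: "c = compose (carrier M) (compose (carrier M) \<tau> \<rho>) (inv\<^bsub>aut_group M K\<^esub> \<tau>)"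
      unfolding c_def aut_group_simps(1)[OF tr iA] using aut_group_simps(1)[OF tA] rA by simp
    \<comment> \<open>The inverse of \<tau> keeps y inside \<open>E\<close>, where \<rho> is the
      identity.\<close>
    have "c y = y" if y: "y \<in> E" for y
    proof -
      define y' where "y' = (inv\<^bsub>aut_group M K\<^esub> \<tau>) y"
      have y'E: "y' \<in> E" using stable[OF iA] y by (auto simp: y'_def)
      have yM: "y \<in> carrier M" "y' \<in> carrier M" using y y'E EM by auto
      have "compose (carrier M) \<tau> (inv\<^bsub>aut_group M K\<^esub> \<tau>) = (\<lambda>x\<in>carrier M. x)"
        using A.r_inv[OF t] unfolding aut_group_simps(1)[OF tA iA] aut_group_simps(2) .
      from fun_cong[OF this, of y] have ty: "\<tau> y' = y" using yM by (simp add: compose_eq y'_def)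
      have "c y = \<tau> (\<rho> y')" unfolding ceq using yM by (simp add: compose_eq y'_def)
      also have "\<rho> y' = y'" using M.autsD(3)[OF r y'E] .
      finally show ?thesis using ty by simp
    qed
    then have "c \<in> auts M E" using cA by (simp add: auts_def)
    then show "\<tau> \<otimes>\<^bsub>aut_group M K\<^esub> \<rho> \<otimes>\<^bsub>aut_group M K\<^esub> inv\<^bsub>aut_group M K\<^esub> \<tau> \<in> auts M E" by (simp add: c_def)
  qed
  moreover have "aut_group M E \<cong> (aut_group M K)\<lparr>carrier := auts M E\<rparr>" using iso_refl by simp
  ultimately show "is_normal_subgroup_of (Gal L M \<iota>) (Gal k M (\<iota> \<circ> \<psi>))"
    unfolding is_normal_subgroup_of_def gal by blast
qed

section \<open>Tensor products of fields\<close>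

locale tensor =
  fixes k :: "('a, 'l) ring_scheme" and E :: "('b, 'm) ring_scheme" and \<phi> :: "'a \<Rightarrow> 'b"
    and L :: "('c, 'n) ring_scheme" and \<psi> :: "'a \<Rightarrow> 'c"
  assumes k: "field k" and E: "field E" and L: "field L"
    and \<phi>: "\<phi> \<in> ring_hom k E" and \<psi>: "\<psi> \<in> ring_hom k L"
begin

sublocale k: field k by (rule k)
sublocale E: field E by (rule E)
sublocale L: field L by (rule L)
sublocale \<phi>: ring_hom_ring k E \<phi> by (rule ring_hom_ringI2[OF k.ring_axioms E.ring_axioms \<phi>])
sublocale \<psi>: ring_hom_ring k L \<psi> by (rule ring_hom_ringI2[OF k.ring_axioms L.ring_axioms \<psi>])

abbreviation "R \<equiv> tensor_pairs E L"
abbreviation "I \<equiv> tensor_ideal k E \<phi> L \<psi>"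
abbreviation "M \<equiv> tensor_product k E \<phi> L \<psi>"
abbreviation "\<iota> \<equiv> tensor_right k E \<phi> L \<psi>"

sublocale R: cring R by (rule cring_tensor_pairs[OF E.is_cring L.is_cring])

lemma R_simps:
  "c \<in> carrier R \<longleftrightarrow> Poly_Mapping.keys c \<subseteq> carrier E \<times> carrier L"
  "c \<oplus>\<^bsub>R\<^esub> d = c + d" "\<zero>\<^bsub>R\<^esub> = 0" "\<one>\<^bsub>R\<^esub> = frag_of (\<one>\<^bsub>E\<^esub>, \<one>\<^bsub>L\<^esub>)"
  by (simp_all add: tensor_pairs_def)

lemma frag_of_R: "x \<in> carrier E \<Longrightarrow> y \<in> carrier L \<Longrightarrow> frag_of (x, y) \<in> carrier R"
  by (simp add: R_simps)

lemma mult_frag_of: "frag_of (x, y) \<otimes>\<^bsub>R\<^esub> frag_of (x', y') = frag_of (x \<otimes>\<^bsub>E\<^esub> x', y \<otimes>\<^bsub>L\<^esub> y')"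
  by (simp add: tensor_pairs_def)

lemma minus_R: "c \<in> carrier R \<Longrightarrow> d \<in> carrier R \<Longrightarrow> c \<ominus>\<^bsub>R\<^esub> d = c - d" "c \<in> carrier R \<Longrightarrow> d \<in> carrier R \<Longrightarrow> c - d \<in> carrier R"
proof -
  assume c: "c \<in> carrier R" and d: "d \<in> carrier R"
  have md: "- d \<in> carrier R" using d by (simp add: R_simps)
  have "\<ominus>\<^bsub>R\<^esub> d = - d" using d md by (intro R.minus_equality) (simp_all add: R_simps(2,3))
  then have "c \<ominus>\<^bsub>R\<^esub> d = c - d" by (simp add: a_minus_def R_simps(2))
  moreover have "c \<ominus>\<^bsub>R\<^esub> d \<in> carrier R" using c d by (rule R.minus_closed)
  ultimately show "c \<ominus>\<^bsub>R\<^esub> d = c - d" "c - d \<in> carrier R" by auto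
qed

lemma R_induct [consumes 1, case_names zero one diff]:
  assumes c: "c \<in> carrier R" and z: "P 0" and o: "\<And>x y. x \<in> carrier E \<Longrightarrow> y \<in> carrier L \<Longrightarrow> P (frag_of (x, y))"
    and d: "\<And>a b. a \<in> carrier R \<Longrightarrow> b \<in> carrier R \<Longrightarrow> P a \<Longrightarrow> P b \<Longrightarrow> P (a - b)"
  shows "P c"
proof -
  have "c \<in> carrier R \<and> P c"
    using c[unfolded R_simps]
  proof (induction c rule: frag_induction)
    case zero
    show ?case using z R.zero_closed by (simp add: R_simps(3))
  next
    case (one p)
    then show ?case using o[of "fst p" "snd p"] frag_of_R[of "fst p" "snd p"] by (simp add: mem_Times_iff)
  next
    case (diff a b)
    then show ?case using d minus_R(2) by blast
  qed
  then show ?thesis by simp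
qed

text \<open>Both sides of the multiplicative law are biadditive and the pairs generate the additive
  group, so testing the law on pairs suffices.\<close>

lemma R_homI:
  assumes D: "ring S" and a: "h \<in> carrier R \<rightarrow> carrier S" "\<And>c d. c \<in> carrier R \<Longrightarrow> d \<in> carrier R \<Longrightarrow> h (c \<oplus>\<^bsub>R\<^esub> d) = h c \<oplus>\<^bsub>S\<^esub> h d"
    and m: "\<And>x y x' y'. x \<in> carrier E \<Longrightarrow> y \<in> carrier L \<Longrightarrow> x' \<in> carrier E \<Longrightarrow> y' \<in> carrier L \<Longrightarrow>
      h (frag_of (x \<otimes>\<^bsub>E\<^esub> x', y \<otimes>\<^bsub>L\<^esub> y')) = h (frag_of (x, y)) \<otimes>\<^bsub>S\<^esub> h (frag_of (x', y'))"
    and o: "h (frag_of (\<one>\<^bsub>E\<^esub>, \<one>\<^bsub>L\<^esub>)) = \<one>\<^bsub>S\<^esub>"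
  shows "h \<in> ring_hom R S"
proof -
  interpret S: ring S by fact
  have hc: "h c \<in> carrier S" if "c \<in> carrier R" for c using a(1) that by blast
  have h0: "h \<zero>\<^bsub>R\<^esub> = \<zero>\<^bsub>S\<^esub>"
    using a(2)[OF R.zero_closed R.zero_closed] hc[OF R.zero_closed] by (metis R.zero_closed R.l_zero S.add.l_cancel_one')
  have hd: "h (c \<ominus>\<^bsub>R\<^esub> d) = h c \<ominus>\<^bsub>S\<^esub> h d" if cd: "c \<in> carrier R" "d \<in> carrier R" for c d
  proof -
    have "h (c \<ominus>\<^bsub>R\<^esub> d) \<oplus>\<^bsub>S\<^esub> h d = h c"
      using a(2)[OF R.minus_closed[OF cd] cd(2)] cd by (simp add: a_minus_def R.a_assoc R.l_neg)
    then have "h c \<ominus>\<^bsub>S\<^esub> h d = h (c \<ominus>\<^bsub>R\<^esub> d) \<oplus>\<^bsub>S\<^esub> h d \<ominus>\<^bsub>S\<^esub> h d" by simp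
    also have "\<dots> = h (c \<ominus>\<^bsub>R\<^esub> d)" using hc[OF R.minus_closed[OF cd]] hc[OF cd(2)] by (simp add: a_minus_def S.a_assoc S.r_neg)
    finally show ?thesis by simp
  qed
  have "h (c \<otimes>\<^bsub>R\<^esub> d) = h c \<otimes>\<^bsub>S\<^esub> h d" if c: "c \<in> carrier R" and d: "d \<in> carrier R" for c d
    using c
  proof (induction c rule: R_induct)
    case zero
    show ?case unfolding R_simps(3)[symmetric] using h0 hc[OF d] d by simp
  next
    case (diff a b)
    have "h ((a \<ominus>\<^bsub>R\<^esub> b) \<otimes>\<^bsub>R\<^esub> d) = h ((a \<otimes>\<^bsub>R\<^esub> d) \<ominus>\<^bsub>R\<^esub> (b \<otimes>\<^bsub>R\<^esub> d))"
      using diff d by (simp add: a_minus_def R.l_distr R.l_minus)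
    also have "\<dots> = h a \<otimes>\<^bsub>S\<^esub> h d \<ominus>\<^bsub>S\<^esub> h b \<otimes>\<^bsub>S\<^esub> h d" using diff d hd by simp
    also have "\<dots> = h (a \<ominus>\<^bsub>R\<^esub> b) \<otimes>\<^bsub>S\<^esub> h d"
      unfolding hd[OF diff(1,2)] using hc diff(1,2) d by (simp add: a_minus_def S.l_distr S.l_minus)
    finally show ?case unfolding minus_R(1)[OF diff(1,2)] .
  next
    case xy: (one x y)
    show ?case using d
    proof (induction d rule: R_induct)
      case zero
      show ?case unfolding R_simps(3)[symmetric] using h0 hc[OF frag_of_R[OF xy]] frag_of_R[OF xy] by simp
    next
      case (one x' y')
      then show ?case using m xy by (simp add: mult_frag_of)
    next
      case (diff a b)
      note f = frag_of_R[OF xy]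
      have "h (frag_of (x, y) \<otimes>\<^bsub>R\<^esub> (a \<ominus>\<^bsub>R\<^esub> b)) = h ((frag_of (x, y) \<otimes>\<^bsub>R\<^esub> a) \<ominus>\<^bsub>R\<^esub> (frag_of (x, y) \<otimes>\<^bsub>R\<^esub> b))"
        using diff f by (simp add: a_minus_def R.r_distr R.r_minus)
      also have "\<dots> = h (frag_of (x, y)) \<otimes>\<^bsub>S\<^esub> h a \<ominus>\<^bsub>S\<^esub> h (frag_of (x, y)) \<otimes>\<^bsub>S\<^esub> h b" using diff f hd by simp
      also have "\<dots> = h (frag_of (x, y)) \<otimes>\<^bsub>S\<^esub> h (a \<ominus>\<^bsub>R\<^esub> b)"
        unfolding hd[OF diff(1,2)] using hc diff(1,2) f by (simp add: a_minus_def S.r_distr S.r_minus)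
      finally show ?case unfolding minus_R(1)[OF diff(1,2)] .
    qed
  qed
  then show ?thesis using hc a(2) o by (intro ring_hom_memI) (simp_all add: R_simps(4))
qed

lemma relations_carrier: "tensor_relations k E \<phi> L \<psi> \<subseteq> carrier R"
  unfolding tensor_relations_def
  by (auto intro!: minus_R(2) frag_of_R)

sublocale I: ideal I R
  unfolding tensor_ideal_def using R.genideal_ideal[OF relations_carrier] .

lemma M_eq: "M = R Quot I" by (simp add: tensor_product_def)

sublocale M: cring M unfolding M_eq by (rule I.quotient_is_cring[OF R.is_cring])

definition proj where "proj c = I +>\<^bsub>R\<^esub> c"

lemma proj_hom: "proj \<in> ring_hom R M"
  using I.rcos_ring_hom by (simp add: M_eq proj_def[abs_def])

sublocale proj: ring_hom_ring R M proj
  by (rule ring_hom_ringI2[OF R.ring_axioms M.ring_axioms proj_hom])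

lemma carrier_M: "carrier M = proj ` carrier R"
  by (auto simp: M_eq FactRing_def A_RCOSETS_def' proj_def)

lemma proj_eq: "c \<in> carrier R \<Longrightarrow> d \<in> carrier R \<Longrightarrow> proj c = proj d \<longleftrightarrow> c - d \<in> I"
  using R.quotient_eq_iff_same_a_r_cos[OF I.is_ideal, of c d] minus_R(1)[of c d] by (simp add: proj_def)

lemma \<iota>_eq: "\<iota> y = proj (frag_of (\<one>\<^bsub>E\<^esub>, y))" by (simp add: tensor_right_def proj_def)

lemma relation_I: "c \<in> tensor_relations k E \<phi> L \<psi> \<Longrightarrow> c \<in> I"
  using R.genideal_self[OF relations_carrier] by (auto simp: tensor_ideal_def)

lemma relation_cases:
  assumes "c \<in> tensor_relations k E \<phi> L \<psi>"
  obtains (left) x x' y where "c = frag_of (x \<oplus>\<^bsub>E\<^esub> x', y) - frag_of (x, y) - frag_of (x', y)"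
      "x \<in> carrier E" "x' \<in> carrier E" "y \<in> carrier L"
    | (right) x y y' where "c = frag_of (x, y \<oplus>\<^bsub>L\<^esub> y') - frag_of (x, y) - frag_of (x, y')"
      "x \<in> carrier E" "y \<in> carrier L" "y' \<in> carrier L"
    | (swap) a x y where "c = frag_of (\<phi> a \<otimes>\<^bsub>E\<^esub> x, y) - frag_of (x, \<psi> a \<otimes>\<^bsub>L\<^esub> y)"
      "a \<in> carrier k" "x \<in> carrier E" "y \<in> carrier L"
  using assms unfolding tensor_relations_def by blast

lemma relation_intros:
  "x \<in> carrier E \<Longrightarrow> x' \<in> carrier E \<Longrightarrow> y \<in> carrier L \<Longrightarrow>
    frag_of (x \<oplus>\<^bsub>E\<^esub> x', y) - frag_of (x, y) - frag_of (x', y) \<in> tensor_relations k E \<phi> L \<psi>"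
  "x \<in> carrier E \<Longrightarrow> y \<in> carrier L \<Longrightarrow> y' \<in> carrier L \<Longrightarrow>
    frag_of (x, y \<oplus>\<^bsub>L\<^esub> y') - frag_of (x, y) - frag_of (x, y') \<in> tensor_relations k E \<phi> L \<psi>"
  "a \<in> carrier k \<Longrightarrow> x \<in> carrier E \<Longrightarrow> y \<in> carrier L \<Longrightarrow>
    frag_of (\<phi> a \<otimes>\<^bsub>E\<^esub> x, y) - frag_of (x, \<psi> a \<otimes>\<^bsub>L\<^esub> y) \<in> tensor_relations k E \<phi> L \<psi>"
  unfolding tensor_relations_def by blast+

lemma ideal_minimal: "ideal J R \<Longrightarrow> tensor_relations k E \<phi> L \<psi> \<subseteq> J \<Longrightarrow> I \<subseteq> J"
  unfolding tensor_ideal_def by (rule R.genideal_minimal)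

lemma proj_add_left:
  assumes "x \<in> carrier E" "x' \<in> carrier E" "y \<in> carrier L"
  shows "proj (frag_of (x \<oplus>\<^bsub>E\<^esub> x', y)) = proj (frag_of (x, y)) \<oplus>\<^bsub>M\<^esub> proj (frag_of (x', y))"
proof -
  have "frag_of (x \<oplus>\<^bsub>E\<^esub> x', y) - frag_of (x, y) - frag_of (x', y) \<in> I"
    using assms by (intro relation_I relation_intros)
  then have "frag_of (x \<oplus>\<^bsub>E\<^esub> x', y) - (frag_of (x, y) \<oplus>\<^bsub>R\<^esub> frag_of (x', y)) \<in> I" by (simp add: R_simps(2) algebra_simps)
  then have "proj (frag_of (x \<oplus>\<^bsub>E\<^esub> x', y)) = proj (frag_of (x, y) \<oplus>\<^bsub>R\<^esub> frag_of (x', y))"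
    by (subst proj_eq) (use frag_of_R assms in simp_all)
  then show ?thesis using frag_of_R assms by simp
qed

lemma proj_add_right:
  assumes "x \<in> carrier E" "y \<in> carrier L" "y' \<in> carrier L"
  shows "proj (frag_of (x, y \<oplus>\<^bsub>L\<^esub> y')) = proj (frag_of (x, y)) \<oplus>\<^bsub>M\<^esub> proj (frag_of (x, y'))"
proof -
  have "frag_of (x, y \<oplus>\<^bsub>L\<^esub> y') - frag_of (x, y) - frag_of (x, y') \<in> I"
    using assms by (intro relation_I relation_intros)
  then have "frag_of (x, y \<oplus>\<^bsub>L\<^esub> y') - (frag_of (x, y) \<oplus>\<^bsub>R\<^esub> frag_of (x, y')) \<in> I" by (simp add: R_simps(2) algebra_simps)
  then have "proj (frag_of (x, y \<oplus>\<^bsub>L\<^esub> y')) = proj (frag_of (x, y) \<oplus>\<^bsub>R\<^esub> frag_of (x, y'))"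
    by (subst proj_eq) (use frag_of_R assms in simp_all)
  then show ?thesis using frag_of_R assms by simp
qed

lemma proj_swap:
  assumes "a \<in> carrier k" "x \<in> carrier E" "y \<in> carrier L"
  shows "proj (frag_of (\<phi> a \<otimes>\<^bsub>E\<^esub> x, y)) = proj (frag_of (x, \<psi> a \<otimes>\<^bsub>L\<^esub> y))"
proof -
  have "frag_of (\<phi> a \<otimes>\<^bsub>E\<^esub> x, y) - frag_of (x, \<psi> a \<otimes>\<^bsub>L\<^esub> y) \<in> I"
    using assms by (intro relation_I relation_intros)
  then show ?thesis using proj_eq frag_of_R assms by simp
qed

section \<open>Extending automorphisms through the second factor\<close>

definition twist :: "('c \<Rightarrow> 'c) \<Rightarrow> ('b \<times> 'c \<Rightarrow>\<^sub>0 int) \<Rightarrow> ('b \<times> 'c \<Rightarrow>\<^sub>0 int)" where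
  "twist \<sigma> c = frag_extend (\<lambda>(x, y). frag_of (x, \<sigma> y)) c"

lemma twist_simps: "twist \<sigma> (a - b) = twist \<sigma> a - twist \<sigma> b" "twist \<sigma> (a + b) = twist \<sigma> a + twist \<sigma> b"
  "twist \<sigma> (frag_of (x, y)) = frag_of (x, \<sigma> y)" "twist \<sigma> 0 = 0"
  by (simp_all add: twist_def frag_extend_diff frag_extend_add)

lemma twist_hom:
  assumes s: "\<sigma> \<in> ring_hom L L" shows "twist \<sigma> \<in> ring_hom R R"
proof (rule R_homI[OF R.ring_axioms])
  have sc: "\<And>y. y \<in> carrier L \<Longrightarrow> \<sigma> y \<in> carrier L" using ring_hom_closed[OF s] .
  show "twist \<sigma> \<in> carrier R \<rightarrow> carrier R"
  proof
    fix c assume "c \<in> carrier R"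
    then show "twist \<sigma> c \<in> carrier R"
    proof (induction c rule: R_induct)
      case zero
      show ?case using R.zero_closed by (simp add: twist_simps R_simps(3))
    qed (simp_all add: twist_simps minus_R(2) frag_of_R sc)
  qed
qed (use ring_hom_mult[OF s] ring_hom_one[OF s] in \<open>simp_all add: twist_simps R_simps(2) mult_frag_of R_simps(4)\<close>)

text \<open>The elements whose twist lies in \<open>I\<close> form the kernel of a ring
  homomorphism, hence an ideal. It contains the defining relations, so it contains the ideal that
  they generate.\<close>

lemma twist_I:
  assumes s: "\<sigma> \<in> relative_auts k L \<psi>" and c: "c \<in> I"
  shows "twist \<sigma> c \<in> I"
proof -
  have sh: "\<sigma> \<in> ring_hom L L" and sf: "\<And>a. a \<in> carrier k \<Longrightarrow> \<sigma> (\<psi> a) = \<psi> a" using s by (auto simp: relative_auts_def)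
  interpret t: ring_hom_ring R R "twist \<sigma>" by (rule ring_hom_ringI2[OF R.ring_axioms R.ring_axioms twist_hom[OF sh]])
  have ph: "proj \<circ> twist \<sigma> \<in> ring_hom R M" by (rule ring_hom_trans[OF twist_hom[OF sh] proj_hom])
  interpret pt: ring_hom_ring R M "proj \<circ> twist \<sigma>" by (rule ring_hom_ringI2[OF R.ring_axioms M.ring_axioms ph])
  have sc: "\<And>y. y \<in> carrier L \<Longrightarrow> \<sigma> y \<in> carrier L" using ring_hom_closed[OF sh] .
  have zero: "proj c = \<zero>\<^bsub>M\<^esub> \<longleftrightarrow> c \<in> I" if "c \<in> carrier R" for c
    using proj_eq[OF that R.zero_closed] unfolding proj.hom_zero by (simp add: R_simps(3))
  have ker: "a_kernel R M (proj \<circ> twist \<sigma>) = {c \<in> carrier R. twist \<sigma> c \<in> I}"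
    unfolding a_kernel_def' comp_def using zero[OF t.hom_closed] by (intro Collect_cong conj_cong) simp_all
  have "I \<subseteq> {c \<in> carrier R. twist \<sigma> c \<in> I}"
  proof (rule ideal_minimal)
    show "ideal {c \<in> carrier R. twist \<sigma> c \<in> I} R" using pt.kernel_is_ideal ker by simp
    show "tensor_relations k E \<phi> L \<psi> \<subseteq> {c \<in> carrier R. twist \<sigma> c \<in> I}"
    proof
      fix c assume c: "c \<in> tensor_relations k E \<phi> L \<psi>"
      have "twist \<sigma> c \<in> tensor_relations k E \<phi> L \<psi>"
        using c
      proof (cases rule: relation_cases)
        case (left x x' y)
        then show ?thesis using relation_intros(1)[of x x' "\<sigma> y"] sc by (simp add: twist_simps)
      next
        case (right x y y')
        then show ?thesis using relation_intros(2)[of x "\<sigma> y" "\<sigma> y'"] sc ring_hom_add[OF sh] by (simp add: twist_simps)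
      next
        \<comment> \<open>This relation moves scalars across the tensor sign, so here \<sigma> has
          to fix the image of \<open>k\<close>.\<close>
        case (swap a x y)
        then show ?thesis using relation_intros(3)[of a x "\<sigma> y"] sc sf ring_hom_mult[OF sh] by (simp add: twist_simps)
      qed
      then have "twist \<sigma> c \<in> I" by (rule relation_I)
      then show "c \<in> {c \<in> carrier R. twist \<sigma> c \<in> I}" using c relations_carrier by blast
    qed
  qed
  then show ?thesis using c by blast
qed

text \<open>By \<open>twist_I\<close> the twist descends to the quotient, and the twist by the
  inverse automorphism descends to its inverse.\<close>

lemma lift_aut:
  assumes s: "\<sigma> \<in> relative_auts k L \<psi>"
  shows "\<exists>\<sigma>'\<in>Bij (carrier M) \<inter> ring_hom M M. \<forall>y\<in>carrier L. \<sigma>' (\<iota> y) = \<iota> (\<sigma> y)"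
proof -
  define \<rho> where "\<rho> = (\<lambda>x\<in>carrier L. inv_into (carrier L) \<sigma> x)"
  have sa: "\<sigma> \<in> auts L (\<psi> ` carrier k)" using s by (simp add: relative_auts_eq)
  have ra: "\<rho> \<in> auts L (\<psi> ` carrier k)" unfolding \<rho>_def by (rule L.auts_inv[OF sa]) auto
  then have r: "\<rho> \<in> relative_auts k L \<psi>" by (simp add: relative_auts_eq)
  have sh: "\<sigma> \<in> ring_hom L L" "\<rho> \<in> ring_hom L L" using L.autsD(2)[OF sa] L.autsD(2)[OF ra] .
  have inv: "\<rho> (\<sigma> y) = y" "\<sigma> (\<rho> y) = y" if "y \<in> carrier L" for y
    using L.autsD(5)[OF sa] L.autsD(4)[OF sa] that by (auto simp: \<rho>_def bij_betw_def f_inv_into_f)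
  \<comment> \<open>The value is computed on a chosen representative; outside the carrier it is
    \<open>undefined\<close>, since \<open>Bij\<close> demands an extensional function.\<close>
  define lift where "lift = (\<lambda>\<tau> u. if u \<in> carrier M then proj (twist \<tau> (SOME c. c \<in> carrier R \<and> u = proj c)) else undefined)"
  have lift: "lift \<tau> (proj c) = proj (twist \<tau> c)" if t: "\<tau> \<in> relative_auts k L \<psi>" and c: "c \<in> carrier R" for \<tau> c
  proof -
    have th: "\<tau> \<in> ring_hom L L" using t by (simp add: relative_auts_def)
    define d where "d = (SOME d. d \<in> carrier R \<and> proj c = proj d)"
    have "d \<in> carrier R \<and> proj c = proj d" unfolding d_def by (rule someI[of _ c]) (simp add: c)
    then have d: "d \<in> carrier R" "d - c \<in> I" using proj_eq[of d c] c by auto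
    have "twist \<tau> d - twist \<tau> c \<in> I" using twist_I[OF t d(2)] by (simp add: twist_simps)
    then have "proj (twist \<tau> d) = proj (twist \<tau> c)"
      using proj_eq[OF ring_hom_closed[OF twist_hom[OF th] d(1)] ring_hom_closed[OF twist_hom[OF th] c]] by simp
    then show ?thesis using c by (simp add: lift_def d_def carrier_M)
  qed
  have lc: "lift \<tau> u \<in> carrier M" if t: "\<tau> \<in> relative_auts k L \<psi>" and u: "u \<in> carrier M" for \<tau> u
  proof -
    have th: "\<tau> \<in> ring_hom L L" using t by (simp add: relative_auts_def)
    obtain c where c: "c \<in> carrier R" "u = proj c" using u carrier_M by auto
    then show ?thesis using lift[OF t c(1)] ring_hom_closed[OF twist_hom[OF th] c(1)] carrier_M by auto
  qed
  have tw: "twist \<rho> (twist \<sigma> c) = c \<and> twist \<sigma> (twist \<rho> c) = c" if "c \<in> carrier R" for c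
    using that by (induction c rule: R_induct) (simp_all add: twist_simps inv)
  have ll: "lift \<rho> (lift \<sigma> u) = u" "lift \<sigma> (lift \<rho> u) = u" if u: "u \<in> carrier M" for u
  proof -
    obtain c where c: "c \<in> carrier R" "u = proj c" using u carrier_M by auto
    show "lift \<rho> (lift \<sigma> u) = u" "lift \<sigma> (lift \<rho> u) = u"
      using lift[OF s c(1)] lift[OF r c(1)] lift[OF r ring_hom_closed[OF twist_hom[OF sh(1)] c(1)]]
        lift[OF s ring_hom_closed[OF twist_hom[OF sh(2)] c(1)]] tw[OF c(1)] c(2) by simp_all
  qed
  have "bij_betw (lift \<sigma>) (carrier M) (carrier M)"
    by (rule bij_betw_byWitness[where f' = "lift \<rho>"]) (intro ballI image_subsetI ll lc[OF s] lc[OF r]; assumption)+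
  then have "lift \<sigma> \<in> Bij (carrier M)" by (simp add: Bij_def lift_def extensional_def)
  moreover have "lift \<sigma> \<in> ring_hom M M"
  proof (rule ring_hom_memI)
    note th = twist_hom[OF sh(1)]
    show "lift \<sigma> u \<in> carrier M" if "u \<in> carrier M" for u using lc[OF s that] .
    fix u v assume "u \<in> carrier M" "v \<in> carrier M"
    then obtain c d where c: "c \<in> carrier R" "u = proj c" and d: "d \<in> carrier R" "v = proj d" using carrier_M by auto
    have cl: "twist \<sigma> c \<in> carrier R" "twist \<sigma> d \<in> carrier R" using ring_hom_closed[OF th] c d by auto
    show "lift \<sigma> (u \<otimes>\<^bsub>M\<^esub> v) = lift \<sigma> u \<otimes>\<^bsub>M\<^esub> lift \<sigma> v"
      using lift[OF s c(1)] lift[OF s d(1)] lift[OF s R.m_closed[OF c(1) d(1)]] ring_hom_mult[OF th c(1) d(1)]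
        proj.hom_mult[OF c(1) d(1)] proj.hom_mult[OF cl] c(2) d(2) by simp
    show "lift \<sigma> (u \<oplus>\<^bsub>M\<^esub> v) = lift \<sigma> u \<oplus>\<^bsub>M\<^esub> lift \<sigma> v"
      using lift[OF s c(1)] lift[OF s d(1)] lift[OF s R.a_closed[OF c(1) d(1)]] ring_hom_add[OF th c(1) d(1)]
        proj.hom_add[OF c(1) d(1)] proj.hom_add[OF cl] c(2) d(2) by simp
  next
    show "lift \<sigma> \<one>\<^bsub>M\<^esub> = \<one>\<^bsub>M\<^esub>"
      using lift[OF s R.one_closed] ring_hom_one[OF twist_hom[OF sh(1)]] proj.hom_one by simp
  qed
  moreover have "lift \<sigma> (\<iota> y) = \<iota> (\<sigma> y)" if "y \<in> carrier L" for y
    using lift[OF s frag_of_R[OF E.one_closed that]] by (simp add: \<iota>_eq twist_simps)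
  ultimately show ?thesis by blast
qed

lemma \<iota>_hom: "\<iota> \<in> ring_hom L M"
proof (rule ring_hom_memI)
  show "\<iota> \<one>\<^bsub>L\<^esub> = \<one>\<^bsub>M\<^esub>" using proj.hom_one by (simp add: \<iota>_eq R_simps(4))
  fix x y assume xy: "x \<in> carrier L" "y \<in> carrier L"
  show "\<iota> x \<in> carrier M" using xy frag_of_R by (simp add: \<iota>_eq)
  show "\<iota> (x \<otimes>\<^bsub>L\<^esub> y) = \<iota> x \<otimes>\<^bsub>M\<^esub> \<iota> y"
    using proj.hom_mult[OF frag_of_R frag_of_R, OF E.one_closed xy(1) E.one_closed xy(2)]
    by (simp add: \<iota>_eq mult_frag_of)
  show "\<iota> (x \<oplus>\<^bsub>L\<^esub> y) = \<iota> x \<oplus>\<^bsub>M\<^esub> \<iota> y" using proj_add_right xy by (simp add: \<iota>_eq)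
qed

text \<open>When \<psi> is bijective, every y in \<open>L\<close> comes from a scalar, which can be
  moved to the left factor; this gives surjectivity. Multiplication back into \<open>E\<close> is a
  left inverse, which gives injectivity.\<close>

lemma trivial_tensor:
  assumes bij: "bij_betw \<psi> (carrier k) (carrier L)"
  shows "(\<lambda>x. proj (frag_of (x, \<one>\<^bsub>L\<^esub>))) \<in> ring_iso E M" (is "?\<eta> \<in> _")
    and "(\<lambda>x. proj (frag_of (x, \<one>\<^bsub>L\<^esub>))) ` \<phi> ` carrier k = \<iota> ` carrier L"
proof -
  define \<chi> where "\<chi> = inv_into (carrier k) \<psi>"
  have \<chi>: "\<chi> y \<in> carrier k" "\<psi> (\<chi> y) = y" if "y \<in> carrier L" for y
    using bij that by (auto simp: \<chi>_def bij_betw_def inv_into_into f_inv_into_f)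
  have \<chi>\<psi>: "\<chi> (\<psi> a) = a" if "a \<in> carrier k" for a using bij that by (simp add: \<chi>_def bij_betw_def)
  have \<chi>h: "\<chi> \<in> ring_hom L k"
    using ring_iso_set_sym[OF k.ring_axioms, of \<psi> L] bij \<psi> by (simp add: ring_iso_def \<chi>_def)
  have hom: "?\<eta> \<in> ring_hom E M"
  proof (rule ring_hom_memI)
    show "?\<eta> \<one>\<^bsub>E\<^esub> = \<one>\<^bsub>M\<^esub>" using proj.hom_one by (simp add: R_simps(4))
    fix x y assume xy: "x \<in> carrier E" "y \<in> carrier E"
    show "?\<eta> x \<in> carrier M" using xy frag_of_R by simp
    show "?\<eta> (x \<otimes>\<^bsub>E\<^esub> y) = ?\<eta> x \<otimes>\<^bsub>M\<^esub> ?\<eta> y"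
      using proj.hom_mult[OF frag_of_R frag_of_R, OF xy(1) L.one_closed xy(2) L.one_closed] by (simp add: mult_frag_of)
    show "?\<eta> (x \<oplus>\<^bsub>E\<^esub> y) = ?\<eta> x \<oplus>\<^bsub>M\<^esub> ?\<eta> y" using proj_add_left xy by simp
  qed
  interpret \<eta>: ring_hom_ring E M ?\<eta> by (rule ring_hom_ringI2[OF E.ring_axioms M.ring_axioms hom])
  have surj: "\<exists>x\<in>carrier E. proj c = ?\<eta> x" if "c \<in> carrier R" for c
    using that
  proof (induction c rule: R_induct)
    case zero
    show ?case using proj.hom_zero \<eta>.hom_zero by (intro bexI[of _ "\<zero>\<^bsub>E\<^esub>"]) (simp_all add: R_simps(3))
  next
    case (one x y)
    have "proj (frag_of (x, y)) = ?\<eta> (\<phi> (\<chi> y) \<otimes>\<^bsub>E\<^esub> x)"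
      using proj_swap[OF \<chi>(1)[OF one(2)] one(1) L.one_closed] \<chi>[OF one(2)] one by simp
    then show ?case using \<chi>(1)[OF one(2)] one(1) by (intro bexI[of _ "\<phi> (\<chi> y) \<otimes>\<^bsub>E\<^esub> x"]) simp_all
  next
    case (diff a b)
    then obtain x x' where x: "x \<in> carrier E" "proj a = ?\<eta> x" "x' \<in> carrier E" "proj b = ?\<eta> x'" by blast
    have "proj (a \<ominus>\<^bsub>R\<^esub> b) = ?\<eta> (x \<ominus>\<^bsub>E\<^esub> x')"
      using diff(1,2) x by (simp add: a_minus_def)
    then show ?case using x E.minus_closed unfolding minus_R(1)[OF diff(1,2)] by blast
  qed
  define S where "S = carrier E \<times> carrier L"
  \<comment> \<open>The multiplication map on pairs, with y read in \<open>E\<close> through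
    \<open>k\<close>. Its additive extension h exists because \<open>R\<close> is additively free on
    the pairs, and it vanishes on the relations and hence on \<open>I\<close>.\<close>
  define f where "f = (\<lambda>p. fst p \<otimes>\<^bsub>E\<^esub> \<phi> (\<chi> (snd p)))"
  have fS: "f ` S \<subseteq> carrier (add_monoid E)" using \<chi>(1) by (auto simp: f_def S_def)
  obtain h where h: "h \<in> hom (free_Abelian_group S) (add_monoid E)" "\<And>p. p \<in> S \<Longrightarrow> h (frag_of p) = f p"
    using comm_group.free_Abelian_group_universal[OF E.a_comm_group fS] by blast
  have hf: "h (frag_of (x, y)) = x \<otimes>\<^bsub>E\<^esub> \<phi> (\<chi> y)" if "x \<in> carrier E" "y \<in> carrier L" for x y
    using h(2)[of "(x, y)"] that by (simp add: S_def f_def)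
  have hR: "h \<in> ring_hom R E"
  proof (rule R_homI[OF E.ring_axioms])
    show "h \<in> carrier R \<rightarrow> carrier E" using h(1) by (auto simp: hom_def R_simps(1) S_def)
    show "h (c \<oplus>\<^bsub>R\<^esub> d) = h c \<oplus>\<^bsub>E\<^esub> h d" if "c \<in> carrier R" "d \<in> carrier R" for c d
      using hom_mult[OF h(1), of c d] that by (simp add: R_simps(1,2) S_def)
    show "h (frag_of (\<one>\<^bsub>E\<^esub>, \<one>\<^bsub>L\<^esub>)) = \<one>\<^bsub>E\<^esub>" using hf ring_hom_one[OF \<chi>h] by simp
    show "h (frag_of (x \<otimes>\<^bsub>E\<^esub> x', y \<otimes>\<^bsub>L\<^esub> y')) = h (frag_of (x, y)) \<otimes>\<^bsub>E\<^esub> h (frag_of (x', y'))"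
      if "x \<in> carrier E" "y \<in> carrier L" "x' \<in> carrier E" "y' \<in> carrier L" for x y x' y'
      using that \<chi>(1) by (simp add: hf ring_hom_mult[OF \<chi>h] E.m_ac)
  qed
  interpret h: ring_hom_ring R E h by (rule ring_hom_ringI2[OF R.ring_axioms E.ring_axioms hR])
  have hd: "h (c - d) = h c \<ominus>\<^bsub>E\<^esub> h d" if "c \<in> carrier R" "d \<in> carrier R" for c d
    unfolding minus_R(1)[OF that, symmetric] using that by (simp add: a_minus_def)
  have cancel: "u \<oplus>\<^bsub>E\<^esub> v \<ominus>\<^bsub>E\<^esub> u \<ominus>\<^bsub>E\<^esub> v = \<zero>\<^bsub>E\<^esub>" if "u \<in> carrier E" "v \<in> carrier E" for u v
  proof -
    have "u \<oplus>\<^bsub>E\<^esub> v \<ominus>\<^bsub>E\<^esub> u = v" using that by (simp add: E.a_comm[of u v] a_minus_def E.a_assoc E.r_neg)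
    then show ?thesis using that by (simp add: a_minus_def E.r_neg)
  qed
  have "tensor_relations k E \<phi> L \<psi> \<subseteq> a_kernel R E h"
  proof
    fix c assume c: "c \<in> tensor_relations k E \<phi> L \<psi>"
    have "h c = \<zero>\<^bsub>E\<^esub>"
      using c
    proof (cases rule: relation_cases)
      case (left x x' y)
      then show ?thesis using \<chi>(1)[of y] by (simp add: hd hf frag_of_R minus_R(2) E.l_distr cancel)
    next
      case (right x y y')
      then show ?thesis using \<chi>(1)[of y] \<chi>(1)[of y']
        by (simp add: hd hf frag_of_R minus_R(2) ring_hom_add[OF \<chi>h] E.r_distr cancel)
    next
      case (swap a x y)
      then show ?thesis using \<chi>(1)[of y]
        by (simp add: hd hf frag_of_R ring_hom_mult[OF \<chi>h] \<chi>\<psi> a_minus_def E.m_ac E.r_neg)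
    qed
    with subsetD[OF relations_carrier c] show "c \<in> a_kernel R E h" unfolding a_kernel_def' by (intro CollectI conjI)
  qed
  then have Ik: "I \<subseteq> a_kernel R E h" by (rule ideal_minimal[OF h.kernel_is_ideal])
  have "inj_on ?\<eta> (carrier E)"
  proof (rule inj_onI)
    fix x x' assume x: "x \<in> carrier E" "x' \<in> carrier E" and eq: "?\<eta> x = ?\<eta> x'"
    have "frag_of (x, \<one>\<^bsub>L\<^esub>) - frag_of (x', \<one>\<^bsub>L\<^esub>) \<in> I"
      using eq proj_eq[OF frag_of_R[OF x(1) L.one_closed] frag_of_R[OF x(2) L.one_closed]] by simp
    then have "h (frag_of (x, \<one>\<^bsub>L\<^esub>) - frag_of (x', \<one>\<^bsub>L\<^esub>)) = \<zero>\<^bsub>E\<^esub>" by (rule subsetD[OF Ik, unfolded a_kernel_def', THEN CollectD, THEN conjunct2])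
    then have "x \<ominus>\<^bsub>E\<^esub> x' = \<zero>\<^bsub>E\<^esub>" using x ring_hom_one[OF \<chi>h] by (simp add: hd hf frag_of_R)
    then show "x = x'" using x by (simp add: E.r_right_minus_eq)
  qed
  moreover have "?\<eta> ` carrier E = carrier M"
  proof
    show "?\<eta> ` carrier E \<subseteq> carrier M" using ring_hom_closed[OF hom] by (rule image_subsetI)
    show "carrier M \<subseteq> ?\<eta> ` carrier E" unfolding carrier_M
    proof (rule image_subsetI)
      fix c assume c: "c \<in> carrier R"
      from surj[OF c] obtain x where "x \<in> carrier E" "proj c = ?\<eta> x" by (rule bexE)
      then show "proj c \<in> ?\<eta> ` carrier E" by (rule rev_image_eqI)
    qed
  qed
  ultimately show "?\<eta> \<in> ring_iso E M" using hom by (simp add: ring_iso_def bij_betw_def)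
  have \<eta>\<phi>: "?\<eta> (\<phi> a) = \<iota> (\<psi> a)" if "a \<in> carrier k" for a
    using proj_swap[OF that E.one_closed L.one_closed] that by (simp add: \<iota>_eq)
  have "?\<eta> ` \<phi> ` carrier k = (\<lambda>a. ?\<eta> (\<phi> a)) ` carrier k" by (rule image_image)
  also have "\<dots> = (\<lambda>a. \<iota> (\<psi> a)) ` carrier k" by (rule image_cong[OF refl \<eta>\<phi>])
  also have "\<dots> = \<iota> ` \<psi> ` carrier k" by (rule image_image[symmetric])
  also have "\<psi> ` carrier k = carrier L" using bij by (rule bij_betw_imp_surj_on)
  finally show "?\<eta> ` \<phi> ` carrier k = \<iota> ` carrier L" .
qed

end

section \<open>Pre-Galois groups\<close>

lemma galois_imp_pre_galois:
  fixes k :: "('a, 'm) ring_scheme"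
  assumes "is_galois_group_over G k"
  shows "is_pre_galois_group_over G k"
proof -
  obtain N :: "'a list ring" and \<phi> where g: "finite_galois_extension k N \<phi>" and iso: "G \<cong> Gal k N \<phi>"
    and fin: "finite_group G"
    using is_galois_group_overD[OF assms] .
  have ext: "finite_field_extension k N \<phi>" using g by (simp add: finite_galois_extension_def)
  then have k: "field k" and N: "field N" and \<phi>: "\<phi> \<in> ring_hom k N"
    by (simp_all add: finite_field_extension_def)
  interpret k: field k by (rule k)
  \<comment> \<open>A copy of \<open>k\<close> on singleton lists, because the definition asks for a
    field on \<open>'a list\<close>. Over it the base change of \<open>N\<close> is \<open>N\<close>
    again by \<open>trivial_tensor\<close>.\<close>
  define \<psi> :: "'a \<Rightarrow> 'a list" where "\<psi> = (\<lambda>a. [a])"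
  define L where "L = image_ring \<psi> k"
  have inj: "inj_on \<psi> (carrier k)" by (simp add: \<psi>_def inj_on_def)
  have L: "field L" unfolding L_def using k.inj_imp_image_ring_is_field[OF inj] .
  have "\<psi> \<in> ring_iso k L" unfolding L_def using inj_imp_image_ring_iso[OF inj] .
  then have \<psi>: "\<psi> \<in> ring_hom k L" and bij: "bij_betw \<psi> (carrier k) (carrier L)" by (simp_all add: ring_iso_def)
  have im: "\<psi> ` carrier k = carrier L" using bij by (rule bij_betw_imp_surj_on)
  interpret T: tensor k N \<phi> L \<psi> by (rule tensor.intro[OF k N L \<phi> \<psi>])
  have "ring.finite_dimension L (\<psi> ` carrier k) (carrier L)"
    unfolding im using T.L.finite_dimensionI[OF T.L.dimension_one[OF T.L.carrier_is_subfield]] .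
  then have "finite_field_extension k L \<psi>" using k L \<psi> by (simp add: finite_field_extension_def)
  moreover have "{x \<in> carrier L. \<forall>\<sigma> \<in> relative_auts k L \<psi>. \<sigma> x = x} = \<psi> ` carrier k"
  proof
    show "{x \<in> carrier L. \<forall>\<sigma> \<in> relative_auts k L \<psi>. \<sigma> x = x} \<subseteq> \<psi> ` carrier k" unfolding im by (rule Collect_restrict)
    show "\<psi> ` carrier k \<subseteq> {x \<in> carrier L. \<forall>\<sigma> \<in> relative_auts k L \<psi>. \<sigma> x = x}"
      by (rule image_subsetI) (simp add: relative_auts_def)
  qed
  ultimately have gL: "finite_galois_extension k L \<psi>" by (simp add: finite_galois_extension_def)
  note \<eta> = T.trivial_tensor[OF bij]
  interpret \<eta>: ring_hom_ring N T.M "\<lambda>x. T.proj (frag_of (x, \<one>\<^bsub>L\<^esub>))"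
    using \<eta>(1) by (intro ring_hom_ringI2 T.E.ring_axioms T.M.ring_axioms) (simp add: ring_iso_def)
  have M: "field T.M"
    using field.ring_iso_imp_img_field[OF N \<eta>(1)] unfolding \<eta>.hom_one \<eta>.hom_zero by simp
  note t = galois_transport[OF g L M T.\<iota>_hom \<eta>]
  show ?thesis
    unfolding is_pre_galois_group_over_def pre_galois_extension_def
    using fin ext gL t(1) iso_trans[OF iso t(2)] by blast
qed

text \<open>\<open>lift_aut\<close> supplies exactly the extension hypothesis of
  \<open>galois_tower\<close>. The resulting Galois group consists of functions and is replaced by a
  copy on the natural numbers.\<close>

lemma pre_galois_imp_normal_in_galois:
  fixes k :: "('a, 'm) ring_scheme"
  assumes "is_pre_galois_group_over G k"
  shows "\<exists>\<Gamma> :: nat monoid. is_galois_group_over \<Gamma> k \<and> is_normal_subgroup_of G \<Gamma>"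
proof -
  obtain E :: "'a list ring" and \<phi> where E: "pre_galois_extension k E \<phi> G"
    using assms by (auto simp: is_pre_galois_group_over_def)
  then obtain L :: "'a list ring" and \<psi> where gL: "finite_galois_extension k L \<psi>"
    and gM: "finite_galois_extension L (tensor_product k E \<phi> L \<psi>) (tensor_right k E \<phi> L \<psi>)"
    and iso: "G \<cong> Gal L (tensor_product k E \<phi> L \<psi>) (tensor_right k E \<phi> L \<psi>)"
    by (auto simp: pre_galois_extension_def)
  interpret T: tensor k E \<phi> L \<psi>
    using E gL by (simp add: tensor_def pre_galois_extension_def finite_galois_extension_def finite_field_extension_def)
  note tower = galois_tower[OF gL gM T.lift_aut]
  let ?\<Delta> = "Gal k T.M (T.\<iota> \<circ> \<psi>)"
  have gr: "group ?\<Delta>" using tower(2) by (simp add: finite_group_def)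
  obtain \<Gamma> :: "nat monoid" where \<Gamma>: "finite_group \<Gamma>" "?\<Delta> \<cong> \<Gamma>"
    using finite_group_on_nat[OF tower(2)] by blast
  have "is_galois_group_over \<Gamma> k"
    using is_galois_group_overI[OF tower(1) \<Gamma>(1) group.iso_sym[OF gr \<Gamma>(2)]] .
  moreover obtain H where "H \<lhd> ?\<Delta>" "Gal L T.M T.\<iota> \<cong> ?\<Delta>\<lparr>carrier := H\<rparr>"
    using tower(3) unfolding is_normal_subgroup_of_def by blast
  then have "is_normal_subgroup_of G ?\<Delta>"
    unfolding is_normal_subgroup_of_def using iso_trans[OF iso] by blast
  then have "is_normal_subgroup_of G \<Gamma>"
    using is_normal_subgroup_of_iso[OF _ gr] \<Gamma> unfolding finite_group_def is_iso_def by blast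
  ultimately show ?thesis by blast
qed

section \<open>The equivalences\<close>

theorem corollary2p11:
  fixes k :: "('a, 'm) ring_scheme"
  assumes "field k"
  shows
    "((\<forall>G :: nat monoid. finite_group G \<longrightarrow> is_galois_group_over G k) \<longleftrightarrow>
      (\<forall>G :: nat monoid. finite_group G \<longrightarrow> is_pre_galois_group_over G k)) \<and>
     ((\<forall>G :: nat monoid. finite_group G \<longrightarrow> is_pre_galois_group_over G k) \<longleftrightarrow>
      (\<forall>G :: nat monoid. finite_group G \<longrightarrow>
         (\<exists>\<Gamma> :: nat monoid. is_galois_group_over \<Gamma> k \<and> is_normal_subgroup_of G \<Gamma>))) \<and>
     ((\<forall>G :: nat monoid. finite_group G \<longrightarrow>
         (\<exists>\<Gamma> :: nat monoid. is_galois_group_over \<Gamma> k \<and> is_normal_subgroup_of G \<Gamma>)) \<longleftrightarrow>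
      (\<forall>G :: nat monoid. finite_group G \<and> complete_group G \<longrightarrow>
         (\<exists>\<Gamma> :: nat monoid. is_galois_group_over \<Gamma> k \<and> is_normal_subgroup_of G \<Gamma>)))"
    (is "(?i \<longleftrightarrow> ?ii) \<and> (?ii \<longleftrightarrow> ?iii) \<and> (?iii \<longleftrightarrow> ?iv)")
proof -
  have "?i \<Longrightarrow> ?ii" using galois_imp_pre_galois by blast
  moreover have "?ii \<Longrightarrow> ?iii" using pre_galois_imp_normal_in_galois by blast
  moreover have "?iii \<Longrightarrow> ?iv" by blast
  moreover have ?i if iv: ?iv
  proof (intro allI impI)
    fix G :: "nat monoid" assume G: "finite_group G"
    obtain H :: "nat monoid" and f where H: "finite_group H" "complete_group H" "f \<in> epi H G"
      using complete_group_cover[OF G] by blast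
    obtain \<Gamma> :: "nat monoid" where \<Gamma>: "is_galois_group_over \<Gamma> k" "is_normal_subgroup_of H \<Gamma>"
      using iv H(1,2) by blast
    have "group \<Gamma>" using \<Gamma>(1) by (simp add: is_galois_group_over_def finite_group_def)
    then obtain r where "r \<in> epi \<Gamma> H" using complete_normal_retract[OF H(2) \<Gamma>(2)] by blast
    \<comment> \<open>The quotient lemma serves twice: along the retraction onto \<open>H\<close>
      here, and then along the cover of \<open>G\<close> by \<open>H\<close>.\<close>
    then have "is_galois_group_over H k" using galois_quotient[OF \<Gamma>(1)] H(1) by blast
    then show "is_galois_group_over G k" using galois_quotient H(3) G by blast
  qed
  ultimately show ?thesis by (intro conjI iffI) blast+
qed

end
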